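(* Let $A,B:\mathrm{dom}\,A\to\mathbb{R}^{m_\zeta\times m_\zeta}$ be hybrid signals with the same hybrid time domain $\mathrm{dom}\,A=\mathrm{dom}\,B$, let $\nu:\mathrm{dom}\,A\to\mathbb{R}^{m_\zeta}$, and consider the hybrid system $$\mathcal{H}'_\nu:\quad\begin{cases}\dot\zeta=-A(t,j)\zeta+\nu(t,j), & t\in\mathrm{int}(I^j_A),\\ \zeta^+=[I_{m_\zeta}-B(t,j)]\zeta+\nu(t,j), & (t,j),(t,j+1)\in\mathrm{dom}\,A,\end{cases}$$ where $\mathcal{H}'_0$ denotes the system with $\nu\equiv0$. Assume that: (1) (Lyapunov non-strict inequalities) there exist a symmetric matrix function $P:\mathrm{dom}\,A\to\mathbb{R}^{m_\zeta\times m_\zeta}$, constants $p_1,p_2>0$ with $p_1I_{m_\zeta}\le P(t,j)\le p_2I_{m_\zeta}$ for all $(t,j)\in\mathrm{dom}\,A$, and symmetric positive semidefinite matrix functions $Q_c,Q_d:\mathrm{dom}\,A\to\mathbb{R}^{m_\zeta\times m_\zeta}$ such that $$\dot P(t,j)-A(t,j)^\top P(t,j)-P(t,j)A(t,j)\le-Q_c(t,j)\quad\text{for all }t\in\mathrm{int}(I^j_A),$$ $$[I_{m_\zeta}-B(t,j)]^\top P(t,j+1)[I_{m_\zeta}-B(t,j)]-P(t,j)\le-Q_d(t,j)$$ for all $(t,j)\in\mathrm{dom}\,A$ such that $(t,j+1)\in\mathrm{dom}\,A$; (2) (uniform boundedness) there exist $\bar A,\bar B>0$ such that $|A(t,j)|\le\bar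 A$ and $|B(t,j)|\le\bar B$ for all $(t,j)\in\mathrm{dom}\,A$; (3) the pair $(A,B)$ is hybrid uniformly observable (HUO) with these $Q_c,Q_d$. Then the origin $\{\zeta=0\}$ is uniformly exponentially stable (UES) for $\mathcal{H}'_0$, and $\mathcal{H}'_\nu$ is input-to-state stable (ISS) with respect to $\nu$.
   Context: Hybrid time domains. A hybrid signal is a function on a hybrid time domain $\mathrm{dom}\subset\mathbb{R}_{\ge0}\times\mathbb{Z}_{\ge0}$, i.e. a set such that for each $(T,J)$ in it, its intersection with $[0,T]\times\{0,\dots,J\}$ is $\bigcup_{j=0}^J[t_j,t_{j+1}]\times\{j\}$ for some $0=t_0\le\dots\le t_{J+1}=T$. Put $I^j_A:=\{t:(t,j)\in\mathrm{dom}\,A\}$. A hybrid arc is a hybrid signal that is locally absolutely continuous in $t$ on each $I^j$. Solutions $\zeta$ to $\mathcal{H}'_\nu$, starting from $\zeta_o\in\mathbb{R}^{m_\zeta}$ at $(t_o,j_o)\in\mathrm{dom}\,A$, are hybrid arcs whose domain is the part of $\mathrm{dom}\,A$ from $(t_o,j_o)$ on (or a portion of it), satisfying the differential equation for almost all $t\in I^j_A$ and $\zeta(t,j+1)=[I-B(t,j)]\zeta(t,j)+\nu(t,j)$ at the jumps; they jump exactly when $A$ jumps. $|\cdot|$ is the Euclidean (induced) norm; matrix inequalities are in the semidefinite order. Hybrid integral. For $(t,j)\in\mathrm{dom}\,\phi$ and $K\in\mathbb{R}_{>0}\cup\{+\infty\}$, $E^\phi_{t,j,K}\subset\mathrm{dom}\,\phi$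 is the shortest hybrid time domain starting from $(t,j)$, contained in $\mathrm{dom}\,\phi$, of length (elapsed ordinary time plus number of jumps) at least $K$; $E^\phi_{t,j,\infty}$ is the whole part of $\mathrm{dom}\,\phi$ from $(t,j)$ on. Writing $E^\phi_{t,j,K}=\bigcup_{i=j}^{m_K}[t_i,t_{i+1}]\times\{i\}$ with $t_j:=t$, $$\int_{E^\phi_{t,j,K}}g(s,i)\,d(s,i):=\sum_{i=j}^{m_K}\int_{t_i}^{t_{i+1}}g(s,i)\,ds+\sum_{i=j}^{m_K-1}g(t_{i+1},i).$$ Transition matrix. $\mathcal{M}((t,j),(t_o,j_o))$ is the hybrid transition matrix of $\mathcal{H}'_0$: $\dot{\mathcal{M}}((t,j),(t_o,j_o))=-A(t,j)\mathcal{M}((t,j),(t_o,j_o))$ for $t\in I^j_A$; $\mathcal{M}((t,j+1),(t_o,j_o))=[I_{m_\zeta}-B(t,j)]\mathcal{M}((t,j),(t_o,j_o))$ when $(t,j),(t,j+1)\in\mathrm{dom}\,A$; $\mathcal{M}((t_o,j_o),(t_o,j_o))=I_{m_\zeta}$. HUO. With $Q_c,Q_d$ as in (1), set $\Phi(t,j):=Q_c(t,j)$ if $t\in\mathrm{int}(I^j_A)$ and $\Phi(t,j):=Q_d(t,j)$ otherwise. The pair $(A,B)$ is HUO if there exist $K,\mu>0$ such that for each $(t_o,j_o)\in\mathrm{dom}\,A$ $$\int_{E^A_{t_o,j_o,K}}\mathcal{M}((s,i),(t_o,j_o))^\top\Phi(s,i)\,\mathcal{M}((s,i),(t_o,j_o))\,d(s,i)\ge\mu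 I_{m_\zeta}.$$ UES. The origin is UES for $\mathcal{H}'_0$ if there exist $\kappa,\lambda>0$, independent of $(t_o,j_o)$ and $\zeta_o$, such that every solution $\zeta$ starting at $(t_o,j_o)$ from $\zeta_o$ satisfies $|\zeta(t,j)|\le\kappa|\zeta_o|e^{-\lambda(t+j-t_o-j_o)}$ for all $(t,j)\in\mathrm{dom}\,\zeta$. ISS. $\mathcal{H}'_\nu$ is ISS with respect to $\nu$ if there exist a class $\mathcal{K}_\infty$ function $\alpha$ and a class $\mathcal{KL}$ function $\beta$ such that each solution $\zeta$ to $\mathcal{H}'_\nu$ starting from $\zeta_o$ at $(t_o,j_o)\in\mathrm{dom}\,A$ satisfies $$|\zeta(t,j)|\le\beta(|\zeta_o|,t+j-t_o-j_o)+\alpha\big(\sup\{|\nu(s,i)|:(s,i)\in\mathrm{dom}\,\zeta\setminus E^\zeta_{t,j,\infty}\}\big)$$ for all $(t,j)\in E^\zeta_{t_o,j_o,\infty}$.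
   Formalization: P(t,j) is additionally assumed continuous in t on each interval I^j up to its endpoints; with P merely differentiable on int(I^j), P could jump up at an endpoint and the claim fails. *)

theory Defs
  imports "HOL-Analysis.Analysis"
begin

text \<open>
  Matrices are elements of \<open>real^'n^'n\<close> and hybrid signals are total functions
  \<open>real \<Rightarrow> nat \<Rightarrow> 'a\<close> together with an explicit hybrid time domain; every condition below
  only refers to the values of a signal on its domain.
\<close>

section \<open>Matrices in the semidefinite order\<close>

definition sym_matrix :: "real^'n^'n \<Rightarrow> bool" where
  "sym_matrix X \<longleftrightarrow> transpose X = X"

definition psd :: "real^'n^'n \<Rightarrow> bool" where
  "psd X \<longleftrightarrow> sym_matrix X \<and> (\<forall>x. 0 \<le> x \<bullet> (X *v x))"

definition psd_le :: "real^'n^'n \<Rightarrow> real^'n^'n \<Rightarrow> bool" (infix "\<preceq>" 50) where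
  "X \<preceq> Y \<longleftrightarrow> psd (Y - X)"

text \<open>
  The instance \<open>norm\<close> on \<open>real^'n^'n\<close> is the Frobenius norm; the norm induced by the
  Euclidean norm is the operator norm.
\<close>

definition matrix_norm :: "real^'n^'n \<Rightarrow> real" where
  "matrix_norm X = onorm (\<lambda>x. X *v x)"

section \<open>Hybrid time domains\<close>

definition segment :: "(nat \<Rightarrow> real) \<Rightarrow> nat \<Rightarrow> nat \<Rightarrow> (real \<times> nat) set" where
  "segment \<tau> j m = (\<Union>i\<in>{j..m}. {\<tau> i..\<tau> (Suc i)} \<times> {i})"

definition hybrid_time_domain_from :: "real \<Rightarrow> nat \<Rightarrow> (real \<times> nat) set \<Rightarrow> bool" where
  "hybrid_time_domain_from t0 j0 D \<longleftrightarrow>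
     D \<subseteq> {t0..} \<times> {j0..} \<and>
     (\<forall>(T, J) \<in> D. \<exists>\<tau>. \<tau> j0 = t0 \<and> (\<forall>i\<in>{j0..J}. \<tau> i \<le> \<tau> (Suc i)) \<and> \<tau> (Suc J) = T \<and>
        D \<inter> ({t0..T} \<times> {j0..J}) = segment \<tau> j0 J)"

definition hybrid_time_domain :: "(real \<times> nat) set \<Rightarrow> bool" where
  "hybrid_time_domain D \<longleftrightarrow> hybrid_time_domain_from 0 0 D"

text \<open>The set \<open>I\<^sup>j\<close> of ordinary times at which the jump counter equals \<open>j\<close>.\<close>

definition flow_times :: "(real \<times> nat) set \<Rightarrow> nat \<Rightarrow> real set" where
  "flow_times D j = {t. (t, j) \<in> D}"

text \<open>The part of \<open>D\<close> from \<open>(t, j)\<close> on.\<close>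

definition tail_from :: "(real \<times> nat) set \<Rightarrow> real \<Rightarrow> nat \<Rightarrow> (real \<times> nat) set" where
  "tail_from D t j = {(s, i) \<in> D. t \<le> s \<and> j \<le> i}"

section \<open>Hybrid arcs and solutions\<close>

text \<open>Absolute continuity on the compact interval \<open>{a..b}\<close>, by finite families of
  non-overlapping subintervals.\<close>

definition abs_continuous :: "real \<Rightarrow> real \<Rightarrow> (real \<Rightarrow> 'a::real_normed_vector) \<Rightarrow> bool" where
  "abs_continuous a b f \<longleftrightarrow>
     (\<forall>\<epsilon>>0. \<exists>\<delta>>0. \<forall>(n::nat) u v.
        (\<forall>k<n. a \<le> u k \<and> u k \<le> v k \<and> v k \<le> b) \<and>
        (\<forall>k<n. \<forall>l<n. k \<noteq> l \<longrightarrow> {u k<..<v k} \<inter> {u l<..<v l} = {}) \<and>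
        (\<Sum>k<n. v k - u k) < \<delta>
        \<longrightarrow> (\<Sum>k<n. norm (f (v k) - f (u k))) < \<epsilon>)"

definition locally_abs_continuous ::
  "(real \<times> nat) set \<Rightarrow> (real \<Rightarrow> nat \<Rightarrow> 'a::real_normed_vector) \<Rightarrow> bool" where
  "locally_abs_continuous D z \<longleftrightarrow>
     (\<forall>j a b. a \<le> b \<and> {a..b} \<subseteq> flow_times D j \<longrightarrow> abs_continuous a b (\<lambda>t. z t j))"

text \<open>
  \<open>solution D A B \<nu> t0 j0 z0 E z\<close>: \<open>z\<close>, with domain \<open>E\<close>, is a solution starting from \<open>z0\<close> at
  \<open>(t0, j0)\<close>. As \<open>E\<close> is a hybrid time domain contained in \<open>D\<close>, it cannot flow past a jump
  of \<open>D\<close> or jump where \<open>D\<close> does not, and it may be only an initial portion of the part of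
  \<open>D\<close> from \<open>(t0, j0)\<close> on.
\<close>

definition solution ::
  "(real \<times> nat) set \<Rightarrow> (real \<Rightarrow> nat \<Rightarrow> real^'n^'n) \<Rightarrow> (real \<Rightarrow> nat \<Rightarrow> real^'n^'n) \<Rightarrow>
   (real \<Rightarrow> nat \<Rightarrow> real^'n) \<Rightarrow> real \<Rightarrow> nat \<Rightarrow> real^'n \<Rightarrow>
   (real \<times> nat) set \<Rightarrow> (real \<Rightarrow> nat \<Rightarrow> real^'n) \<Rightarrow> bool" where
  "solution D A B \<nu> t0 j0 z0 E z \<longleftrightarrow>
     hybrid_time_domain_from t0 j0 E \<and> (t0, j0) \<in> E \<and> E \<subseteq> D \<and>
     locally_abs_continuous E z \<and> z t0 j0 = z0 \<and>
     (\<forall>j. AE t in lebesgue. t \<in> interior (flow_times E j) \<longrightarrow>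
        ((\<lambda>s. z s j) has_vector_derivative (- (A t j *v z t j) + \<nu> t j)) (at t)) \<and>
     (\<forall>t j. (t, j) \<in> E \<and> (t, Suc j) \<in> E \<longrightarrow>
        z t (Suc j) = (mat 1 - B t j) *v z t j + \<nu> t j)"

text \<open>
  \<open>M (t, j) (t0, j0)\<close> is only specified forward in hybrid time, since the jump maps may be
  singular; there it is unique when \<open>A\<close> is bounded. The differential equation is required
  almost everywhere, as for solutions.
\<close>

definition transition_matrix ::
  "(real \<times> nat) set \<Rightarrow> (real \<Rightarrow> nat \<Rightarrow> real^'n^'n) \<Rightarrow> (real \<Rightarrow> nat \<Rightarrow> real^'n^'n) \<Rightarrow>
   (real \<times> nat \<Rightarrow> real \<times> nat \<Rightarrow> real^'n^'n) \<Rightarrow> bool" where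
  "transition_matrix D A B M \<longleftrightarrow>
     (\<forall>(t0, j0) \<in> D.
        locally_abs_continuous (tail_from D t0 j0) (\<lambda>t j. M (t, j) (t0, j0)) \<and>
        M (t0, j0) (t0, j0) = mat 1 \<and>
        (\<forall>j. AE t in lebesgue. t \<in> interior (flow_times (tail_from D t0 j0) j) \<longrightarrow>
           ((\<lambda>s. M (s, j) (t0, j0)) has_vector_derivative
              - (A t j ** M (t, j) (t0, j0))) (at t)) \<and>
        (\<forall>t j. (t, j) \<in> tail_from D t0 j0 \<and> (t, Suc j) \<in> tail_from D t0 j0 \<longrightarrow>
           M (t, Suc j) (t0, j0) = (mat 1 - B t j) ** M (t, j) (t0, j0)))"

section \<open>Hybrid uniform observability\<close>

definition segment_in :: "(real \<times> nat) set \<Rightarrow> real \<Rightarrow> nat \<Rightarrow> (nat \<Rightarrow> real) \<Rightarrow> nat \<Rightarrow> bool" where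
  "segment_in D t j \<tau> m \<longleftrightarrow>
     j \<le> m \<and> \<tau> j = t \<and> (\<forall>i\<in>{j..m}. \<tau> i \<le> \<tau> (Suc i)) \<and> segment \<tau> j m \<subseteq> D"

definition segment_length :: "(nat \<Rightarrow> real) \<Rightarrow> nat \<Rightarrow> nat \<Rightarrow> real" where
  "segment_length \<tau> j m = (\<tau> (Suc m) - \<tau> j) + real (m - j)"

text \<open>
  \<open>shortest_segment D t j K \<tau> m\<close>: the set \<open>segment \<tau> j m\<close> is the shortest hybrid time domain
  starting from \<open>(t, j)\<close>, contained in \<open>D\<close>, of length at least \<open>K\<close>. For a hybrid time domain
  \<open>D\<close>, this determines \<open>m\<close> and \<open>\<tau>\<close> on \<open>{j..Suc m}\<close>.
\<close>

definition shortest_segment ::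
  "(real \<times> nat) set \<Rightarrow> real \<Rightarrow> nat \<Rightarrow> real \<Rightarrow> (nat \<Rightarrow> real) \<Rightarrow> nat \<Rightarrow> bool" where
  "shortest_segment D t j K \<tau> m \<longleftrightarrow>
     segment_in D t j \<tau> m \<and> K \<le> segment_length \<tau> j m \<and>
     (\<forall>\<sigma> n. segment_in D t j \<sigma> n \<and> K \<le> segment_length \<sigma> j n \<longrightarrow>
        segment_length \<tau> j m \<le> segment_length \<sigma> j n)"

definition hybrid_integrable ::
  "(nat \<Rightarrow> real) \<Rightarrow> nat \<Rightarrow> nat \<Rightarrow> (real \<Rightarrow> nat \<Rightarrow> 'a::euclidean_space) \<Rightarrow> bool" where
  "hybrid_integrable \<tau> j m g \<longleftrightarrow>
     (\<forall>i\<in>{j..m}. (\<lambda>s. g s i) integrable_on {\<tau> i..\<tau> (Suc i)})"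

definition hybrid_integral ::
  "(nat \<Rightarrow> real) \<Rightarrow> nat \<Rightarrow> nat \<Rightarrow> (real \<Rightarrow> nat \<Rightarrow> 'a::euclidean_space) \<Rightarrow> 'a" where
  "hybrid_integral \<tau> j m g =
     (\<Sum>i=j..m. integral {\<tau> i..\<tau> (Suc i)} (\<lambda>s. g s i)) + (\<Sum>i=j..<m. g (\<tau> (Suc i)) i)"

definition Phi ::
  "(real \<times> nat) set \<Rightarrow> (real \<Rightarrow> nat \<Rightarrow> real^'n^'n) \<Rightarrow> (real \<Rightarrow> nat \<Rightarrow> real^'n^'n) \<Rightarrow>
   real \<Rightarrow> nat \<Rightarrow> real^'n^'n" where
  "Phi D Qc Qd t j = (if t \<in> interior (flow_times D j) then Qc t j else Qd t j)"

text \<open>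
  The existence of the transition matrix, of the shortest segment and of the integral is
  part of the property.
\<close>

definition HUO ::
  "(real \<times> nat) set \<Rightarrow> (real \<Rightarrow> nat \<Rightarrow> real^'n^'n) \<Rightarrow> (real \<Rightarrow> nat \<Rightarrow> real^'n^'n) \<Rightarrow>
   (real \<Rightarrow> nat \<Rightarrow> real^'n^'n) \<Rightarrow> (real \<Rightarrow> nat \<Rightarrow> real^'n^'n) \<Rightarrow> bool" where
  "HUO D A B Qc Qd \<longleftrightarrow>
     (\<exists>M. transition_matrix D A B M \<and>
       (\<exists>K>0. \<exists>\<mu>>0. \<forall>(t0, j0) \<in> D. \<exists>\<tau> m.
          shortest_segment D t0 j0 K \<tau> m \<and>
          (let g = (\<lambda>s i. transpose (M (s, i) (t0, j0)) ** Phi D Qc Qd s i ** M (s, i) (t0, j0))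
           in hybrid_integrable \<tau> j0 m g \<and> mat \<mu> \<preceq> hybrid_integral \<tau> j0 m g)))"

section \<open>Stability notions\<close>

definition UES ::
  "(real \<times> nat) set \<Rightarrow> (real \<Rightarrow> nat \<Rightarrow> real^'n^'n) \<Rightarrow> (real \<Rightarrow> nat \<Rightarrow> real^'n^'n) \<Rightarrow> bool" where
  "UES D A B \<longleftrightarrow>
     (\<exists>\<kappa>>0. \<exists>\<gamma>>0. \<forall>t0 j0 z0 E z. (t0, j0) \<in> D \<and> solution D A B (\<lambda>_ _. 0) t0 j0 z0 E z \<longrightarrow>
        (\<forall>(t, j) \<in> E. norm (z t j) \<le> \<kappa> * norm z0 * exp (- \<gamma> * (t + real j - t0 - real j0))))"

definition class_K :: "(real \<Rightarrow> real) \<Rightarrow> bool" where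
  "class_K \<alpha> \<longleftrightarrow> continuous_on {0..} \<alpha> \<and> strict_mono_on {0..} \<alpha> \<and> \<alpha> 0 = 0"

definition class_K_inf :: "(real \<Rightarrow> real) \<Rightarrow> bool" where
  "class_K_inf \<alpha> \<longleftrightarrow> class_K \<alpha> \<and> filterlim \<alpha> at_top at_top"

definition class_KL :: "(real \<Rightarrow> real \<Rightarrow> real) \<Rightarrow> bool" where
  "class_KL \<beta> \<longleftrightarrow>
     continuous_on ({0..} \<times> {0..}) (\<lambda>(r, s). \<beta> r s) \<and>
     (\<forall>s\<ge>0. class_K (\<lambda>r. \<beta> r s)) \<and>
     (\<forall>r\<ge>0. antimono_on {0..} (\<beta> r) \<and> (\<beta> r \<longlongrightarrow> 0) at_top)"

text \<open>
  The gains do not depend on the input \<open>\<nu>\<close>. The supremum is that of a set of nonnegative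
  numbers: it is \<open>0\<close> for the empty set (hence \<open>insert 0\<close>), and if it is infinite then the
  estimate holds trivially (hence \<open>bdd_above\<close>).
\<close>

definition ISS ::
  "(real \<times> nat) set \<Rightarrow> (real \<Rightarrow> nat \<Rightarrow> real^'n^'n) \<Rightarrow> (real \<Rightarrow> nat \<Rightarrow> real^'n^'n) \<Rightarrow> bool" where
  "ISS D A B \<longleftrightarrow>
     (\<exists>\<alpha> \<beta>. class_K_inf \<alpha> \<and> class_KL \<beta> \<and>
       (\<forall>\<nu> t0 j0 z0 E z. (t0, j0) \<in> D \<and> solution D A B \<nu> t0 j0 z0 E z \<longrightarrow>
          (\<forall>(t, j) \<in> tail_from E t0 j0.
             let N = (\<lambda>(s, i). norm (\<nu> s i)) ` (E - tail_from E t j) in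
             bdd_above N \<longrightarrow>
             norm (z t j) \<le> \<beta> (norm z0) (t + real j - t0 - real j0) + \<alpha> (Sup (insert 0 N)))))"

end

theory Submission
  imports Defs
begin

text \<open>
  Along an unforced solution the Lyapunov function \<open>V = \<zeta> \<bullet> P \<zeta>\<close> never increases, and the non-strict
  inequalities say that its loss over a stretch of hybrid time is at least the hybrid integral of
  \<open>\<zeta> \<bullet> \<Phi> \<zeta>\<close>. As \<open>\<zeta>\<close> is the transition matrix applied to its initial value, observability bounds
  that integral below by \<open>\<mu> |\<zeta>|\<^sup>2\<close>, hence by a fixed fraction of \<open>V\<close>: over each observability window,
  of length between \<open>K\<close> and \<open>K + 1\<close>, the function \<open>V\<close> contracts by a fixed factor below one. Under an
  input, the solution is compared over the window with the unforced arc that starts at the same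
  point. Since \<open>A\<close> and \<open>B\<close> are bounded and the window is short, the difference is at most a constant
  times the supremum of the input, and a weighted Young inequality gives
  \<open>V\<^sub>e\<^sub>n\<^sub>d \<le> \<rho> V\<^sub>s\<^sub>t\<^sub>a\<^sub>r\<^sub>t + c N\<^sup>2\<close> with \<open>\<rho> < 1\<close> (lemma \<open>window_contraction\<close>). Iterating over
  windows yields a bound on \<open>|\<zeta>|\<^sup>2\<close> with an exponentially decaying term and a term in \<open>N\<^sup>2\<close>
  (lemma \<open>solution_decay\<close>). Exponential stability is the case \<open>N = 0\<close>, and input-to-state stability
  follows by taking square roots.

  Two points need care. First, \<open>A\<close> and the input need not be measurable in time, and \<open>P\<close>
  is differentiable with a derivative that need not be integrable a priori, so \<open>V\<close> is not treated by
  Lebesgue integration. The Lyapunov inequality does bound \<open>P'\<close> from above, so that \<open>V\<close> satisfies the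
  upper half of absolute continuity; a gauge argument shows that this suffices to integrate an upper
  bound on the derivative (theorem \<open>upper_fundamental_theorem\<close>). The same theorem, with a scalar
  multiple of the identity for \<open>P\<close>, gives the Gronwall estimates.

  Second, the definition of a hybrid time domain constrains only the part of the domain below each of
  its points, and admits a branching: from one point the domain may both continue to flow and
  jump on at the same instant. For instance, \<open>[0, \<infinity>) \<times> {0}\<close> together with \<open>{1} \<times> \<nat>\<close> is a hybrid
  time domain. An observability window may then follow the other branch than the solution. There is
  at most one such point, and theorem \<open>split_at_branch\<close> cuts the way of a solution into a piece before
  it, a step of length at most one, and a piece after it; windows are harmless on both pieces, and the
  step costs only a constant factor.
\<close>

section \<open>A fundamental theorem of calculus for one-sided absolute continuity\<close>

definition nonoverlapping_family :: "real \<Rightarrow> real \<Rightarrow> nat \<Rightarrow> (nat \<Rightarrow> real) \<Rightarrow> (nat \<Rightarrow> real) \<Rightarrow> bool" where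
  "nonoverlapping_family a b n u v \<longleftrightarrow>
     (\<forall>k<n. a \<le> u k \<and> u k \<le> v k \<and> v k \<le> b) \<and>
     (\<forall>k<n. \<forall>l<n. k \<noteq> l \<longrightarrow> {u k<..<v k} \<inter> {u l<..<v l} = {})"

text \<open>
  Only the increments \<open>f (v k) - f (u k)\<close> themselves, without absolute value, are required to be small.
  A function that falls steeply, as \<open>z \<bullet> (P z)\<close> may where \<open>P'\<close> is very negative, still qualifies.
\<close>

definition upper_abs_continuous :: "real \<Rightarrow> real \<Rightarrow> (real \<Rightarrow> real) \<Rightarrow> bool" where
  "upper_abs_continuous a b f \<longleftrightarrow>
     (\<forall>\<epsilon>>0. \<exists>\<delta>>0. \<forall>n u v. nonoverlapping_family a b n u v \<and> (\<Sum>k<n. v k - u k) < \<delta>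
        \<longrightarrow> (\<Sum>k<n. f (v k) - f (u k)) < \<epsilon>)"

lemma Inf_Sup_of_tagged_interval:
  fixes K :: "real set"
  assumes "p tagged_partial_division_of {a..b}" "(x, K) \<in> p"
  shows "K = {Inf K..Sup K}" "a \<le> Inf K" "Inf K \<le> x" "x \<le> Sup K" "Sup K \<le> b"
    "measure lborel K = Sup K - Inf K"
proof -
  note tp = tagged_partial_division_ofD[OF assms(1)]
  obtain u v where K: "K = {u..v}"
    using tp(4)[OF assms(2)] by (metis box_real(2))
  have x: "u \<le> x" "x \<le> v" and ab: "{u..v} \<subseteq> {a..b}"
    using tp(2,3)[OF assms(2)] K by auto
  with K show "K = {Inf K..Sup K}" "a \<le> Inf K" "Inf K \<le> x" "x \<le> Sup K" "Sup K \<le> b"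
    "measure lborel K = Sup K - Inf K"
    by auto
qed

text \<open>
  The non-overlapping families behind absolute continuity are indexed by numbers, those of the gauge
  integral by tagged intervals; an enumeration of the tagged intervals translates one into the other.
\<close>

lemma nonoverlapping_sum_over_tagged_partial_division:
  fixes f :: "real \<Rightarrow> real"
  assumes q: "q tagged_partial_division_of {a..b}"
    and small: "\<And>n u v. nonoverlapping_family a b n u v \<Longrightarrow> (\<Sum>k<n. v k - u k) < \<delta>
                  \<Longrightarrow> (\<Sum>k<n. f (v k) - f (u k)) < \<epsilon>"
    and len: "(\<Sum>(x, K)\<in>q. measure lborel K) < \<delta>"
  shows "(\<Sum>(x, K)\<in>q. f (Sup K) - f (Inf K)) < \<epsilon>"
proof -
  note tp = tagged_partial_division_ofD[OF q]
  obtain h where h: "bij_betw h {..<card q} q"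
    using ex_bij_betw_nat_finite[OF tp(1)] by (auto simp: atLeast0LessThan)
  define u v where "u = (\<lambda>k. Inf (snd (h k)))" and "v = (\<lambda>k. Sup (snd (h k)))"
  have hq: "(fst (h k), snd (h k)) \<in> q" if "k < card q" for k
    using bij_betwE[OF h] that by auto
  note int = Inf_Sup_of_tagged_interval[OF q hq]
  have "{u k<..<v k} \<inter> {u l<..<v l} = {}" if "k < card q" "l < card q" "k \<noteq> l" for k l
  proof -
    have "h k \<noteq> h l"
      using h that unfolding bij_betw_def inj_on_def by auto
    then have "(fst (h k), snd (h k)) \<noteq> (fst (h l), snd (h l))"
      by simp
    from tp(5)[OF hq[OF that(1)] hq[OF that(2)] this] 
    have "interior (snd (h k)) \<inter> interior (snd (h l)) = {}" .
    moreover have "interior (snd (h i)) = {u i<..<v i}" if "i < card q" for i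
      using arg_cong[OF int(1)[OF that], of interior] by (simp add: u_def v_def interior_atLeastAtMost_real)
    ultimately show ?thesis using that by simp
  qed
  moreover have "a \<le> u k \<and> u k \<le> v k \<and> v k \<le> b" if "k < card q" for k
    using int(2-5)[OF that] unfolding u_def v_def by linarith
  ultimately have fam: "nonoverlapping_family a b (card q) u v"
    unfolding nonoverlapping_family_def by blast
  have "(\<Sum>k<card q. v k - u k) = (\<Sum>k<card q. measure lborel (snd (h k)))"
    by (rule sum.cong) (auto simp: int(6) u_def v_def)
  also have "\<dots> = (\<Sum>(x, K)\<in>q. measure lborel K)"
    using sum.reindex_bij_betw[OF h, of "\<lambda>y. measure lborel (snd y)"] by (simp add: case_prod_beta)
  finally have "(\<Sum>k<card q. f (v k) - f (u k)) < \<epsilon>"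
    using small[OF fam] len by simp
  then show ?thesis
    using sum.reindex_bij_betw[OF h, of "\<lambda>y. f (Sup (snd y)) - f (Inf (snd y))"]
    by (simp add: case_prod_beta u_def v_def)
qed

text \<open>
  The interval straddles \<open>x\<close>, as it does in a tagged division; this is what allows differentiability at
  the single point \<open>x\<close> to control the increment over the whole interval.
\<close>

lemma upper_derivative_estimate:
  fixes f :: "real \<Rightarrow> real"
  assumes der: "(f has_real_derivative d) (at x)" and "\<epsilon> > 0"
  shows "\<exists>r>0. \<forall>u v. u \<in> ball x r \<and> v \<in> ball x r \<and> u \<le> x \<and> x \<le> v
           \<longrightarrow> f v - f u \<le> (d + \<epsilon>) * (v - u)"
proof -
  have "(f has_derivative (\<lambda>h. d * h)) (at x within UNIV)"
    using der by (simp add: has_field_derivative_def)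
  then obtain r where "r > 0"
    and r: "\<And>y. norm (y - x) < r \<Longrightarrow> norm (f y - f x - d * (y - x)) \<le> \<epsilon> * norm (y - x)"
    unfolding has_derivative_within_alt using \<open>\<epsilon> > 0\<close> by blast
  have "f v - f u \<le> (d + \<epsilon>) * (v - u)"
    if "u \<in> ball x r" "v \<in> ball x r" "u \<le> x" "x \<le> v" for u v
  proof -
    have "\<bar>f v - f x - d * (v - x)\<bar> \<le> \<epsilon> * (v - x)" "\<bar>f u - f x - d * (u - x)\<bar> \<le> \<epsilon> * (x - u)"
      using r[of v] r[of u] that by (auto simp: dist_real_def)
    then show ?thesis
      by (auto simp: algebra_simps abs_le_iff)
  qed
  with \<open>r > 0\<close> show ?thesis by blast
qed

text \<open>
  For a fine tagged division, the intervals whose tag is a point with \<open>f' \<le> g\<close> contribute at most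
  the Riemann sum of \<open>g\<close>, up to \<open>\<epsilon>\<close> times the length. The other tags form a null set; their intervals lie in an
  open set of small measure, so the hypothesis on \<open>f\<close> makes their total contribution small.
\<close>

theorem upper_fundamental_theorem:
  fixes f g :: "real \<Rightarrow> real"
  assumes "a \<le> b"
    and uac: "upper_abs_continuous a b f"
    and der: "AE t in lebesgue. t \<in> {a<..<b} \<longrightarrow> (\<exists>d. (f has_real_derivative d) (at t) \<and> d \<le> g t)"
    and int: "g integrable_on {a..b}"
  shows "f b - f a \<le> integral {a..b} g"
proof (rule field_le_epsilon)
  fix e :: real assume "e > 0"
  define \<epsilon> where "\<epsilon> = e / (b - a + 2)"
  have "\<epsilon> > 0" using \<open>e > 0\<close> \<open>a \<le> b\<close> by (simp add: \<epsilon>_def)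
  obtain N0 where N0: "negligible N0" and
    N0': "\<And>t. t \<notin> N0 \<Longrightarrow> t \<in> {a<..<b} \<Longrightarrow> \<exists>d. (f has_real_derivative d) (at t) \<and> d \<le> g t"
    using der unfolding eventually_ae_filter_negligible by blast
  \<comment> \<open>the end points have no two-sided derivative, so they join the exceptional set\<close>
  define N where "N = N0 \<union> {a, b}"
  have negN: "negligible N"
    using N0 unfolding N_def by (simp add: negligible_Un)
  \<comment> \<open>on the exceptional set \<open>g\<close> is replaced by \<open>0\<close>, which leaves the integral unchanged\<close>
  define g' where "g' = (\<lambda>t. if t \<in> N then 0 else g t)"
  have "(g' has_integral integral {a..b} g) {a..b}"
    by (rule has_integral_spike[OF negN _ integrable_integral[OF int]]) (auto simp: g'_def)
  then obtain \<gamma>1 where \<gamma>1: "gauge \<gamma>1" and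
    \<gamma>1': "\<And>p. p tagged_division_of {a..b} \<Longrightarrow> \<gamma>1 fine p \<Longrightarrow>
        norm ((\<Sum>(x, K)\<in>p. measure lborel K *\<^sub>R g' x) - integral {a..b} g) < \<epsilon>"
    using \<open>\<epsilon> > 0\<close> unfolding has_integral_real by meson
  obtain \<delta> where "\<delta> > 0" and \<delta>: "\<And>n u v. nonoverlapping_family a b n u v
      \<Longrightarrow> (\<Sum>k<n. v k - u k) < \<delta> \<Longrightarrow> (\<Sum>k<n. f (v k) - f (u k)) < \<epsilon>"
    using uac \<open>\<epsilon> > 0\<close> unfolding upper_abs_continuous_def by meson
  obtain U where U: "open U" "N \<subseteq> U" "(U - N) \<in> lmeasurable" "emeasure lebesgue (U - N) < ennreal \<delta>"
    using sets_lebesgue_outer_open[OF negligible_imp_sets[OF negN] \<open>\<delta> > 0\<close>] by blast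
  have "N \<in> null_sets lebesgue"
    using negN negligible_iff_null_sets by blast
  then have ns: "N \<in> null_sets lebesgue" .
  have Us: "U \<in> sets lebesgue" using U(1) by simp
  have "U = (U - N) \<union> N" using U(2) by blast
  then have Um: "U \<in> lmeasurable"
    using fmeasurable.Un[OF U(3) fmeasurableI_null_sets[OF ns]] by simp
  have "measure lebesgue U = measure lebesgue (U - N)"
    using measure_Diff_null_set[OF Us ns] by simp
  then have Ud: "measure lebesgue U < \<delta>"
    using U(4) emeasure_eq_measure2[OF U(3)] \<open>0 < \<delta>\<close> by (simp add: ennreal_less_iff)
  have "\<exists>r>0. \<forall>u v. u \<in> ball x r \<and> v \<in> ball x r \<and> u \<le> x \<and> x \<le> v
           \<longrightarrow> f v - f u \<le> (g x + \<epsilon>) * (v - u)" if "x \<in> {a..b} - N" for x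
  proof -
    have "x \<notin> N0" "x \<in> {a<..<b}"
      using that by (auto simp: N_def less_eq_real_def)
    then obtain d where d: "(f has_real_derivative d) (at x)" "d \<le> g x"
      using N0' by blast
    obtain r where "r > 0" and r: "\<And>u v. u \<in> ball x r \<Longrightarrow> v \<in> ball x r \<Longrightarrow> u \<le> x \<Longrightarrow> x \<le> v
           \<Longrightarrow> f v - f u \<le> (d + \<epsilon>) * (v - u)"
      using upper_derivative_estimate[OF d(1) \<open>\<epsilon> > 0\<close>] by blast
    moreover have "(d + \<epsilon>) * (v - u) \<le> (g x + \<epsilon>) * (v - u)" if "u \<le> x" "x \<le> v" for u v
      using that d(2) by (intro mult_right_mono) auto
    ultimately show ?thesis by (meson order_trans)
  qed
  then obtain r where r0: "\<And>x. x \<in> {a..b} - N \<Longrightarrow> r x > 0" and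
    r: "\<And>x u v. x \<in> {a..b} - N \<Longrightarrow> u \<in> ball x (r x) \<Longrightarrow> v \<in> ball x (r x) \<Longrightarrow> u \<le> x \<Longrightarrow> x \<le> v
           \<Longrightarrow> f v - f u \<le> (g x + \<epsilon>) * (v - u)"
    by metis
  define \<gamma>2 where "\<gamma>2 = (\<lambda>x. if x \<in> N then U else if x \<in> {a..b} then ball x (r x) else UNIV)"
  have "gauge \<gamma>2"
    using U(1,2) r0 by (auto simp: gauge_def \<gamma>2_def)
  then obtain p where p: "p tagged_division_of {a..b}" and "(\<lambda>x. \<gamma>1 x \<inter> \<gamma>2 x) fine p"
    using fine_division_exists_real gauge_Int[OF \<gamma>1] by blast
  then have fine1: "\<gamma>1 fine p" and fine2: "\<gamma>2 fine p"
    by (auto simp: fine_Int)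
  have tp: "p tagged_partial_division_of {a..b}"
    using p by (simp add: tagged_division_of_def)
  have finp: "finite p" using p by auto
  note int = Inf_Sup_of_tagged_interval[OF tp]
  define q where "q = {(x, K) \<in> p. x \<in> N}"
  have "q \<subseteq> p" by (auto simp: q_def)
  have tq: "q tagged_partial_division_of {a..b}"
    by (rule tagged_partial_division_subset[OF tp \<open>q \<subseteq> p\<close>])
  \<comment> \<open>the intervals tagged in the exceptional set are covered by the thin open set\<close>
  have bad: "(\<Sum>(x, K)\<in>q. f (Sup K) - f (Inf K)) < \<epsilon>"
  proof (rule nonoverlapping_sum_over_tagged_partial_division[OF tq])
    show "(\<Sum>k<n. f (v k) - f (u k)) < \<epsilon>"
      if "nonoverlapping_family a b n u v" "(\<Sum>k<n. v k - u k) < \<delta>" for n u v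
      using that by (rule \<delta>)
    note tq' = tagged_partial_division_of_Union_self[OF tq]
    note dq = division_of_tagged_division[OF tq']
    have "(\<Sum>(x, K)\<in>q. measure lborel K) = (\<Sum>K\<in>snd ` q. measure lborel K)"
      by (rule sum.over_tagged_division_lemma[OF tq']) (auto simp: content_eq_0_interior)
    also have "\<dots> = (\<Sum>K\<in>snd ` q. measure lebesgue K)"
    proof (rule sum.cong)
      fix K assume "K \<in> snd ` q"
      then obtain u v where "K = cbox u v" using division_ofD(4)[OF dq] by blast
      then show "measure lborel K = measure lebesgue K" by simp
    qed simp
    also have "\<dots> = measure lebesgue (\<Union>(snd ` q))"
      by (rule content_division[OF dq])
    also have "\<dots> \<le> measure lebesgue U"
    proof (rule measure_mono_fmeasurable[OF _ _ Um])
      show "\<Union>(snd ` q) \<subseteq> U"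
      proof clarify
        fix y x K assume "(x, K) \<in> q" "y \<in> snd (x, K)"
        then show "y \<in> U"
          using fineD[OF fine2, of x K] by (auto simp: q_def \<gamma>2_def)
      qed
      show "\<Union>(snd ` q) \<in> sets lebesgue"
        using lmeasurable_division[OF dq] by (rule fmeasurableD)
    qed
    finally show "(\<Sum>(x, K)\<in>q. measure lborel K) < \<delta>" using Ud by linarith
  qed
  have good: "(\<Sum>(x, K)\<in>p - q. f (Sup K) - f (Inf K)) \<le> (\<Sum>(x, K)\<in>p - q. (g' x + \<epsilon>) * measure lborel K)"
  proof (rule sum_mono, clarify)
    fix x K assume xK: "(x, K) \<in> p" "(x, K) \<notin> q"
    have "x \<in> {a..b}" using tagged_division_ofD(2,3)[OF p xK(1)] by auto
    moreover have "x \<notin> N" using xK by (auto simp: q_def)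
    ultimately have x: "x \<in> {a..b} - N" by simp
    have sub: "K \<subseteq> ball x (r x)"
      using fineD[OF fine2 xK(1)] x by (simp add: \<gamma>2_def)
    have "{Inf K, Sup K} \<subseteq> {Inf K..Sup K}"
      using int(3,4)[OF xK(1)] by auto
    also have "\<dots> = K"
      by (rule int(1)[OF xK(1), symmetric])
    finally have "Inf K \<in> ball x (r x)" "Sup K \<in> ball x (r x)"
      using sub by auto
    then show "f (Sup K) - f (Inf K) \<le> (g' x + \<epsilon>) * measure lborel K"
      using r[OF x] int(3,4,6)[OF xK(1)] x by (simp add: g'_def)
  qed
  have "(\<Sum>(x, K)\<in>p. (g' x + \<epsilon>) * measure lborel K) = (\<Sum>(x, K)\<in>q. (g' x + \<epsilon>) * measure lborel K) + (\<Sum>(x, K)\<in>p - q. (g' x + \<epsilon>) * measure lborel K)"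
    by (subst sum.subset_diff[OF \<open>q \<subseteq> p\<close> finp]) (simp add: add.commute)
  moreover have "(\<Sum>(x, K)\<in>q. (g' x + \<epsilon>) * measure lborel K) \<ge> 0"
    using \<open>\<epsilon> > 0\<close> by (intro sum_nonneg) (auto simp: q_def g'_def)
  moreover have "f b - f a = (\<Sum>(x, K)\<in>q. f (Sup K) - f (Inf K)) + (\<Sum>(x, K)\<in>p - q. f (Sup K) - f (Inf K))"
    unfolding additive_tagged_division_1[OF \<open>a \<le> b\<close> p, of f, symmetric]
    by (subst sum.subset_diff[OF \<open>q \<subseteq> p\<close> finp]) (simp add: add.commute)
  ultimately have "f b - f a \<le> \<epsilon> + (\<Sum>(x, K)\<in>p. (g' x + \<epsilon>) * measure lborel K)"
    using bad good by linarith
  also have "(\<Sum>(x, K)\<in>p. (g' x + \<epsilon>) * measure lborel K)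
      = (\<Sum>(x, K)\<in>p. measure lborel K *\<^sub>R g' x) + \<epsilon> * (\<Sum>(x, K)\<in>p. measure lborel K)"
    by (simp add: sum_distrib_left sum.distrib[symmetric] case_prod_beta algebra_simps)
  also have "(\<Sum>(x, K)\<in>p. measure lborel K) = b - a"
    using additive_content_tagged_division[of p a b] p \<open>a \<le> b\<close> by simp
  also have "(\<Sum>(x, K)\<in>p. measure lborel K *\<^sub>R g' x) \<le> integral {a..b} g + \<epsilon>"
    using \<gamma>1'[OF p fine1] by (simp add: abs_less_iff)
  finally have "f b - f a \<le> integral {a..b} g + \<epsilon> * (b - a + 2)"
    by (simp add: algebra_simps)
  also have "\<epsilon> * (b - a + 2) = e" using \<open>a \<le> b\<close> by (simp add: \<epsilon>_def)
  finally show "f b - f a \<le> integral {a..b} g + e" .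
qed

section \<open>Growth of time-varying quadratic forms along absolutely continuous curves\<close>

lemma bounded_bilinear_matrix_vector_mult:
  "bounded_bilinear (\<lambda>(X :: real^'n^'m) x. X *v x)"
  unfolding bilinear_conv_bounded_bilinear[symmetric] bilinear_def
  by (auto simp: linear_iff matrix_vector_mult_add_rdistrib matrix_vector_right_distrib
      matrix_vector_mult_scaleR scaleR_matrix_vector_assoc[symmetric])

lemma norm_matrix_vector_mult_le:
  fixes X :: "real^'n^'n"
  shows "norm (X *v x) \<le> matrix_norm X * norm x"
  unfolding matrix_norm_def by (rule onorm[OF matrix_vector_mul_bounded_linear])

lemma abs_continuousE:
  assumes "abs_continuous a b z" and "\<epsilon> > 0"
  obtains \<delta> where "\<delta> > 0"
    and "\<And>n u v. nonoverlapping_family a b n u v \<Longrightarrow> (\<Sum>k<n. v k - u k) < \<delta>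
           \<Longrightarrow> (\<Sum>k<n. norm (z (v k) - z (u k))) < \<epsilon>"
proof -
  obtain \<delta> where "\<delta> > 0 \<and> (\<forall>(n::nat) u v.
        (\<forall>k<n. a \<le> u k \<and> u k \<le> v k \<and> v k \<le> b) \<and>
        (\<forall>k<n. \<forall>l<n. k \<noteq> l \<longrightarrow> {u k<..<v k} \<inter> {u l<..<v l} = {}) \<and>
        (\<Sum>k<n. v k - u k) < \<delta>
        \<longrightarrow> (\<Sum>k<n. norm (z (v k) - z (u k))) < \<epsilon>)"
    using assms(1)[unfolded abs_continuous_def, rule_format, OF assms(2)] by (rule exE)
  then show thesis
    by (intro that[of \<delta>]) (simp_all add: nonoverlapping_family_def)
qed

lemma abs_continuous_imp_continuous_on:
  assumes "abs_continuous a b z"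
  shows "continuous_on {a..b} z"
  unfolding continuous_on_iff
proof (intro ballI allI impI)
  fix x \<epsilon> :: real assume x: "x \<in> {a..b}" and "\<epsilon> > 0"
  then obtain \<delta> where "\<delta> > 0"
    and \<delta>: "\<And>n u v. nonoverlapping_family a b n u v \<Longrightarrow> (\<Sum>k<n. v k - u k) < \<delta>
           \<Longrightarrow> (\<Sum>k<n. norm (z (v k) - z (u k))) < \<epsilon>"
    using abs_continuousE[OF assms] by blast
  have "dist (z y) (z x) < \<epsilon>" if "y \<in> {a..b}" "dist y x < \<delta>" for y
  proof -
    have short: "norm (z q - z p) < \<epsilon>" if "a \<le> p" "p \<le> q" "q \<le> b" "q - p < \<delta>" for p q
      using \<delta>[of 1 "\<lambda>_. p" "\<lambda>_. q"] that
      by (simp add: nonoverlapping_family_def)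
    show ?thesis
    proof (cases "x \<le> y")
      case True
      then show ?thesis using short[of x y] that x by (simp add: dist_norm)
    next
      case False
      then show ?thesis using short[of y x] that x by (simp add: dist_norm norm_minus_commute)
    qed
  qed
  with \<open>\<delta> > 0\<close> show "\<exists>d>0. \<forall>y\<in>{a..b}. dist y x < d \<longrightarrow> dist (z y) (z x) < \<epsilon>"
    by blast
qed

text \<open>
  Write the increment of \<open>z \<bullet> (P z)\<close> as the change of \<open>P\<close> at the new \<open>z\<close>, bounded above by the growth
  hypothesis, plus the change of \<open>z\<close> at the old \<open>P\<close>, which is at most a constant times
  the increment of the absolutely continuous \<open>z\<close>.
\<close>

lemma upper_abs_continuous_quadratic_form:
  fixes z :: "real \<Rightarrow> real^'n" and P :: "real \<Rightarrow> real^'n^'n"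
  assumes ac: "abs_continuous a b z" and contP: "continuous_on {a..b} P" and "0 \<le> c"
    and growth: "\<And>s t x. a \<le> s \<Longrightarrow> s \<le> t \<Longrightarrow> t \<le> b
                   \<Longrightarrow> x \<bullet> (P t *v x) \<le> x \<bullet> (P s *v x) + c * (t - s) * (norm x)\<^sup>2"
  shows "upper_abs_continuous a b (\<lambda>t. z t \<bullet> (P t *v z t))"
  unfolding upper_abs_continuous_def
proof (intro allI impI)
  fix \<epsilon> :: real assume "\<epsilon> > 0"
  have "bounded (z ` {a..b})" "bounded (P ` {a..b})"
    using abs_continuous_imp_continuous_on[OF ac] contP
    by (auto intro: compact_imp_bounded compact_continuous_image)
  then obtain R Q where "R > 0" and R: "\<And>t. t \<in> {a..b} \<Longrightarrow> norm (z t) \<le> R"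
    and "Q > 0" and Q: "\<And>t. t \<in> {a..b} \<Longrightarrow> norm (P t) \<le> Q"
    unfolding bounded_pos by blast
  obtain K0 where K0: "K0 > 0" "\<And>(X::real^'n^'n) x. norm (X *v x) \<le> norm X * norm x * K0"
    using bounded_bilinear.pos_bounded[OF bounded_bilinear_matrix_vector_mult] by blast
  define C where "C = Q * K0"
  have "C > 0" using \<open>Q > 0\<close> K0(1) by (simp add: C_def)
  have C: "norm (P t *v x) \<le> C * norm x" if "t \<in> {a..b}" for t x
  proof -
    have "norm (P t *v x) \<le> norm (P t) * norm x * K0" by (rule K0(2))
    also have "\<dots> \<le> Q * norm x * K0"
      using Q[OF that] K0(1) by (intro mult_right_mono) auto
    finally show ?thesis by (simp add: C_def mult_ac)
  qed
  have step: "z v \<bullet> (P v *v z v) - z u \<bullet> (P u *v z u)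
      \<le> (c * R\<^sup>2) * (v - u) + (2 * R * C) * norm (z v - z u)"
    if "a \<le> u" "u \<le> v" "v \<le> b" for u v
  proof -
    have uv: "u \<in> {a..b}" "v \<in> {a..b}" using that by auto
    have "(norm (z v))\<^sup>2 \<le> R\<^sup>2"
      using R[OF uv(2)] by (intro power_mono) auto
    then have "c * (v - u) * (norm (z v))\<^sup>2 \<le> c * (v - u) * R\<^sup>2"
      using \<open>0 \<le> c\<close> that by (intro mult_left_mono) auto
    then have "z v \<bullet> (P v *v z v) \<le> z v \<bullet> (P u *v z v) + (c * R\<^sup>2) * (v - u)"
      using growth[OF that, of "z v"] by (simp add: algebra_simps)
    moreover have "z v \<bullet> (P u *v z v) - z u \<bullet> (P u *v z u)
        = (z v - z u) \<bullet> (P u *v z v) + z u \<bullet> (P u *v (z v - z u))"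
      by (simp add: inner_diff_left inner_diff_right matrix_vector_mult_diff_distrib)
    moreover have "(z v - z u) \<bullet> (P u *v z v) \<le> norm (z v - z u) * (C * R)"
    proof -
      have "(z v - z u) \<bullet> (P u *v z v) \<le> norm (z v - z u) * norm (P u *v z v)"
        by (rule norm_cauchy_schwarz)
      also have "\<dots> \<le> norm (z v - z u) * (C * norm (z v))"
        by (intro mult_left_mono C uv) auto
      also have "\<dots> \<le> norm (z v - z u) * (C * R)"
        using \<open>C > 0\<close> by (intro mult_left_mono R uv) auto
      finally show ?thesis .
    qed
    moreover have "z u \<bullet> (P u *v (z v - z u)) \<le> R * (C * norm (z v - z u))"
    proof -
      have "z u \<bullet> (P u *v (z v - z u)) \<le> norm (z u) * norm (P u *v (z v - z u))"
        by (rule norm_cauchy_schwarz)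
      also have "\<dots> \<le> R * (C * norm (z v - z u))"
        using \<open>R > 0\<close> by (intro mult_mono C R uv) auto
      finally show ?thesis .
    qed
    ultimately show ?thesis by (simp add: algebra_simps)
  qed
  define M1 M2 where "M1 = c * R\<^sup>2 + 1" and "M2 = 2 * R * C"
  have M: "M1 > 0" "M2 > 0" "c * R\<^sup>2 \<le> M1"
    using \<open>R > 0\<close> \<open>C > 0\<close> \<open>0 \<le> c\<close> by (auto simp: M1_def M2_def intro: add_nonneg_pos)
  have "\<epsilon> / (2 * M2) > 0" using M \<open>\<epsilon> > 0\<close> by simp
  then obtain \<delta> where "\<delta> > 0"
    and \<delta>: "\<And>n u v. nonoverlapping_family a b n u v \<Longrightarrow> (\<Sum>k<n. v k - u k) < \<delta>
           \<Longrightarrow> (\<Sum>k<n. norm (z (v k) - z (u k))) < \<epsilon> / (2 * M2)"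
    using abs_continuousE[OF ac] by blast
  define \<delta>' where "\<delta>' = min \<delta> (\<epsilon> / (2 * M1))"
  show "\<exists>\<delta>>0. \<forall>n u v. nonoverlapping_family a b n u v \<and> (\<Sum>k<n. v k - u k) < \<delta> \<longrightarrow>
     (\<Sum>k<n. z (v k) \<bullet> (P (v k) *v z (v k)) - z (u k) \<bullet> (P (u k) *v z (u k))) < \<epsilon>"
  proof (intro exI[of _ \<delta>'] conjI allI impI)
    show "\<delta>' > 0" using M \<open>\<delta> > 0\<close> \<open>\<epsilon> > 0\<close> by (simp add: \<delta>'_def)
    fix n u v assume uv: "nonoverlapping_family a b n u v \<and> (\<Sum>k<n. v k - u k) < \<delta>'"
    then have fam: "\<And>k. k < n \<Longrightarrow> a \<le> u k \<and> u k \<le> v k \<and> v k \<le> b"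
      unfolding nonoverlapping_family_def by blast
    have "(\<Sum>k<n. z (v k) \<bullet> (P (v k) *v z (v k)) - z (u k) \<bullet> (P (u k) *v z (u k)))
        \<le> (\<Sum>k<n. M1 * (v k - u k) + M2 * norm (z (v k) - z (u k)))"
    proof (rule sum_mono)
      fix k assume "k \<in> {..<n}"
      then have k: "a \<le> u k" "u k \<le> v k" "v k \<le> b" using fam by auto
      have "(c * R\<^sup>2) * (v k - u k) \<le> M1 * (v k - u k)"
        using M(3) k by (intro mult_right_mono) auto
      then show "z (v k) \<bullet> (P (v k) *v z (v k)) - z (u k) \<bullet> (P (u k) *v z (u k))
          \<le> M1 * (v k - u k) + M2 * norm (z (v k) - z (u k))"
        using step[OF k] by (simp add: M2_def)
    qed
    also have "\<dots> = M1 * (\<Sum>k<n. v k - u k) + M2 * (\<Sum>k<n. norm (z (v k) - z (u k)))"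
      by (simp add: sum.distrib sum_distrib_left)
    also have "\<dots> < M1 * (\<epsilon> / (2 * M1)) + M2 * (\<epsilon> / (2 * M2))"
    proof (rule add_strict_mono)
      show "M1 * (\<Sum>k<n. v k - u k) < M1 * (\<epsilon> / (2 * M1))"
        using uv M(1) by (intro mult_strict_left_mono) (auto simp: \<delta>'_def)
      show "M2 * (\<Sum>k<n. norm (z (v k) - z (u k))) < M2 * (\<epsilon> / (2 * M2))"
        using uv M(2) \<delta>[of n u v]
        by (intro mult_strict_left_mono) (auto simp: \<delta>'_def nonoverlapping_family_def)
    qed
    also have "\<dots> = \<epsilon>" using M by simp
    finally show "(\<Sum>k<n. z (v k) \<bullet> (P (v k) *v z (v k)) - z (u k) \<bullet> (P (u k) *v z (u k))) < \<epsilon>" .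
  qed
qed

lemma quadratic_form_has_derivative:
  fixes P :: "real \<Rightarrow> real^'n^'n"
  assumes "(P has_vector_derivative P') (at t)" and "(z has_vector_derivative z') (at t)"
  shows "((\<lambda>s. z s \<bullet> (P s *v z s)) has_real_derivative
           (z' \<bullet> (P t *v z t) + z t \<bullet> (P' *v z t) + z t \<bullet> (P t *v z'))) (at t)"
proof -
  have "((\<lambda>s. P s *v z s) has_vector_derivative (P t *v z' + P' *v z t)) (at t)"
    using bounded_bilinear.has_vector_derivative[OF bounded_bilinear_matrix_vector_mult assms] .
  from bounded_bilinear.has_vector_derivative[OF bounded_bilinear_inner assms(2) this]
  show ?thesis
    by (simp add: has_real_derivative_iff_has_vector_derivative algebra_simps)
qed

text \<open>
  An upper bound on \<open>P'\<close> as a quadratic form is all that is assumed about the derivative of \<open>P\<close>: it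
  makes \<open>x \<bullet> (P t x) - c t |x|\<^sup>2\<close> nonincreasing by the mean value theorem, which is the growth
  hypothesis of \<open>upper_abs_continuous_quadratic_form\<close>.
\<close>

theorem quadratic_form_growth:
  fixes z :: "real \<Rightarrow> real^'n" and P :: "real \<Rightarrow> real^'n^'n"
  assumes "a \<le> b" and ac: "abs_continuous a b z" and contP: "continuous_on {a..b} P"
    and derP: "\<And>t. t \<in> {a<..<b} \<Longrightarrow> (P has_vector_derivative P' t) (at t)"
    and "0 \<le> c" and P'_le: "\<And>t x. t \<in> {a<..<b} \<Longrightarrow> x \<bullet> (P' t *v x) \<le> c * (norm x)\<^sup>2"
    and rate: "AE t in lebesgue. t \<in> {a<..<b} \<longrightarrow> (\<exists>z'. (z has_vector_derivative z') (at t) \<and>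
       z' \<bullet> (P t *v z t) + z t \<bullet> (P' t *v z t) + z t \<bullet> (P t *v z') \<le> g t)"
    and "g integrable_on {a..b}"
  shows "z b \<bullet> (P b *v z b) \<le> z a \<bullet> (P a *v z a) + integral {a..b} g"
proof -
  have "x \<bullet> (P t *v x) \<le> x \<bullet> (P s *v x) + c * (t - s) * (norm x)\<^sup>2"
    if st: "a \<le> s" "s \<le> t" "t \<le> b" for s t x
  proof -
    let ?h = "\<lambda>r. x \<bullet> (P r *v x) - c * r * (norm x)\<^sup>2"
    have "?h t \<le> ?h s"
    proof (rule DERIV_nonpos_imp_decreasing_open[OF st(2)])
      fix r assume "s < r" "r < t"
      then have r: "r \<in> {a<..<b}" using st by auto
      have "((\<lambda>r. x \<bullet> (P r *v x)) has_real_derivative x \<bullet> (P' r *v x)) (at r)"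
        using quadratic_form_has_derivative[OF derP[OF r] has_vector_derivative_const[of x]]
        by simp
      then have "(?h has_real_derivative (x \<bullet> (P' r *v x) - c * (norm x)\<^sup>2)) (at r)"
        by (auto intro!: derivative_eq_intros)
      then show "\<exists>y. (?h has_real_derivative y) (at r) \<and> y \<le> 0"
        using P'_le[OF r, of x] by force
      next
      have "continuous_on {s..t} P"
        using contP by (rule continuous_on_subset) (use st in auto)
      then have "continuous_on {s..t} (\<lambda>r. P r *v x)"
        by (intro bounded_bilinear.continuous_on[OF bounded_bilinear_matrix_vector_mult] continuous_on_const)
      then show "continuous_on {s..t} ?h"
        by (intro continuous_intros)
    qed
    then show ?thesis by (simp add: algebra_simps)
  qed
  from upper_abs_continuous_quadratic_form[OF ac contP \<open>0 \<le> c\<close> this]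
  have uac: "upper_abs_continuous a b (\<lambda>t. z t \<bullet> (P t *v z t))" .
  have "AE t in lebesgue. t \<in> {a<..<b} \<longrightarrow>
      (\<exists>d. ((\<lambda>t. z t \<bullet> (P t *v z t)) has_real_derivative d) (at t) \<and> d \<le> g t)"
    using rate
  proof (rule eventually_mono, intro impI)
    fix t assume *: "t \<in> {a<..<b} \<longrightarrow> (\<exists>z'. (z has_vector_derivative z') (at t) \<and>
       z' \<bullet> (P t *v z t) + z t \<bullet> (P' t *v z t) + z t \<bullet> (P t *v z') \<le> g t)" and t: "t \<in> {a<..<b}"
    show "\<exists>d. ((\<lambda>t. z t \<bullet> (P t *v z t)) has_real_derivative d) (at t) \<and> d \<le> g t"
      using * t quadratic_form_has_derivative[OF derP[OF t]] by blast
  qed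
  from upper_fundamental_theorem[OF \<open>a \<le> b\<close> uac this \<open>g integrable_on {a..b}\<close>]
  show ?thesis by simp
qed

section \<open>The order structure of hybrid time domains\<close>

text \<open>
  The times \<open>\<tau> k\<close> at which level \<open>k\<close> begins, on the way to the point \<open>(T, J)\<close> of \<open>D\<close>, with the consequences
  of the definition of a hybrid time domain in the form in which they are used.
\<close>

definition switching_times ::
  "real \<Rightarrow> nat \<Rightarrow> (real \<times> nat) set \<Rightarrow> real \<Rightarrow> nat \<Rightarrow> (nat \<Rightarrow> real) \<Rightarrow> bool" where
  "switching_times t0 j0 D T J \<tau> \<longleftrightarrow>
     \<tau> j0 = t0 \<and> \<tau> (Suc J) = T \<and>
     (\<forall>k l. j0 \<le> k \<longrightarrow> k \<le> l \<longrightarrow> l \<le> Suc J \<longrightarrow> \<tau> k \<le> \<tau> l) \<and>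
     (\<forall>s k. j0 \<le> k \<longrightarrow> k \<le> J \<longrightarrow> \<tau> k \<le> s \<longrightarrow> s \<le> \<tau> (Suc k) \<longrightarrow> (s, k) \<in> D) \<and>
     (\<forall>s k. (s, k) \<in> D \<longrightarrow> s \<le> T \<longrightarrow> k \<le> J \<longrightarrow> \<tau> k \<le> s \<and> s \<le> \<tau> (Suc k))"

lemma mem_segment:
  "(t, k) \<in> segment \<tau> j m \<longleftrightarrow> j \<le> k \<and> k \<le> m \<and> \<tau> k \<le> t \<and> t \<le> \<tau> (Suc k)"
  by (auto simp: segment_def)

lemma switching_timesD:
  assumes "switching_times t0 j0 D T J \<tau>"
  shows "\<tau> j0 = t0" "\<tau> (Suc J) = T"
    "\<And>k l. j0 \<le> k \<Longrightarrow> k \<le> l \<Longrightarrow> l \<le> Suc J \<Longrightarrow> \<tau> k \<le> \<tau> l"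
    "\<And>s k. j0 \<le> k \<Longrightarrow> k \<le> J \<Longrightarrow> \<tau> k \<le> s \<Longrightarrow> s \<le> \<tau> (Suc k) \<Longrightarrow> (s, k) \<in> D"
    "\<And>s k. (s, k) \<in> D \<Longrightarrow> s \<le> T \<Longrightarrow> k \<le> J \<Longrightarrow> \<tau> k \<le> s \<and> s \<le> \<tau> (Suc k)"
  using assms unfolding switching_times_def by simp_all

lemma switching_times_exist:
  assumes "hybrid_time_domain_from t0 j0 D" and "(T, J) \<in> D"
  obtains \<tau> where "switching_times t0 j0 D T J \<tau>"
proof -
  obtain \<tau> where \<tau>: "\<tau> j0 = t0" "\<forall>i\<in>{j0..J}. \<tau> i \<le> \<tau> (Suc i)" "\<tau> (Suc J) = T"
    and seg: "D \<inter> ({t0..T} \<times> {j0..J}) = segment \<tau> j0 J"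
    using assms unfolding hybrid_time_domain_from_def by fastforce
  have sub: "D \<subseteq> {t0..} \<times> {j0..}"
    using assms unfolding hybrid_time_domain_from_def by blast
  have mono: "\<tau> k \<le> \<tau> l" if "j0 \<le> k" "k \<le> l" "l \<le> Suc J" for k l
    using that(2,3)
  proof (induction l rule: dec_induct)
    case (step n)
    then have "\<tau> n \<le> \<tau> (Suc n)" using \<tau>(2) that(1) by auto
    with step show ?case by simp
  qed simp
  show thesis
  proof (rule that[of \<tau>], unfold switching_times_def, intro conjI allI impI)
    show "\<tau> j0 = t0" "\<tau> (Suc J) = T" by (fact \<tau>)+
    show "\<tau> k \<le> \<tau> l" if "j0 \<le> k" "k \<le> l" "l \<le> Suc J" for k l
      using that by (rule mono)
    fix s k
    show "(s, k) \<in> D" if "j0 \<le> k" "k \<le> J" "\<tau> k \<le> s" "s \<le> \<tau> (Suc k)"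
      using mem_segment[of s k \<tau> j0 J] seg that by blast
    assume "(s, k) \<in> D" "s \<le> T" "k \<le> J"
    then have "(s, k) \<in> D \<inter> ({t0..T} \<times> {j0..J})" using sub by auto
    then show "\<tau> k \<le> s" "s \<le> \<tau> (Suc k)" using mem_segment[of s k \<tau> j0 J] seg by simp_all
  qed
qed

lemma hybrid_time_domain_from_lower_bound:
  assumes "hybrid_time_domain_from t0 j0 D" and "(t, j) \<in> D"
  shows "t0 \<le> t" "j0 \<le> j"
  using assms unfolding hybrid_time_domain_from_def by auto

lemma flow_times_convex:
  assumes "hybrid_time_domain_from t0 j0 D" and "(x, k) \<in> D" "(y, k) \<in> D" and "x \<le> z" "z \<le> y"
  shows "(z, k) \<in> D"
proof -
  obtain \<tau> where sw: "switching_times t0 j0 D y k \<tau>"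
    using switching_times_exist[OF assms(1,3)] .
  note \<tau> = switching_timesD(1,2)[OF sw] and mono = switching_timesD(3)[OF sw]
    and in_D = switching_timesD(4)[OF sw] and of_D = switching_timesD(5)[OF sw]
  have "\<tau> k \<le> x" using of_D[OF assms(2)] assms(4,5) by simp
  then show ?thesis
    using in_D[of k z] hybrid_time_domain_from_lower_bound[OF assms(1,2)] assms \<tau> by auto
qed

text \<open>
  Below one of its points a hybrid time domain is linearly ordered: all of level \<open>k\<close> precedes all of
  level \<open>l > k\<close>. The common upper bound \<open>(T, J)\<close> is essential, since across two branches the claim fails.
\<close>

lemma lower_level_earlier:
  assumes "hybrid_time_domain_from t0 j0 D" and "(x, k) \<in> D" "(z, l) \<in> D" "(T, J) \<in> D"
    and "k < l" "l \<le> J" "x \<le> T" "z \<le> T"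
  shows "x \<le> z"
proof -
  obtain \<tau> where sw: "switching_times t0 j0 D T J \<tau>"
    using switching_times_exist[OF assms(1,4)] .
  note \<tau> = switching_timesD(1,2)[OF sw] and mono = switching_timesD(3)[OF sw]
    and in_D = switching_timesD(4)[OF sw] and of_D = switching_timesD(5)[OF sw]
  have "x \<le> \<tau> (Suc k)" using of_D[OF assms(2)] assms by auto
  also have "\<tau> (Suc k) \<le> \<tau> l"
    using hybrid_time_domain_from_lower_bound[OF assms(1,2)] assms by (intro mono) auto
  also have "\<tau> l \<le> z" using of_D[OF assms(3)] assms by auto
  finally show ?thesis .
qed

lemma level_nonempty:
  assumes "hybrid_time_domain_from t0 j0 D" and "(T, J) \<in> D" and "j0 \<le> k" "k \<le> J"
  obtains u where "u \<le> T" "(u, k) \<in> D"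
proof -
  obtain \<tau> where sw: "switching_times t0 j0 D T J \<tau>"
    using switching_times_exist[OF assms(1,2)] .
  note \<tau> = switching_timesD(1,2)[OF sw] and mono = switching_timesD(3)[OF sw]
    and in_D = switching_timesD(4)[OF sw] and of_D = switching_timesD(5)[OF sw]
  show thesis
    using that[of "\<tau> k"] mono[of k "Suc J"] mono[of k "Suc k"] in_D[of k "\<tau> k"] assms(3,4) \<tau> by auto
qed

text \<open>
  Two points that are incomparable in the product order reveal a branching. The earlier one, of higher
  level, can only be reached by jumping from level \<open>m\<close> to level \<open>J\<close> at the single time \<open>T\<close>, while level \<open>m\<close>
  itself continues to flow beyond \<open>T\<close>.
\<close>

lemma branch_structure:
  assumes D: "hybrid_time_domain_from t0 j0 D" and flow: "(x, m) \<in> D" and jump: "(T, J) \<in> D"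
    and "T < x" "m < J"
  shows "m \<le> k \<Longrightarrow> k \<le> J \<Longrightarrow> (T, k) \<in> D"
    and "(s, k) \<in> D \<Longrightarrow> m < k \<Longrightarrow> k \<le> J \<Longrightarrow> s \<le> T \<Longrightarrow> s = T"
proof -
  note lb = hybrid_time_domain_from_lower_bound[OF D]
  obtain u where "u \<le> T" "(u, m) \<in> D"
    using level_nonempty[OF D jump, of m] lb(2)[OF flow] \<open>m < J\<close> by auto
  then have Tm: "(T, m) \<in> D"
    using flow_times_convex[OF D _ flow] \<open>T < x\<close> by auto
  have only: "s = T" if "(s, k) \<in> D" "m < k" "k \<le> J" "s \<le> T" for s k
    using lower_level_earlier[OF D Tm that(1) jump] that by auto
  show "(s, k) \<in> D \<Longrightarrow> m < k \<Longrightarrow> k \<le> J \<Longrightarrow> s \<le> T \<Longrightarrow> s = T"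
    by (rule only)
  show "(T, k) \<in> D" if "m \<le> k" "k \<le> J"
  proof (cases "k = m")
    case False
    have "j0 \<le> k" using lb(2)[OF flow] that(1) by simp
    then obtain u where "u \<le> T" "(u, k) \<in> D"
      using level_nonempty[OF D jump _ \<open>k \<le> J\<close>] by blast
    then show ?thesis using only[of u k] False that by auto
  qed (use Tm in simp)
qed

text \<open>
  From \<open>(s, i)\<close> on, everything in \<open>D\<close> is comparable with \<open>(t, j)\<close>: no window that starts after \<open>(s, i)\<close>
  and is shorter than the way to \<open>(t, j)\<close> can leave that way.
\<close>

definition unbranched :: "(real \<times> nat) set \<Rightarrow> real \<Rightarrow> nat \<Rightarrow> real \<Rightarrow> nat \<Rightarrow> bool" where
  "unbranched D s i t j \<longleftrightarrow>
     (\<forall>x k. (x, k) \<in> D \<and> s \<le> x \<and> i \<le> k \<longrightarrow> (x \<le> t \<and> k \<le> j) \<or> (t \<le> x \<and> j \<le> k))"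

text \<open>
  At most one level flows beyond a given time \<open>T\<close> that it shares with other levels; hence there is
  at most one branch point.
\<close>

lemma two_flows_same_level:
  assumes D: "hybrid_time_domain_from t0 j0 D" and "(x, m) \<in> D" "(x', m') \<in> D" "(T, m) \<in> D" "(T, m') \<in> D"
    and "T < x" "T < x'"
  shows "m = m'"
proof -
  have *: False if "(y, k) \<in> D" "(y', l) \<in> D" "(T, k) \<in> D" "(T, l) \<in> D" "T < y" "T < y'" "k < l"
    for y y' k l
  proof -
    have "(min y y', k) \<in> D" "(min y y', l) \<in> D"
      using flow_times_convex[OF D that(3,1), of "min y y'"]
        flow_times_convex[OF D that(4,2), of "min y y'"] that(5,6) by auto
    from lower_level_earlier[OF D this(1) that(4) this(2) that(7)] that(5,6)
    show False by auto
  qed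
  show ?thesis
    using *[of x m x' m'] *[of x' m' x m] assms(2-7) by (meson linorder_less_linear)
qed

text \<open>
  If some point is incomparable with \<open>(T, J)\<close>, the branch point lies on the way to \<open>(T, J)\<close>. Either
  \<open>(T, J)\<close> is on the jumping branch, and the short step is the jump away from the branch point \<open>(T, m)\<close>; or it is on
  the flowing branch, and the short step is a flow of length at most one out of the branch point
  \<open>(x, J)\<close>. After the step, points of the other branch no longer lie ahead.
\<close>

theorem split_at_branch:
  assumes D: "hybrid_time_domain_from t0 j0 D" and p: "(s, i) \<in> D" and e: "(T, J) \<in> D"
    and "s \<le> T" "i \<le> J"
  shows "unbranched D s i T J \<or>
    (\<exists>t1 j1 t2 j2. (t1, j1) \<in> D \<and> (t2, j2) \<in> D \<and> s \<le> t1 \<and> t1 \<le> t2 \<and> t2 \<le> T \<and>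
       i \<le> j1 \<and> j1 \<le> j2 \<and> j2 \<le> J \<and> (t2 + real j2) - (t1 + real j1) \<le> 1 \<and>
       unbranched D s i t1 j1 \<and> unbranched D t2 j2 T J)"
proof (cases "unbranched D s i T J")
  case False
  then obtain x m where r: "(x, m) \<in> D" "s \<le> x" "i \<le> m" "T < x \<and> m < J \<or> x < T \<and> J < m"
    unfolding unbranched_def by (metis leI less_le_not_le linorder_le_less_linear)
  from r(4) show ?thesis
  proof
    assume xm: "T < x \<and> m < J"
    then have xm': "T < x" "m < J" by auto
    note br = branch_structure[OF D r(1) e xm']
    have m: "(T, m) \<in> D" "(T, Suc m) \<in> D" using br(1)[of m] br(1)[of "Suc m"] xm' by auto
    have "unbranched D s i T m"
      unfolding unbranched_def
    proof (intro allI impI, rule ccontr)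
      fix x' m' assume r': "(x', m') \<in> D \<and> s \<le> x' \<and> i \<le> m'"
        and "\<not> ((x' \<le> T \<and> m' \<le> m) \<or> (T \<le> x' \<and> m \<le> m'))"
      then consider "T < x'" "m' < m" | "x' < T" "m < m'" by linarith
      then show False
      proof cases
        case 1
        then have "(T, m') \<in> D"
          using branch_structure(1)[OF D _ e, of x' m' m'] r' xm' by auto
        then show False using two_flows_same_level[OF D r(1) _ m(1), of x' m'] r' 1 xm' by auto
      next
        case 2
        then have "(x', Suc m) \<in> D"
          using branch_structure(1)[OF D m(1), of x' m' "Suc m"] r' xm' by auto
        then show False using br(2)[of x' "Suc m"] 2 xm' by auto
      qed
    qed
    moreover have "unbranched D T (Suc m) T J"
      unfolding unbranched_def
    proof (intro allI impI, rule ccontr)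
      fix x' m' assume r': "(x', m') \<in> D \<and> T \<le> x' \<and> Suc m \<le> m'"
        and "\<not> ((x' \<le> T \<and> m' \<le> J) \<or> (T \<le> x' \<and> J \<le> m'))"
      then have "T < x'" "m' < J" by auto
      then show False using two_flows_same_level[OF D r(1) _ m(1), of x' m'] r' xm' br(1)[of m'] by auto
    qed
    moreover have "i \<le> m" "Suc m \<le> J" using r xm' by auto
    ultimately show ?thesis
      using m \<open>s \<le> T\<close> by (intro disjI2 exI[of _ T] exI[of _ m] exI[of _ T] exI[of _ "Suc m"]) auto
  next
    assume xm: "x < T \<and> J < m"
    then have xm': "x < T" "J < m" by auto
    note br = branch_structure[OF D e r(1) xm']
    have J: "(x, J) \<in> D" "(x, Suc J) \<in> D" using br(1)[of J] br(1)[of "Suc J"] xm' by auto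
    have no_jump: False if "(x', m') \<in> D" "x' < T" "J < m'" "x' \<noteq> x" for x' m'
    proof -
      note br' = branch_structure[OF D e that(1,2,3)]
      have "(x', Suc J) \<in> D" using br'(1)[of "Suc J"] that by auto
      then show False
        using br(2)[of x' "Suc J"] br'(2)[of x "Suc J"] J that xm' by (cases "x' \<le> x") auto
    qed
    \<comment> \<open>any flow of positive length leaves the jumping branch behind; a length of at most one suffices\<close>
    define t2 where "t2 = min (x + 1) T"
    have t2: "x < t2" "t2 \<le> T" "t2 \<le> x + 1" using xm' by (auto simp: t2_def)
    have "unbranched D s i x J"
      unfolding unbranched_def
    proof (intro allI impI, rule ccontr)
      fix x' m' assume r': "(x', m') \<in> D \<and> s \<le> x' \<and> i \<le> m'"
        and "\<not> ((x' \<le> x \<and> m' \<le> J) \<or> (x \<le> x' \<and> J \<le> m'))"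
      then consider "x < x'" "m' < J" | "x' < x" "J < m'" by linarith
      then show False
      proof cases
        case 1
        then have "(x, m') \<in> D"
          using branch_structure(1)[OF D _ J(1), of x' m' m'] r' by auto
        then show False using two_flows_same_level[OF D e _ J(1), of x' m'] r' 1 xm' by auto
      next
        case 2
        then show False using no_jump[of x' m'] r' xm' by auto
      qed
    qed
    moreover have "unbranched D t2 J T J"
      unfolding unbranched_def
    proof (intro allI impI, rule ccontr)
      fix x' m' assume r': "(x', m') \<in> D \<and> t2 \<le> x' \<and> J \<le> m'"
        and "\<not> ((x' \<le> T \<and> m' \<le> J) \<or> (T \<le> x' \<and> J \<le> m'))"
      then have "x' < T" "J < m'" by auto
      then show False using no_jump[of x' m'] r' t2 by auto
    qed
    moreover have "(t2, J) \<in> D" using flow_times_convex[OF D J(1) e, of t2] t2 by auto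
    ultimately show ?thesis
      using J t2 r \<open>i \<le> J\<close>
      by (intro disjI2 exI[of _ x] exI[of _ J] exI[of _ t2] exI[of _ J]) auto
  qed
qed simp

text \<open>
  A solution cannot miss points of \<open>D\<close> between its start and one of its points: a point of \<open>D\<close> outside
  \<open>E\<close> would violate the order of levels of \<open>D\<close>. So a window that ends before \<open>(T, J)\<close>
  lies in the domain of the solution.
\<close>

lemma subdomain_mem:
  assumes D: "hybrid_time_domain_from t0' j0' D" and E: "hybrid_time_domain_from t0 j0 E" and "E \<subseteq> D"
    and e: "(T, J) \<in> E" and y: "(y, k) \<in> D" and "t0 \<le> y" "y \<le> T" "j0 \<le> k" "k \<le> J"
  shows "(y, k) \<in> E"
proof -
  obtain \<tau> where sw: "switching_times t0 j0 E T J \<tau>"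
    using switching_times_exist[OF E e] .
  note \<tau> = switching_timesD(1,2)[OF sw] and mono = switching_timesD(3)[OF sw]
    and in_D = switching_timesD(4)[OF sw] and of_D = switching_timesD(5)[OF sw]
  note earlier = lower_level_earlier[OF D _ _ subsetD[OF \<open>E \<subseteq> D\<close> e]]
  have "\<tau> k \<le> y"
  proof (cases "k = j0")
    case False
    then obtain k' where k': "k = Suc k'" "j0 \<le> k'" using \<open>j0 \<le> k\<close> by (cases k) auto
    have "(\<tau> k, k') \<in> E" using in_D[of k' "\<tau> k"] mono[of k' k] k' \<open>k \<le> J\<close> by auto
    moreover have "\<tau> k \<le> T" using mono[of k "Suc J"] \<tau> \<open>j0 \<le> k\<close> \<open>k \<le> J\<close> by auto
    ultimately show ?thesis using earlier[of "\<tau> k" k' y k] y \<open>E \<subseteq> D\<close> k' \<open>y \<le> T\<close> \<open>k \<le> J\<close> by auto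
  qed (use \<tau> assms in simp)
  moreover have "y \<le> \<tau> (Suc k)"
  proof (cases "k = J")
    case False
    then have "Suc k \<le> J" using \<open>k \<le> J\<close> by simp
    then have "(\<tau> (Suc k), Suc k) \<in> E" "\<tau> (Suc k) \<le> T"
      using in_D[of "Suc k" "\<tau> (Suc k)"] mono[of "Suc k" "Suc (Suc k)"] mono[of "Suc k" "Suc J"] \<tau> \<open>j0 \<le> k\<close> by auto
    then show ?thesis
      using earlier[of y k "\<tau> (Suc k)" "Suc k"] y \<open>E \<subseteq> D\<close> \<open>y \<le> T\<close> \<open>Suc k \<le> J\<close> by auto
  qed (use \<tau> assms in simp)
  ultimately show ?thesis using in_D[of k y] assms by auto
qed

lemma segment_between:
  assumes E: "hybrid_time_domain_from t0 j0 E" and p: "(s, i) \<in> E" and e: "(T, J) \<in> E"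
    and "s \<le> T" "i \<le> J"
  obtains \<sigma> where "segment_in E s i \<sigma> J" "\<sigma> (Suc J) = T"
proof -
  obtain \<tau> where sw: "switching_times t0 j0 E T J \<tau>"
    using switching_times_exist[OF E e] .
  note \<tau> = switching_timesD(1,2)[OF sw] and mono = switching_timesD(3)[OF sw]
    and in_D = switching_timesD(4)[OF sw] and of_D = switching_timesD(5)[OF sw]
  define \<sigma> where "\<sigma> = (\<lambda>k. if k \<le> i then s else \<tau> k)"
  have i: "j0 \<le> i" "\<tau> i \<le> s" "s \<le> \<tau> (Suc i)"
    using hybrid_time_domain_from_lower_bound[OF E p] of_D[OF p \<open>s \<le> T\<close> \<open>i \<le> J\<close>] by auto
  have step: "\<tau> k \<le> \<sigma> k" "\<sigma> k \<le> \<sigma> (Suc k)" "\<sigma> (Suc k) = \<tau> (Suc k)"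
    if "k \<in> {i..J}" for k
  proof -
    have "k = i \<or> i < k" using that by auto
    then show "\<tau> k \<le> \<sigma> k" "\<sigma> k \<le> \<sigma> (Suc k)" "\<sigma> (Suc k) = \<tau> (Suc k)"
      using that i mono[of k "Suc k"] unfolding \<sigma>_def by auto
  qed
  have "segment_in E s i \<sigma> J"
    unfolding segment_in_def
  proof (intro conjI ballI subsetI)
    fix y assume "y \<in> segment \<sigma> i J"
    moreover obtain t k where tk: "y = (t, k)" by (cases y)
    ultimately have y: "k \<in> {i..J}" "\<sigma> k \<le> t" "t \<le> \<sigma> (Suc k)"
      by (simp_all add: mem_segment)
    have "\<tau> k \<le> t" "t \<le> \<tau> (Suc k)" using step[OF y(1)] y(2,3) by linarith+
    then show "y \<in> E" using in_D[of k t] i(1) y(1) tk by auto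
  next
    show "\<sigma> i = s" by (simp add: \<sigma>_def)
  qed (fact \<open>i \<le> J\<close>, rule step)
  moreover have "\<sigma> (Suc J) = T" using \<tau> \<open>i \<le> J\<close> by (simp add: \<sigma>_def)
  ultimately show thesis by (rule that)
qed

text \<open>
  A longer segment could be truncated, by up to one unit of flow or by a final jump, and would still have
  length at least \<open>K\<close>.
\<close>

lemma shortest_segment_length_le:
  assumes "shortest_segment D t j K \<tau> m" and "K > 0"
  shows "segment_length \<tau> j m \<le> K + 1"
proof (rule ccontr)
  assume "\<not> ?thesis"
  then have long: "segment_length \<tau> j m > K + 1" by simp
  have seg: "j \<le> m" "\<tau> j = t" "\<And>i. i \<in> {j..m} \<Longrightarrow> \<tau> i \<le> \<tau> (Suc i)" "segment \<tau> j m \<subseteq> D"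
    using assms(1) unfolding shortest_segment_def segment_in_def by auto
  have least: "segment_length \<tau> j m \<le> segment_length \<sigma> j n"
    if "segment_in D t j \<sigma> n" "K \<le> segment_length \<sigma> j n" for \<sigma> n
    using assms(1) that unfolding shortest_segment_def by blast
  show False
  proof (cases "\<tau> m < \<tau> (Suc m)")
    case True
    define \<sigma> where "\<sigma> = \<tau>(Suc m := max (\<tau> m) (\<tau> (Suc m) - 1))"
    have len: "segment_length \<tau> j m - 1 \<le> segment_length \<sigma> j m" "segment_length \<sigma> j m < segment_length \<tau> j m"
      using True \<open>j \<le> m\<close> by (auto simp: segment_length_def \<sigma>_def)
    have \<sigma>: "\<sigma> k = \<tau> k" "\<sigma> (Suc k) \<le> \<tau> (Suc k)" "\<sigma> k \<le> \<sigma> (Suc k)" if "k \<in> {j..m}" for k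
      using that seg(3)[of k] by (auto simp: \<sigma>_def)
    have "segment \<sigma> j m \<subseteq> segment \<tau> j m"
      unfolding segment_def using \<sigma> by (fastforce intro: order_trans)
    then have "segment_in D t j \<sigma> m"
      unfolding segment_in_def using seg \<sigma> by auto
    then show False using least[of \<sigma> m] len long by linarith
  next
    case False
    then have eq: "\<tau> (Suc m) = \<tau> m" using seg(3)[of m] \<open>j \<le> m\<close> by auto
    have "j < m"
    proof (rule ccontr)
      assume "\<not> j < m"
      then have "segment_length \<tau> j m = 0" using \<open>j \<le> m\<close> eq by (simp add: segment_length_def)
      then show False using long \<open>K > 0\<close> by simp
    qed
    then obtain n where n: "m = Suc n" "j \<le> n" by (cases m) auto
    have len: "segment_length \<tau> j n = segment_length \<tau> j m - 1"
      using n eq by (simp add: segment_length_def of_nat_diff)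
    have "segment_in D t j \<tau> n"
      using seg n unfolding segment_in_def segment_def by fastforce
    then show False using least[of \<tau> n] len long by linarith
  qed
qed

section \<open>Arcs of linear hybrid systems and their growth\<close>

lemma abs_continuous_iff:
  "abs_continuous a b z \<longleftrightarrow>
     (\<forall>\<epsilon>>0. \<exists>\<delta>>0. \<forall>n u v. nonoverlapping_family a b n u v \<and> (\<Sum>k<n. v k - u k) < \<delta>
        \<longrightarrow> (\<Sum>k<n. norm (z (v k) - z (u k))) < \<epsilon>)"
  unfolding abs_continuous_def nonoverlapping_family_def conj_assoc ..

lemma abs_continuous_diff:
  assumes "abs_continuous a b f" and "abs_continuous a b g"
  shows "abs_continuous a b (\<lambda>t. f t - g t)"
  unfolding abs_continuous_iff
proof (intro allI impI)
  fix \<epsilon> :: real assume "\<epsilon> > 0"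
  then have "\<epsilon> / 2 > 0" by simp
  obtain \<delta>f where "\<delta>f > 0" and f: "\<And>n u v. nonoverlapping_family a b n u v \<Longrightarrow> (\<Sum>k<n. v k - u k) < \<delta>f
       \<Longrightarrow> (\<Sum>k<n. norm (f (v k) - f (u k))) < \<epsilon> / 2"
    using abs_continuousE[OF assms(1) \<open>\<epsilon> / 2 > 0\<close>] by blast
  obtain \<delta>g where "\<delta>g > 0" and g: "\<And>n u v. nonoverlapping_family a b n u v \<Longrightarrow> (\<Sum>k<n. v k - u k) < \<delta>g
       \<Longrightarrow> (\<Sum>k<n. norm (g (v k) - g (u k))) < \<epsilon> / 2"
    using abs_continuousE[OF assms(2) \<open>\<epsilon> / 2 > 0\<close>] by blast
  have small: "(\<Sum>k<n. norm (f (v k) - g (v k) - (f (u k) - g (u k)))) < \<epsilon>"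
    if fam: "nonoverlapping_family a b n u v" and len: "(\<Sum>k<n. v k - u k) < min \<delta>f \<delta>g" for n u v
  proof -
    have "(\<Sum>k<n. norm (f (v k) - g (v k) - (f (u k) - g (u k))))
        \<le> (\<Sum>k<n. norm (f (v k) - f (u k)) + norm (g (v k) - g (u k)))"
    proof (rule sum_mono)
      fix k
      have "f (v k) - g (v k) - (f (u k) - g (u k)) = (f (v k) - f (u k)) - (g (v k) - g (u k))"
        by simp
      then show "norm (f (v k) - g (v k) - (f (u k) - g (u k)))
          \<le> norm (f (v k) - f (u k)) + norm (g (v k) - g (u k))"
        using norm_triangle_ineq4 by metis
    qed
    also have "\<dots> < \<epsilon>"
      using f[OF fam] g[OF fam] len by (simp add: sum.distrib)
    finally show ?thesis .
  qed
  show "\<exists>\<delta>>0. \<forall>n u v. nonoverlapping_family a b n u v \<and> (\<Sum>k<n. v k - u k) < \<delta> \<longrightarrow>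
        (\<Sum>k<n. norm (f (v k) - g (v k) - (f (u k) - g (u k)))) < \<epsilon>"
    using \<open>\<delta>f > 0\<close> \<open>\<delta>g > 0\<close> small by (intro exI[of _ "min \<delta>f \<delta>g"]) simp
qed

lemma abs_continuous_bounded_linear:
  assumes "abs_continuous a b f" and "bounded_linear h"
  shows "abs_continuous a b (\<lambda>t. h (f t))"
  unfolding abs_continuous_iff
proof (intro allI impI)
  fix \<epsilon> :: real assume "\<epsilon> > 0"
  obtain C where "C > 0" and C: "\<And>x. norm (h x) \<le> norm x * C"
    using bounded_linear.pos_bounded[OF assms(2)] by blast
  then have "\<epsilon> / C > 0" using \<open>\<epsilon> > 0\<close> by simp
  obtain \<delta> where "\<delta> > 0" and f: "\<And>n u v. nonoverlapping_family a b n u v \<Longrightarrow> (\<Sum>k<n. v k - u k) < \<delta>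
       \<Longrightarrow> (\<Sum>k<n. norm (f (v k) - f (u k))) < \<epsilon> / C"
    using abs_continuousE[OF assms(1) \<open>\<epsilon> / C > 0\<close>] by blast
  have small: "(\<Sum>k<n. norm (h (f (v k)) - h (f (u k)))) < \<epsilon>"
    if fam: "nonoverlapping_family a b n u v" and len: "(\<Sum>k<n. v k - u k) < \<delta>" for n u v
  proof -
    have "(\<Sum>k<n. norm (h (f (v k)) - h (f (u k)))) \<le> (\<Sum>k<n. norm (f (v k) - f (u k)) * C)"
      using C by (intro sum_mono) (simp add: linear_diff[OF bounded_linear.linear[OF assms(2)], symmetric])
    also have "\<dots> = (\<Sum>k<n. norm (f (v k) - f (u k))) * C"
      by (simp add: sum_distrib_right)
    also have "\<dots> < \<epsilon>"
      using f[OF fam len] \<open>C > 0\<close> by (simp add: pos_less_divide_eq)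
    finally show ?thesis .
  qed
  show "\<exists>\<delta>>0. \<forall>n u v. nonoverlapping_family a b n u v \<and> (\<Sum>k<n. v k - u k) < \<delta> \<longrightarrow>
        (\<Sum>k<n. norm (h (f (v k)) - h (f (u k)))) < \<epsilon>"
    using \<open>\<delta> > 0\<close> small by (intro exI[of _ \<delta>]) simp
qed

text \<open>
  The equations of the hybrid system along the finite path with switching times \<open>\<tau>\<close>. Unlike solutions,
  arcs on the same path can be subtracted, whatever domains they were restricted from.
\<close>

definition linear_arc ::
  "(real \<Rightarrow> nat \<Rightarrow> real^'n^'n) \<Rightarrow> (real \<Rightarrow> nat \<Rightarrow> real^'n^'n) \<Rightarrow> (real \<Rightarrow> nat \<Rightarrow> real^'n) \<Rightarrow>
   (nat \<Rightarrow> real) \<Rightarrow> nat \<Rightarrow> nat \<Rightarrow> (real \<Rightarrow> nat \<Rightarrow> real^'n) \<Rightarrow> bool" where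
  "linear_arc A B \<nu> \<tau> j m z \<longleftrightarrow>
     (\<forall>k\<in>{j..m}. \<tau> k \<le> \<tau> (Suc k) \<and> abs_continuous (\<tau> k) (\<tau> (Suc k)) (\<lambda>t. z t k) \<and>
        (AE t in lebesgue. t \<in> {\<tau> k<..<\<tau> (Suc k)} \<longrightarrow>
           ((\<lambda>s. z s k) has_vector_derivative (- (A t k *v z t k) + \<nu> t k)) (at t))) \<and>
     (\<forall>k\<in>{j..<m}. z (\<tau> (Suc k)) (Suc k)
        = (mat 1 - B (\<tau> (Suc k)) k) *v z (\<tau> (Suc k)) k + \<nu> (\<tau> (Suc k)) k)"

lemma linear_arc_diff:
  assumes y: "linear_arc A B \<nu> \<tau> j m y" and z: "linear_arc A B \<omega> \<tau> j m z"
  shows "linear_arc A B (\<lambda>t k. \<nu> t k - \<omega> t k) \<tau> j m (\<lambda>t k. y t k - z t k)"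
  unfolding linear_arc_def
proof (intro conjI ballI)
  fix k assume k: "k \<in> {j..m}"
  show "\<tau> k \<le> \<tau> (Suc k)" using y k unfolding linear_arc_def by blast
  show "abs_continuous (\<tau> k) (\<tau> (Suc k)) (\<lambda>t. y t k - z t k)"
    using y z k unfolding linear_arc_def by (intro abs_continuous_diff) auto
  have "AE t in lebesgue. t \<in> {\<tau> k<..<\<tau> (Suc k)} \<longrightarrow>
           ((\<lambda>s. y s k) has_vector_derivative (- (A t k *v y t k) + \<nu> t k)) (at t)"
    using y k unfolding linear_arc_def by blast
  moreover have "AE t in lebesgue. t \<in> {\<tau> k<..<\<tau> (Suc k)} \<longrightarrow>
           ((\<lambda>s. z s k) has_vector_derivative (- (A t k *v z t k) + \<omega> t k)) (at t)"
    using z k unfolding linear_arc_def by blast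
  ultimately show "AE t in lebesgue. t \<in> {\<tau> k<..<\<tau> (Suc k)} \<longrightarrow>
           ((\<lambda>s. y s k - z s k) has_vector_derivative
              (- (A t k *v (y t k - z t k)) + (\<nu> t k - \<omega> t k))) (at t)"
  proof eventually_elim
    case (elim t)
    show ?case
    proof
      assume "t \<in> {\<tau> k<..<\<tau> (Suc k)}"
      with elim have "((\<lambda>s. y s k - z s k) has_vector_derivative
          ((- (A t k *v y t k) + \<nu> t k) - (- (A t k *v z t k) + \<omega> t k))) (at t)"
        by (intro has_vector_derivative_diff) auto
      then show "((\<lambda>s. y s k - z s k) has_vector_derivative
          (- (A t k *v (y t k - z t k)) + (\<nu> t k - \<omega> t k))) (at t)"
        by (simp add: matrix_vector_mult_diff_distrib algebra_simps)
    qed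
  qed
next
  fix k assume k: "k \<in> {j..<m}"
  have "y (\<tau> (Suc k)) (Suc k) = (mat 1 - B (\<tau> (Suc k)) k) *v y (\<tau> (Suc k)) k + \<nu> (\<tau> (Suc k)) k"
    "z (\<tau> (Suc k)) (Suc k) = (mat 1 - B (\<tau> (Suc k)) k) *v z (\<tau> (Suc k)) k + \<omega> (\<tau> (Suc k)) k"
    using y z k unfolding linear_arc_def by blast+
  then show "y (\<tau> (Suc k)) (Suc k) - z (\<tau> (Suc k)) (Suc k)
      = (mat 1 - B (\<tau> (Suc k)) k) *v (y (\<tau> (Suc k)) k - z (\<tau> (Suc k)) k)
        + (\<nu> (\<tau> (Suc k)) k - \<omega> (\<tau> (Suc k)) k)"
    by (simp only: matrix_vector_mult_diff_distrib) simp
qed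

text \<open>
  Gronwall's inequality in the form of a weighted energy: with \<open>c = 2 \<alpha> + 1\<close>, the derivative of
  \<open>exp (- c (t - a)) |z|\<^sup>2\<close> is at most \<open>N\<^sup>2\<close>. Carrying \<open>N\<^sup>2\<close> on both sides makes the estimate composable,
  also with the one for jumps.
\<close>

lemma flow_growth_bound:
  fixes z :: "real \<Rightarrow> real^'n" and A :: "real \<Rightarrow> real^'n^'n"
  assumes "a \<le> b" and ac: "abs_continuous a b z"
    and ode: "AE t in lebesgue. t \<in> {a<..<b} \<longrightarrow> (z has_vector_derivative (- (A t *v z t) + \<nu> t)) (at t)"
    and A: "\<And>t. t \<in> {a<..<b} \<Longrightarrow> matrix_norm (A t) \<le> \<alpha>"
    and \<nu>: "\<And>t. t \<in> {a<..<b} \<Longrightarrow> norm (\<nu> t) \<le> N"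
    and "0 \<le> \<alpha>"
  shows "(norm (z b))\<^sup>2 + N\<^sup>2 \<le> exp ((2 * \<alpha> + 2) * (b - a)) * ((norm (z a))\<^sup>2 + N\<^sup>2)"
proof -
  define c where "c = 2 * \<alpha> + 1"
  have "c \<ge> 1" using \<open>0 \<le> \<alpha>\<close> by (simp add: c_def)
  define e where "e = (\<lambda>t. exp (- c * (t - a)))"
  define P :: "real \<Rightarrow> real^'n^'n" where "P = (\<lambda>t. e t *\<^sub>R mat 1)"
  define P' :: "real \<Rightarrow> real^'n^'n" where "P' = (\<lambda>t. (- c * e t) *\<^sub>R mat 1)"
  have Px: "P t *v x = e t *\<^sub>R x" and P'x: "P' t *v x = (- c * e t) *\<^sub>R x" for t x
    by (simp_all only: P_def P'_def scaleR_matrix_vector_assoc[symmetric] matrix_vector_mul_lid)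
  have "z b \<bullet> (P b *v z b) \<le> z a \<bullet> (P a *v z a) + integral {a..b} (\<lambda>_. N\<^sup>2)"
  proof (rule quadratic_form_growth[OF \<open>a \<le> b\<close> ac, where P' = P' and c = 0])
    show "continuous_on {a..b} P"
      unfolding P_def e_def by (intro continuous_intros)
    show "(P has_vector_derivative P' t) (at t)" for t
    proof -
      have "(e has_real_derivative (- c * e t)) (at t)"
        unfolding e_def by (auto intro!: derivative_eq_intros)
      then show ?thesis
        unfolding P_def P'_def using has_vector_derivative_scaleR[OF _ has_vector_derivative_const] by force
    qed
    show "x \<bullet> (P' t *v x) \<le> 0 * (norm x)\<^sup>2" for t x
      using \<open>c \<ge> 1\<close> by (simp add: P'x e_def)
    show "AE t in lebesgue. t \<in> {a<..<b} \<longrightarrow> (\<exists>z'. (z has_vector_derivative z') (at t) \<and>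
       z' \<bullet> (P t *v z t) + z t \<bullet> (P' t *v z t) + z t \<bullet> (P t *v z') \<le> N\<^sup>2)"
      using ode
    proof eventually_elim
      case (elim t)
      show ?case
      proof
        assume t: "t \<in> {a<..<b}"
        define z' where "z' = - (A t *v z t) + \<nu> t"
        have et: "0 < e t" "e t \<le> 1"
          using t \<open>c \<ge> 1\<close> by (auto simp: e_def)
        have "- ((A t *v z t) \<bullet> z t) \<le> \<alpha> * (norm (z t))\<^sup>2"
        proof -
          have "- ((A t *v z t) \<bullet> z t) \<le> norm (A t *v z t) * norm (z t)"
            using Cauchy_Schwarz_ineq2[of "A t *v z t" "z t"] by simp
          also have "\<dots> \<le> (\<alpha> * norm (z t)) * norm (z t)"
            using norm_matrix_vector_mult_le[of "A t" "z t"]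
              mult_right_mono[OF A[OF t] norm_ge_zero[of "z t"]]
            by (intro mult_right_mono) auto
          finally show ?thesis by (simp add: power2_eq_square)
        qed
        moreover have "2 * (\<nu> t \<bullet> z t) \<le> (norm (z t))\<^sup>2 + N\<^sup>2"
        proof -
          have "\<nu> t \<bullet> z t \<le> N * norm (z t)"
            using norm_cauchy_schwarz[of "\<nu> t" "z t"] mult_right_mono[OF \<nu>[OF t] norm_ge_zero[of "z t"]] by linarith
          moreover have "2 * (N * norm (z t)) \<le> (norm (z t))\<^sup>2 + N\<^sup>2"
            using sum_squares_bound[of N "norm (z t)"] by (simp add: algebra_simps)
          ultimately show ?thesis by linarith
        qed
        ultimately have "2 * (z' \<bullet> z t) - c * (norm (z t))\<^sup>2 \<le> N\<^sup>2"
          by (simp add: z'_def c_def inner_add_left algebra_simps)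
        then have "e t * (2 * (z' \<bullet> z t) - c * (norm (z t))\<^sup>2) \<le> e t * N\<^sup>2"
          using et by (intro mult_left_mono) auto
        also have "\<dots> \<le> N\<^sup>2"
          using et by (simp add: mult_left_le_one_le)
        finally have "z' \<bullet> (P t *v z t) + z t \<bullet> (P' t *v z t) + z t \<bullet> (P t *v z') \<le> N\<^sup>2"
          by (simp add: Px P'x inner_commute power2_norm_eq_inner algebra_simps)
        with elim t show "\<exists>z'. (z has_vector_derivative z') (at t) \<and>
            z' \<bullet> (P t *v z t) + z t \<bullet> (P' t *v z t) + z t \<bullet> (P t *v z') \<le> N\<^sup>2"
          unfolding z'_def by blast
      qed
    qed
  qed auto
  then have *: "e b * (norm (z b))\<^sup>2 \<le> (norm (z a))\<^sup>2 + (b - a) * N\<^sup>2"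
    using \<open>a \<le> b\<close> by (simp add: Px power2_norm_eq_inner e_def)
  define d where "d = b - a"
  have "d \<ge> 0" using \<open>a \<le> b\<close> by (simp add: d_def)
  have "1 \<le> exp (c * d)" using \<open>c \<ge> 1\<close> \<open>d \<ge> 0\<close> by simp
  have "(norm (z b))\<^sup>2 = exp (c * d) * (e b * (norm (z b))\<^sup>2)"
    by (simp add: e_def d_def mult.assoc[symmetric] exp_add[symmetric])
  also have "\<dots> \<le> exp (c * d) * ((norm (z a))\<^sup>2 + d * N\<^sup>2)"
    using * by (intro mult_left_mono) (auto simp: d_def)
  finally have "(norm (z b))\<^sup>2 + N\<^sup>2 \<le> exp (c * d) * ((norm (z a))\<^sup>2 + d * N\<^sup>2) + exp (c * d) * N\<^sup>2"
    using mult_right_mono[OF \<open>1 \<le> exp (c * d)\<close>, of "N\<^sup>2"] by simp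
  also have "\<dots> = exp (c * d) * ((norm (z a))\<^sup>2 + (1 + d) * N\<^sup>2)"
    by (simp add: algebra_simps)
  also have "\<dots> \<le> exp (c * d) * (exp d * ((norm (z a))\<^sup>2 + N\<^sup>2))"
  proof (rule mult_left_mono)
    have "(norm (z a))\<^sup>2 \<le> exp d * (norm (z a))\<^sup>2"
      using \<open>d \<ge> 0\<close> mult_right_mono[of 1 "exp d" "(norm (z a))\<^sup>2"] by simp
    moreover have "(1 + d) * N\<^sup>2 \<le> exp d * N\<^sup>2"
      by (intro mult_right_mono exp_ge_add_one_self) auto
    ultimately show "(norm (z a))\<^sup>2 + (1 + d) * N\<^sup>2 \<le> exp d * ((norm (z a))\<^sup>2 + N\<^sup>2)"
      by (simp add: algebra_simps)
  qed simp
  also have "\<dots> = exp (c * d + d) * ((norm (z a))\<^sup>2 + N\<^sup>2)"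
    by (simp add: exp_add mult.assoc)
  also have "c * d + d = (2 * \<alpha> + 2) * d"
    by (simp add: c_def algebra_simps)
  finally show ?thesis by (simp add: d_def)
qed

text \<open>
  The constant \<open>2 (1 + \<beta>)\<^sup>2 + 3\<close> bounds the growth; its exponential is used instead, so that flows and jumps
  combine into one exponential of the hybrid length.
\<close>

lemma jump_growth_bound:
  fixes x \<nu> :: "real^'n" and B :: "real^'n^'n"
  assumes "matrix_norm B \<le> \<beta>" and "norm \<nu> \<le> N" and "0 \<le> \<beta>"
  shows "(norm ((mat 1 - B) *v x + \<nu>))\<^sup>2 + N\<^sup>2 \<le> exp (2 * (1 + \<beta>)\<^sup>2 + 3) * ((norm x)\<^sup>2 + N\<^sup>2)"
proof -
  have "norm (B *v x) \<le> \<beta> * norm x"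
    using norm_matrix_vector_mult_le[of B x] mult_right_mono[OF assms(1) norm_ge_zero[of x]] by linarith
  moreover have "norm ((mat 1 - B) *v x + \<nu>) \<le> norm x + norm (B *v x) + norm \<nu>"
    unfolding matrix_vector_mult_diff_rdistrib matrix_vector_mul_lid
    using norm_triangle_ineq[of "x - B *v x" \<nu>] norm_triangle_ineq4[of x "B *v x"] by linarith
  ultimately have "norm ((mat 1 - B) *v x + \<nu>) \<le> (1 + \<beta>) * norm x + N"
    using assms(2) by (simp add: algebra_simps)
  then have "(norm ((mat 1 - B) *v x + \<nu>))\<^sup>2 \<le> ((1 + \<beta>) * norm x + N)\<^sup>2"
    by (intro power_mono) auto
  also have "\<dots> \<le> 2 * ((1 + \<beta>) * norm x)\<^sup>2 + 2 * N\<^sup>2"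
    using sum_squares_bound[of "(1 + \<beta>) * norm x" N] unfolding power2_sum by linarith
  also have "\<dots> = 2 * (1 + \<beta>)\<^sup>2 * (norm x)\<^sup>2 + 2 * N\<^sup>2"
    by (simp add: power_mult_distrib)
  finally have "(norm ((mat 1 - B) *v x + \<nu>))\<^sup>2 + N\<^sup>2 \<le> 2 * (1 + \<beta>)\<^sup>2 * (norm x)\<^sup>2 + 3 * N\<^sup>2"
    by simp
  also have "\<dots> \<le> (2 * (1 + \<beta>)\<^sup>2 + 3) * ((norm x)\<^sup>2 + N\<^sup>2)"
    by (simp add: algebra_simps)
  also have "\<dots> \<le> exp (2 * (1 + \<beta>)\<^sup>2 + 3) * ((norm x)\<^sup>2 + N\<^sup>2)"
    using exp_ge_add_one_self[of "2 * (1 + \<beta>)\<^sup>2 + 3"] by (intro mult_right_mono) auto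
  finally show ?thesis .
qed

theorem arc_growth_bound:
  assumes arc: "linear_arc A B \<nu> \<tau> j m z" and "j \<le> m"
    and A: "\<And>k t. k \<in> {j..m} \<Longrightarrow> t \<in> {\<tau> k<..<\<tau> (Suc k)} \<Longrightarrow> matrix_norm (A t k) \<le> \<alpha>"
    and B: "\<And>k. k \<in> {j..<m} \<Longrightarrow> matrix_norm (B (\<tau> (Suc k)) k) \<le> \<beta>"
    and \<nu>_flow: "\<And>k t. k \<in> {j..m} \<Longrightarrow> t \<in> {\<tau> k<..<\<tau> (Suc k)} \<Longrightarrow> norm (\<nu> t k) \<le> N"
    and \<nu>_jump: "\<And>k. k \<in> {j..<m} \<Longrightarrow> norm (\<nu> (\<tau> (Suc k)) k) \<le> N"
    and "0 \<le> \<alpha>" "0 \<le> \<beta>" and c: "c = (2 * \<alpha> + 2) + (2 * (1 + \<beta>)\<^sup>2 + 3)"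
  shows "(norm (z (\<tau> (Suc m)) m))\<^sup>2 + N\<^sup>2
           \<le> exp (c * segment_length \<tau> j m) * ((norm (z (\<tau> j) j))\<^sup>2 + N\<^sup>2)"
proof -
  define G where "G = (\<lambda>t k. (norm (z t k))\<^sup>2 + N\<^sup>2)"
  have G0: "0 \<le> G t k" for t k by (simp add: G_def)
  have c_ge: "2 * \<alpha> + 2 \<le> c" "2 * (1 + \<beta>)\<^sup>2 + 3 \<le> c"
    using c \<open>0 \<le> \<alpha>\<close> by (auto simp: add_nonneg_pos)
  have flow: "G (\<tau> (Suc k)) k \<le> exp (c * (\<tau> (Suc k) - \<tau> k)) * G (\<tau> k) k" if k: "k \<in> {j..m}" for k
  proof -
    have *: "\<tau> k \<le> \<tau> (Suc k)" "abs_continuous (\<tau> k) (\<tau> (Suc k)) (\<lambda>t. z t k)"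
      "AE t in lebesgue. t \<in> {\<tau> k<..<\<tau> (Suc k)} \<longrightarrow>
         ((\<lambda>s. z s k) has_vector_derivative (- (A t k *v z t k) + \<nu> t k)) (at t)"
      using arc k unfolding linear_arc_def by blast+
    have "G (\<tau> (Suc k)) k \<le> exp ((2 * \<alpha> + 2) * (\<tau> (Suc k) - \<tau> k)) * G (\<tau> k) k"
      unfolding G_def by (rule flow_growth_bound[OF * A[OF k] \<nu>_flow[OF k] \<open>0 \<le> \<alpha>\<close>])
    also have "\<dots> \<le> exp (c * (\<tau> (Suc k) - \<tau> k)) * G (\<tau> k) k"
      using *(1) c_ge G0 by (intro mult_right_mono) (auto intro!: mult_right_mono)
    finally show ?thesis .
  qed
  have jump: "G (\<tau> (Suc k)) (Suc k) \<le> exp c * G (\<tau> (Suc k)) k" if k: "k \<in> {j..<m}" for k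
  proof -
    have "z (\<tau> (Suc k)) (Suc k) = (mat 1 - B (\<tau> (Suc k)) k) *v z (\<tau> (Suc k)) k + \<nu> (\<tau> (Suc k)) k"
      using arc k unfolding linear_arc_def by blast
    then have "G (\<tau> (Suc k)) (Suc k) \<le> exp (2 * (1 + \<beta>)\<^sup>2 + 3) * G (\<tau> (Suc k)) k"
      unfolding G_def using jump_growth_bound[OF B[OF k] \<nu>_jump[OF k] \<open>0 \<le> \<beta>\<close>] by simp
    also have "\<dots> \<le> exp c * G (\<tau> (Suc k)) k"
      using c_ge G0 by (intro mult_right_mono) auto
    finally show ?thesis .
  qed
  have "n \<le> m \<Longrightarrow> G (\<tau> (Suc n)) n \<le> exp (c * segment_length \<tau> j n) * G (\<tau> j) j" if "j \<le> n" for n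
    using that
  proof (induction n rule: dec_induct)
    case base
    then show ?case using flow[of j] by (simp add: segment_length_def)
  next
    case (step n)
    have "G (\<tau> (Suc (Suc n))) (Suc n) \<le> exp (c * (\<tau> (Suc (Suc n)) - \<tau> (Suc n))) * G (\<tau> (Suc n)) (Suc n)"
      using flow[of "Suc n"] step by simp
    also have "\<dots> \<le> exp (c * (\<tau> (Suc (Suc n)) - \<tau> (Suc n))) * (exp c * G (\<tau> (Suc n)) n)"
      using jump[of n] step by (intro mult_left_mono) auto
    also have "\<dots> \<le> exp (c * (\<tau> (Suc (Suc n)) - \<tau> (Suc n))) * (exp c * (exp (c * segment_length \<tau> j n) * G (\<tau> j) j))"
      using step by (intro mult_left_mono) auto
    also have "\<dots> = exp (c * (\<tau> (Suc (Suc n)) - \<tau> (Suc n)) + c + c * segment_length \<tau> j n) * G (\<tau> j) j"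
      by (simp add: exp_add mult_ac)
    also have "c * (\<tau> (Suc (Suc n)) - \<tau> (Suc n)) + c + c * segment_length \<tau> j n = c * segment_length \<tau> j (Suc n)"
      using step by (simp add: segment_length_def Suc_diff_le algebra_simps)
    finally show ?case .
  qed
  from this[OF \<open>j \<le> m\<close>] show ?thesis by (simp add: G_def)
qed

section \<open>Decrease of the Lyapunov function along unforced arcs\<close>

lemma psd_leD:
  assumes "X \<preceq> Y"
  shows "x \<bullet> (X *v x) \<le> x \<bullet> (Y *v x)"
  using assms unfolding psd_le_def psd_def
  by (simp add: matrix_vector_mult_diff_rdistrib inner_diff_right)

lemma mat_vector_mult: "mat c *v x = c *\<^sub>R (x :: real^'n)"
  by (simp add: vec_eq_iff matrix_vector_mult_def mat_def if_distrib[of "\<lambda>u. u * _"]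
      sum.delta cong: if_cong)

lemma inner_transpose: "x \<bullet> (transpose X *v y) = (X *v x) \<bullet> (y :: real^'n)"
  by (metis dot_lmul_matrix inner_commute transpose_matrix_vector)

text \<open>
  Expand \<open>0 \<le> (\<delta> y - w) \<bullet> X (\<delta> y - w)\<close> and divide by \<open>\<delta>\<close>.
\<close>

lemma quadratic_form_young:
  assumes "sym_matrix X" and pos: "\<And>x. 0 \<le> x \<bullet> (X *v x)" and "0 < \<delta>"
  shows "(y + w) \<bullet> (X *v (y + w)) \<le> (1 + \<delta>) * (y \<bullet> (X *v y)) + (1 + 1 / \<delta>) * (w \<bullet> (X *v w))"
proof -
  have sym: "w \<bullet> (X *v y) = y \<bullet> (X *v w)"
    using inner_transpose[of w X y] assms(1) by (metis sym_matrix_def inner_commute)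
  have "0 \<le> (\<delta> *\<^sub>R y - w) \<bullet> (X *v (\<delta> *\<^sub>R y - w))" by (rule pos)
  also have "\<dots> = \<delta> * (\<delta> * (y \<bullet> (X *v y)) + (1 / \<delta>) * (w \<bullet> (X *v w)) - 2 * (y \<bullet> (X *v w)))"
    using \<open>0 < \<delta>\<close> sym
    by (simp add: matrix_vector_mult_diff_distrib inner_diff_left inner_diff_right
        matrix_vector_mult_scaleR algebra_simps)
  finally have "0 \<le> \<delta> * (y \<bullet> (X *v y)) + (1 / \<delta>) * (w \<bullet> (X *v w)) - 2 * (y \<bullet> (X *v w))"
    using \<open>0 < \<delta>\<close> by (simp add: zero_le_mult_iff)
  then show ?thesis
    using sym by (simp add: matrix_vector_right_distrib inner_add_left inner_add_right algebra_simps)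
qed

lemma segment_in_mono:
  assumes "segment_in D s i \<sigma> m" and "i \<le> k" "k \<le> l" "l \<le> Suc m"
  shows "\<sigma> k \<le> \<sigma> l"
  using assms(3,4)
proof (induction l rule: dec_induct)
  case (step n)
  then have "\<sigma> n \<le> \<sigma> (Suc n)" using assms(1,2) unfolding segment_in_def by auto
  with step show ?case by simp
qed simp

lemma segment_in_mem:
  assumes "segment_in D s i \<sigma> m" and "k \<in> {i..m}" "\<sigma> k \<le> t" "t \<le> \<sigma> (Suc k)"
  shows "(t, k) \<in> D"
  using assms unfolding segment_in_def by (auto simp: mem_segment dest!: subsetD[of _ _ "(t, k)"])

lemma segment_in_bounds:
  assumes "segment_in D s i \<sigma> m" and "(t, k) \<in> segment \<sigma> i m"
  shows "s \<le> t" "t \<le> \<sigma> (Suc m)" "i \<le> k" "k \<le> m"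
proof -
  have k: "i \<le> k" "k \<le> m" "\<sigma> k \<le> t" "t \<le> \<sigma> (Suc k)" using assms(2) by (auto simp: mem_segment)
  have "\<sigma> i \<le> \<sigma> k" "\<sigma> (Suc k) \<le> \<sigma> (Suc m)"
    using k by (auto intro!: segment_in_mono[OF assms(1)])
  moreover have "\<sigma> i = s" using assms(1) by (simp add: segment_in_def)
  ultimately show "s \<le> t" "t \<le> \<sigma> (Suc m)" "i \<le> k" "k \<le> m" using k by auto
qed

lemma linear_arc_on_segment:
  assumes seg: "segment_in E s i \<sigma> m" and ac: "locally_abs_continuous E z"
    and ode: "\<And>k. AE t in lebesgue. t \<in> interior (flow_times E k) \<longrightarrow>
        ((\<lambda>s. z s k) has_vector_derivative (- (A t k *v z t k) + \<nu> t k)) (at t)"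
    and jump: "\<And>t k. (t, k) \<in> E \<Longrightarrow> (t, Suc k) \<in> E \<Longrightarrow> z t (Suc k) = (mat 1 - B t k) *v z t k + \<nu> t k"
  shows "linear_arc A B \<nu> \<sigma> i m z"
  unfolding linear_arc_def
proof (intro conjI ballI)
  note mem = segment_in_mem[OF seg]
  fix k assume k: "k \<in> {i..m}"
  show le: "\<sigma> k \<le> \<sigma> (Suc k)" using seg k unfolding segment_in_def by blast
  have sub: "{\<sigma> k..\<sigma> (Suc k)} \<subseteq> flow_times E k"
    using mem[OF k] by (auto simp: flow_times_def)
  show "abs_continuous (\<sigma> k) (\<sigma> (Suc k)) (\<lambda>t. z t k)"
    using ac le sub unfolding locally_abs_continuous_def by blast
  have "{\<sigma> k<..<\<sigma> (Suc k)} \<subseteq> interior (flow_times E k)"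
    using sub by (intro interior_maximal) auto
  with ode[of k] show "AE t in lebesgue. t \<in> {\<sigma> k<..<\<sigma> (Suc k)} \<longrightarrow>
        ((\<lambda>s. z s k) has_vector_derivative (- (A t k *v z t k) + \<nu> t k)) (at t)"
    by (auto elim!: eventually_mono)
next
  fix k assume k: "k \<in> {i..<m}"
  have "(\<sigma> (Suc k), k) \<in> E" "(\<sigma> (Suc k), Suc k) \<in> E"
    using k segment_in_mono[OF seg, of k "Suc k"] segment_in_mono[OF seg, of "Suc k" "Suc (Suc k)"]
    by (auto intro!: segment_in_mem[OF seg])
  then show "z (\<sigma> (Suc k)) (Suc k) = (mat 1 - B (\<sigma> (Suc k)) k) *v z (\<sigma> (Suc k)) k + \<nu> (\<sigma> (Suc k)) k"
    by (rule jump)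
qed

lemma solution_linear_arc:
  assumes "solution D A B \<nu> t0 j0 z0 E z" and "segment_in E s i \<sigma> m"
  shows "linear_arc A B \<nu> \<sigma> i m z"
  using assms(1) unfolding solution_def by (intro linear_arc_on_segment[OF assms(2)]) auto

text \<open>
  The transition matrix supplies, from every point of the domain and every initial value, the unforced
  arc with which a solution is compared.
\<close>

lemma transition_matrix_linear_arc:
  fixes x :: "real^'n"
  assumes M: "transition_matrix D A B M" and "(s, i) \<in> D" and seg: "segment_in D s i \<sigma> m"
  shows "linear_arc A B (\<lambda>_ _. 0) \<sigma> i m (\<lambda>t k. M (t, k) (s, i) *v x)"
proof (rule linear_arc_on_segment)
  let ?T = "tail_from D s i"
  have lin: "bounded_linear (\<lambda>X :: real^'n^'n. X *v x)"
    by (rule bounded_bilinear.bounded_linear_left[OF bounded_bilinear_matrix_vector_mult])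
  note M0 = bspec[OF M[unfolded transition_matrix_def] \<open>(s, i) \<in> D\<close>, unfolded prod.case]
  have ac: "locally_abs_continuous ?T (\<lambda>t j. M (t, j) (s, i))"
    by (rule M0[THEN conjunct1])
  have ode: "AE t in lebesgue. t \<in> interior (flow_times ?T k) \<longrightarrow>
       ((\<lambda>r. M (r, k) (s, i)) has_vector_derivative - (A t k ** M (t, k) (s, i))) (at t)" for k
    by (rule M0[THEN conjunct2, THEN conjunct2, THEN conjunct1, THEN spec])
  have jump: "M (t, Suc k) (s, i) = (mat 1 - B t k) ** M (t, k) (s, i)"
    if "(t, k) \<in> ?T" "(t, Suc k) \<in> ?T" for t k
    using M0[THEN conjunct2, THEN conjunct2, THEN conjunct2] that by blast
  have "segment \<sigma> i m \<subseteq> ?T"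
  proof clarify
    fix t k assume tk: "(t, k) \<in> segment \<sigma> i m"
    then show "(t, k) \<in> ?T"
      using segment_in_bounds[OF seg tk] seg unfolding tail_from_def segment_in_def by auto
  qed
  then show "segment_in ?T s i \<sigma> m"
    using seg unfolding segment_in_def by blast
  show "locally_abs_continuous ?T (\<lambda>t k. M (t, k) (s, i) *v x)"
    unfolding locally_abs_continuous_def
  proof (intro allI impI, rule abs_continuous_bounded_linear[OF _ lin])
    fix k a b assume "a \<le> b \<and> {a..b} \<subseteq> flow_times ?T k"
    then show "abs_continuous a b (\<lambda>t. M (t, k) (s, i))"
      using ac unfolding locally_abs_continuous_def by simp
  qed
  show "AE t in lebesgue. t \<in> interior (flow_times ?T k) \<longrightarrow>
      ((\<lambda>r. M (r, k) (s, i) *v x) has_vector_derivative - (A t k *v (M (t, k) (s, i) *v x)) + 0) (at t)" for k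
    using ode[of k]
  proof (rule eventually_mono, intro impI)
    fix t assume "t \<in> interior (flow_times ?T k) \<longrightarrow>
       ((\<lambda>r. M (r, k) (s, i)) has_vector_derivative - (A t k ** M (t, k) (s, i))) (at t)"
      and "t \<in> interior (flow_times ?T k)"
    then have "((\<lambda>r. M (r, k) (s, i)) has_vector_derivative - (A t k ** M (t, k) (s, i))) (at t)"
      by blast
    from bounded_linear.has_vector_derivative[OF lin this]
    show "((\<lambda>r. M (r, k) (s, i) *v x) has_vector_derivative - (A t k *v (M (t, k) (s, i) *v x)) + 0) (at t)"
      by (simp add: linear_neg[OF bounded_linear.linear[OF lin]] matrix_vector_mul_assoc)
  qed
  show "M (t, Suc k) (s, i) *v x = (mat 1 - B t k) *v (M (t, k) (s, i) *v x) + 0"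
    if "(t, k) \<in> ?T" "(t, Suc k) \<in> ?T" for t k
    using jump[OF that] by (simp add: matrix_vector_mul_assoc)
qed

lemma hybrid_integral_quadratic_form:
  fixes g :: "real \<Rightarrow> nat \<Rightarrow> real^'n^'n"
  assumes "hybrid_integrable \<tau> j m g"
  shows "hybrid_integrable \<tau> j m (\<lambda>s i. x \<bullet> (g s i *v x))"
    and "x \<bullet> (hybrid_integral \<tau> j m g *v x) = hybrid_integral \<tau> j m (\<lambda>s i. x \<bullet> (g s i *v x))"
proof -
  have lin: "bounded_linear (\<lambda>X :: real^'n^'n. x \<bullet> (X *v x))"
    by (rule bounded_linear_compose[OF bounded_linear_inner_right
        bounded_bilinear.bounded_linear_left[OF bounded_bilinear_matrix_vector_mult]])
  have int: "(\<lambda>s. g s i) integrable_on {\<tau> i..\<tau> (Suc i)}" if "i \<in> {j..m}" for i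
    using assms that unfolding hybrid_integrable_def by blast
  show "hybrid_integrable \<tau> j m (\<lambda>s i. x \<bullet> (g s i *v x))"
    unfolding hybrid_integrable_def
    using integrable_linear[OF int lin] by (simp add: o_def)
  define L where "L = (\<lambda>X :: real^'n^'n. x \<bullet> (X *v x))"
  have L: "linear L" using lin unfolding L_def by (rule bounded_linear.linear)
  have "L (hybrid_integral \<tau> j m g)
      = (\<Sum>i=j..m. L (integral {\<tau> i..\<tau> (Suc i)} (\<lambda>s. g s i))) + (\<Sum>i=j..<m. L (g (\<tau> (Suc i)) i))"
    unfolding hybrid_integral_def by (simp only: linear_add[OF L] linear_sum[OF L])
  also have "(\<Sum>i=j..m. L (integral {\<tau> i..\<tau> (Suc i)} (\<lambda>s. g s i)))
      = (\<Sum>i=j..m. integral {\<tau> i..\<tau> (Suc i)} (\<lambda>s. L (g s i)))"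
    using integral_linear[OF int lin] by (intro sum.cong) (simp_all add: o_def L_def)
  finally show "x \<bullet> (hybrid_integral \<tau> j m g *v x) = hybrid_integral \<tau> j m (\<lambda>s i. x \<bullet> (g s i *v x))"
    by (simp only: L_def hybrid_integral_def)
qed

text \<open>
  The data and inequalities of a non-strict Lyapunov function for a hybrid linear system with
  bounded coefficients.
\<close>

locale hybrid_lyapunov_pair =
  fixes D :: "(real \<times> nat) set"
    and A B P Qc Qd :: "real \<Rightarrow> nat \<Rightarrow> real^'n^'n"
    and p1 p2 Abar Bbar :: real
  assumes domain: "hybrid_time_domain D"
    and P_sym: "\<forall>(t, j) \<in> D. sym_matrix (P t j)"
    and P_cont: "\<forall>j. continuous_on (flow_times D j) (\<lambda>t. P t j)"
    and p1_pos: "p1 > 0" and p2_pos: "p2 > 0"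
    and P_bounds: "\<forall>(t, j) \<in> D. mat p1 \<preceq> P t j \<and> P t j \<preceq> mat p2"
    and Q_psd: "\<forall>(t, j) \<in> D. psd (Qc t j) \<and> psd (Qd t j)"
    and flow_inequality: "\<forall>j. \<forall>t \<in> interior (flow_times D j).
           \<exists>P'. ((\<lambda>s. P s j) has_vector_derivative P') (at t) \<and>
             P' - transpose (A t j) ** P t j - P t j ** A t j \<preceq> - Qc t j"
    and jump_inequality: "\<forall>t j. (t, j) \<in> D \<and> (t, Suc j) \<in> D \<longrightarrow>
           transpose (mat 1 - B t j) ** P t (Suc j) ** (mat 1 - B t j) - P t j \<preceq> - Qd t j"
    and Abar_pos: "Abar > 0" and Bbar_pos: "Bbar > 0"
    and AB_bounds: "\<forall>(t, j) \<in> D. matrix_norm (A t j) \<le> Abar \<and> matrix_norm (B t j) \<le> Bbar"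
begin

lemma D_from: "hybrid_time_domain_from 0 0 D"
  using domain by (simp add: hybrid_time_domain_def)

abbreviation V :: "real \<Rightarrow> nat \<Rightarrow> real^'n \<Rightarrow> real" where
  "V t j x \<equiv> x \<bullet> (P t j *v x)"

abbreviation \<Phi> :: "real \<Rightarrow> nat \<Rightarrow> real^'n^'n" where
  "\<Phi> \<equiv> Phi D Qc Qd"

lemma V_bounds:
  assumes "(t, j) \<in> D"
  shows "p1 * (norm x)\<^sup>2 \<le> V t j x" "V t j x \<le> p2 * (norm x)\<^sup>2" "0 \<le> V t j x"
proof -
  have "mat p1 \<preceq> P t j" "P t j \<preceq> mat p2" using P_bounds assms by auto
  from this[THEN psd_leD, of x] show "p1 * (norm x)\<^sup>2 \<le> V t j x" "V t j x \<le> p2 * (norm x)\<^sup>2"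
    by (simp_all add: mat_vector_mult power2_norm_eq_inner)
  moreover have "0 \<le> p1 * (norm x)\<^sup>2" using p1_pos by simp
  ultimately show "0 \<le> V t j x" by linarith
qed

lemma P_symmetric:
  assumes "(t, j) \<in> D"
  shows "x \<bullet> (P t j *v y) = (P t j *v x) \<bullet> y"
proof -
  have "transpose (P t j) = P t j" using P_sym assms by (auto simp: sym_matrix_def)
  then show ?thesis using inner_transpose[of x "P t j" y] by metis
qed

lemma V_flow_rate:
  assumes "t \<in> interior (flow_times D j)"
  shows "\<exists>P'. ((\<lambda>s. P s j) has_vector_derivative P') (at t) \<and>
     (\<forall>x. x \<bullet> (P' *v x) - 2 * ((A t j *v x) \<bullet> (P t j *v x)) \<le> - (x \<bullet> (Qc t j *v x)))"
proof -
  have tD: "(t, j) \<in> D" using assms interior_subset by (auto simp: flow_times_def)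
  obtain P' where P': "((\<lambda>s. P s j) has_vector_derivative P') (at t)"
    "P' - transpose (A t j) ** P t j - P t j ** A t j \<preceq> - Qc t j"
    using flow_inequality assms by blast
  have "x \<bullet> (P' *v x) - 2 * ((A t j *v x) \<bullet> (P t j *v x)) \<le> - (x \<bullet> (Qc t j *v x))" for x
  proof -
    have "x \<bullet> ((- Qc t j) *v x) = - (x \<bullet> (Qc t j *v x))"
      using matrix_vector_mult_diff_rdistrib[of 0 "Qc t j" x] by simp
    moreover have "x \<bullet> ((P' - transpose (A t j) ** P t j - P t j ** A t j) *v x)
        = x \<bullet> (P' *v x) - x \<bullet> (transpose (A t j) *v (P t j *v x)) - x \<bullet> (P t j *v (A t j *v x))"
      by (simp add: matrix_vector_mult_diff_rdistrib inner_diff_right matrix_vector_mul_assoc)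
    moreover have "x \<bullet> (transpose (A t j) *v (P t j *v x)) = (A t j *v x) \<bullet> (P t j *v x)"
      by (rule inner_transpose)
    moreover have "x \<bullet> (P t j *v (A t j *v x)) = (A t j *v x) \<bullet> (P t j *v x)"
      using P_symmetric[OF tD, of x "A t j *v x"] by (simp only: inner_commute)
    ultimately show ?thesis
      using psd_leD[OF P'(2), of x] by linarith
  qed
  with P'(1) show ?thesis by blast
qed

lemma V_jump:
  assumes "(t, j) \<in> D" "(t, Suc j) \<in> D"
  shows "V t (Suc j) ((mat 1 - B t j) *v x) \<le> V t j x - x \<bullet> (Qd t j *v x)"
proof -
  have "transpose (mat 1 - B t j) ** P t (Suc j) ** (mat 1 - B t j) - P t j \<preceq> - Qd t j"
    using jump_inequality assms by blast
  from psd_leD[OF this, of x]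
  have "x \<bullet> ((transpose (mat 1 - B t j) ** P t (Suc j) ** (mat 1 - B t j)) *v x) - V t j x
      \<le> x \<bullet> ((- Qd t j) *v x)"
    unfolding matrix_vector_mult_diff_rdistrib inner_diff_right .
  moreover have "x \<bullet> ((- Qd t j) *v x) = - (x \<bullet> (Qd t j *v x))"
    using matrix_vector_mult_diff_rdistrib[of 0 "Qd t j" x] by simp
  moreover have "x \<bullet> ((transpose (mat 1 - B t j) ** P t (Suc j) ** (mat 1 - B t j)) *v x)
      = V t (Suc j) ((mat 1 - B t j) *v x)"
    unfolding matrix_vector_mul_assoc[symmetric] by (rule inner_transpose)
  ultimately show ?thesis by simp
qed

text \<open>
  The flow inequality and \<open>Qc \<ge> 0\<close> give \<open>x \<bullet> P' x \<le> 2 (A x) \<bullet> (P x)\<close>, and the right-hand side is at most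
  \<open>V (A x) + V x\<close> because \<open>V (A x - x) \<ge> 0\<close>. This is the upper bound on \<open>P'\<close> that
  \<open>quadratic_form_growth\<close> asks for.
\<close>

lemma V_flow_decrease:
  assumes "a \<le> b" and sub: "{a..b} \<subseteq> flow_times D k" and ac: "abs_continuous a b y"
    and ode: "AE t in lebesgue. t \<in> {a<..<b} \<longrightarrow> (y has_vector_derivative (- (A t k *v y t))) (at t)"
    and int: "(\<lambda>t. y t \<bullet> (\<Phi> t k *v y t)) integrable_on {a..b}"
  shows "V b k (y b) + integral {a..b} (\<lambda>t. y t \<bullet> (\<Phi> t k *v y t)) \<le> V a k (y a)"
proof -
  have tD: "(t, k) \<in> D" if "t \<in> {a<..<b}" for t
    using subsetD[OF sub, of t] that by (simp add: flow_times_def)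
  have inter: "t \<in> interior (flow_times D k)" if "t \<in> {a<..<b}" for t
  proof -
    have "{a<..<b} \<subseteq> flow_times D k" by (rule order_trans[OF _ sub]) auto
    from interior_maximal[OF this open_greaterThanLessThan] show ?thesis using that by blast
  qed
  define is_rate where "is_rate = (\<lambda>t P'. ((\<lambda>s. P s k) has_vector_derivative P') (at t) \<and>
     (\<forall>x. x \<bullet> (P' *v x) - 2 * ((A t k *v x) \<bullet> (P t k *v x)) \<le> - (x \<bullet> (Qc t k *v x))))"
  have "\<forall>t\<in>{a<..<b}. \<exists>P'. is_rate t P'"
    using V_flow_rate[OF inter] unfolding is_rate_def by blast
  from bchoice[OF this] obtain P' where "\<forall>t\<in>{a<..<b}. is_rate t (P' t)" by blast
  then have P': "\<And>t. t \<in> {a<..<b} \<Longrightarrow> ((\<lambda>s. P s k) has_vector_derivative P' t) (at t)"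
    and rate: "\<And>t x. t \<in> {a<..<b} \<Longrightarrow>
       x \<bullet> (P' t *v x) - 2 * ((A t k *v x) \<bullet> (P t k *v x)) \<le> - (x \<bullet> (Qc t k *v x))"
    unfolding is_rate_def by blast+
  have "V b k (y b) \<le> V a k (y a) + integral {a..b} (\<lambda>t. - (y t \<bullet> (\<Phi> t k *v y t)))"
  proof (rule quadratic_form_growth[OF \<open>a \<le> b\<close> ac _ P', where c = "p2 * (Abar\<^sup>2 + 1)"])
    show "continuous_on {a..b} (\<lambda>t. P t k)"
      using P_cont by (intro continuous_on_subset[OF _ sub]) blast
    show "0 \<le> p2 * (Abar\<^sup>2 + 1)" using p2_pos by simp
    show "x \<bullet> (P' t *v x) \<le> p2 * (Abar\<^sup>2 + 1) * (norm x)\<^sup>2" if t: "t \<in> {a<..<b}" for t x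
    proof -
      let ?w = "A t k *v x"
      have "norm ?w \<le> Abar * norm x"
      proof -
        have "matrix_norm (A t k) \<le> Abar" using AB_bounds tD[OF t] by auto
        then show ?thesis
          using norm_matrix_vector_mult_le[of "A t k" x]
            mult_right_mono[of "matrix_norm (A t k)" Abar "norm x"] by simp
      qed
      then have "(norm ?w)\<^sup>2 \<le> (Abar * norm x)\<^sup>2" by (intro power_mono) auto
      then have "p2 * (norm ?w)\<^sup>2 \<le> p2 * (Abar\<^sup>2 * (norm x)\<^sup>2)"
        using p2_pos by (simp add: power_mult_distrib)
      then have "V t k ?w \<le> p2 * (Abar\<^sup>2 * (norm x)\<^sup>2)" using V_bounds(2)[OF tD[OF t], of ?w] by linarith
      moreover have "0 \<le> V t k (?w - x)" by (rule V_bounds(3)[OF tD[OF t]])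
      then have "2 * (?w \<bullet> (P t k *v x)) \<le> V t k ?w + V t k x"
        using P_symmetric[OF tD[OF t], of x ?w]
        by (simp add: matrix_vector_mult_diff_distrib inner_diff_left inner_diff_right inner_commute)
      moreover have "0 \<le> x \<bullet> (Qc t k *v x)" using Q_psd tD[OF t] by (auto simp: psd_def)
      ultimately show ?thesis
        using rate[OF t, of x] V_bounds(2)[OF tD[OF t], of x] by (simp add: algebra_simps)
    qed
    show "AE t in lebesgue. t \<in> {a<..<b} \<longrightarrow> (\<exists>y'. (y has_vector_derivative y') (at t) \<and>
       y' \<bullet> (P t k *v y t) + y t \<bullet> (P' t *v y t) + y t \<bullet> (P t k *v y') \<le> - (y t \<bullet> (\<Phi> t k *v y t)))"
      using ode
    proof (rule eventually_mono, intro impI)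
      fix t assume *: "t \<in> {a<..<b} \<longrightarrow> (y has_vector_derivative (- (A t k *v y t))) (at t)"
        and t: "t \<in> {a<..<b}"
      have "\<Phi> t k = Qc t k" using inter[OF t] by (simp add: Phi_def)
      moreover have "P t k *v (- (A t k *v y t)) = - (P t k *v (A t k *v y t))"
        using matrix_vector_mult_diff_distrib[of "P t k" 0 "A t k *v y t"] by simp
      ultimately have "(- (A t k *v y t)) \<bullet> (P t k *v y t) + y t \<bullet> (P' t *v y t)
          + y t \<bullet> (P t k *v (- (A t k *v y t))) \<le> - (y t \<bullet> (\<Phi> t k *v y t))"
        using rate[OF t, of "y t"] P_symmetric[OF tD[OF t], of "y t" "A t k *v y t"]
        by (simp add: inner_commute)
      then show "\<exists>y'. (y has_vector_derivative y') (at t) \<and>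
         y' \<bullet> (P t k *v y t) + y t \<bullet> (P' t *v y t) + y t \<bullet> (P t k *v y') \<le> - (y t \<bullet> (\<Phi> t k *v y t))"
        using * t by (intro exI[of _ "- (A t k *v y t)"]) simp
    qed
    show "(\<lambda>t. - (y t \<bullet> (\<Phi> t k *v y t))) integrable_on {a..b}"
      using int by (rule integrable_neg)
  qed
  then show ?thesis by simp
qed

text \<open>
  The loss of \<open>V\<close> along flows and at jumps adds up to the hybrid integral of \<open>y \<bullet> \<Phi> y\<close>. At a jump, \<open>\<Phi>\<close> has to be
  \<open>Qd\<close>, which can fail only at a branch point, as this is interior to the flow times of its level.
\<close>

theorem V_window_decrease:
  assumes arc: "linear_arc A B (\<lambda>_ _. 0) \<tau> j m y" and seg: "segment_in D s j \<tau> m"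
    and proper: "\<And>k. k \<in> {j..<m} \<Longrightarrow> \<tau> (Suc k) \<notin> interior (flow_times D k)"
    and int: "hybrid_integrable \<tau> j m (\<lambda>t k. y t k \<bullet> (\<Phi> t k *v y t k))"
  shows "V (\<tau> (Suc m)) m (y (\<tau> (Suc m)) m) + hybrid_integral \<tau> j m (\<lambda>t k. y t k \<bullet> (\<Phi> t k *v y t k))
           \<le> V (\<tau> j) j (y (\<tau> j) j)"
proof -
  let ?q = "\<lambda>t k. y t k \<bullet> (\<Phi> t k *v y t k)"
  have flow: "V (\<tau> (Suc k)) k (y (\<tau> (Suc k)) k) + integral {\<tau> k..\<tau> (Suc k)} (\<lambda>t. ?q t k)
      \<le> V (\<tau> k) k (y (\<tau> k) k)" if k: "k \<in> {j..m}" for k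
  proof (rule V_flow_decrease)
    show "\<tau> k \<le> \<tau> (Suc k)" "abs_continuous (\<tau> k) (\<tau> (Suc k)) (\<lambda>t. y t k)"
      using arc k unfolding linear_arc_def by blast+
    show "{\<tau> k..\<tau> (Suc k)} \<subseteq> flow_times D k"
      using segment_in_mem[OF seg k] by (auto simp: flow_times_def)
    show "(\<lambda>t. ?q t k) integrable_on {\<tau> k..\<tau> (Suc k)}"
      using int k unfolding hybrid_integrable_def by blast
    have "AE t in lebesgue. t \<in> {\<tau> k<..<\<tau> (Suc k)} \<longrightarrow>
           ((\<lambda>s. y s k) has_vector_derivative (- (A t k *v y t k) + 0)) (at t)"
      using arc k unfolding linear_arc_def by blast
    then show "AE t in lebesgue. t \<in> {\<tau> k<..<\<tau> (Suc k)} \<longrightarrow>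
           ((\<lambda>s. y s k) has_vector_derivative (- (A t k *v y t k))) (at t)"
      by simp
  qed
  have jump: "V (\<tau> (Suc k)) (Suc k) (y (\<tau> (Suc k)) (Suc k)) + ?q (\<tau> (Suc k)) k
      \<le> V (\<tau> (Suc k)) k (y (\<tau> (Suc k)) k)" if k: "k \<in> {j..<m}" for k
  proof -
    have "(\<tau> (Suc k), k) \<in> D" "(\<tau> (Suc k), Suc k) \<in> D"
      using k segment_in_mono[OF seg, of k "Suc k"] segment_in_mono[OF seg, of "Suc k" "Suc (Suc k)"]
      by (auto intro!: segment_in_mem[OF seg])
    note V_jump[OF this, of "y (\<tau> (Suc k)) k"]
    moreover have "y (\<tau> (Suc k)) (Suc k) = (mat 1 - B (\<tau> (Suc k)) k) *v y (\<tau> (Suc k)) k"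
      using arc k unfolding linear_arc_def by simp
    moreover have "\<Phi> (\<tau> (Suc k)) k = Qd (\<tau> (Suc k)) k"
      using proper[OF k] by (simp add: Phi_def)
    ultimately show ?thesis by simp
  qed
  have "n \<le> m \<Longrightarrow> V (\<tau> (Suc n)) n (y (\<tau> (Suc n)) n) + hybrid_integral \<tau> j n ?q \<le> V (\<tau> j) j (y (\<tau> j) j)"
    if "j \<le> n" for n
    using that
  proof (induction n rule: dec_induct)
    case base
    then show ?case using flow[of j] by (simp add: hybrid_integral_def)
  next
    case (step n)
    have "hybrid_integral \<tau> j (Suc n) ?q = hybrid_integral \<tau> j n ?q
        + integral {\<tau> (Suc n)..\<tau> (Suc (Suc n))} (\<lambda>t. ?q t (Suc n)) + ?q (\<tau> (Suc n)) n"
      using step(1) by (simp add: hybrid_integral_def)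
    then show ?case
      using step flow[of "Suc n"] jump[of n] by simp
  qed
  moreover have "j \<le> m" using seg by (simp add: segment_in_def)
  ultimately show ?thesis by blast
qed

end

section \<open>Contraction over one observability window\<close>

context hybrid_lyapunov_pair
begin

definition growth_rate :: real where
  "growth_rate = (2 * Abar + 2) + (2 * (1 + Bbar)\<^sup>2 + 3)"

lemma growth_rate_pos: "0 < growth_rate"
  unfolding growth_rate_def using Abar_pos by (intro add_pos_nonneg) auto

lemma arc_growth_in_domain:
  assumes arc: "linear_arc A B \<nu> \<tau> j m z" and seg: "segment_in D s j \<tau> m"
    and \<nu>: "\<And>t k. (t, k) \<in> segment \<tau> j m \<Longrightarrow> t < \<tau> (Suc m) \<or> k < m \<Longrightarrow> norm (\<nu> t k) \<le> N"
  shows "(norm (z (\<tau> (Suc m)) m))\<^sup>2 + N\<^sup>2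
           \<le> exp (growth_rate * segment_length \<tau> j m) * ((norm (z (\<tau> j) j))\<^sup>2 + N\<^sup>2)"
proof (rule arc_growth_bound[OF arc])
  show "j \<le> m" using seg by (simp add: segment_in_def)
  fix k t assume k: "k \<in> {j..m}" and t: "t \<in> {\<tau> k<..<\<tau> (Suc k)}"
  have "(t, k) \<in> D" using segment_in_mem[OF seg k, of t] t by simp
  then show "matrix_norm (A t k) \<le> Abar" using AB_bounds by auto
  have "\<tau> (Suc k) \<le> \<tau> (Suc m)" using segment_in_mono[OF seg, of "Suc k" "Suc m"] k by auto
  then show "norm (\<nu> t k) \<le> N" using \<nu>[of t k] k t by (auto simp: mem_segment)
next
  fix k assume k: "k \<in> {j..<m}"
  have le: "\<tau> k \<le> \<tau> (Suc k)" using segment_in_mono[OF seg, of k "Suc k"] k by auto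
  then have "(\<tau> (Suc k), k) \<in> D" using segment_in_mem[OF seg, of k "\<tau> (Suc k)"] k by simp
  then show "matrix_norm (B (\<tau> (Suc k)) k) \<le> Bbar" using AB_bounds by auto
  show "norm (\<nu> (\<tau> (Suc k)) k) \<le> N" using \<nu>[of "\<tau> (Suc k)" k] k le by (auto simp: mem_segment)
qed (use Abar_pos Bbar_pos in \<open>auto simp: growth_rate_def\<close>)

text \<open>
  The unforced arc \<open>y\<close> from the same initial value loses the fraction \<open>\<delta>\<close> of \<open>V\<close> by observability. The
  difference \<open>z - y\<close> is an arc driven by \<open>\<nu>\<close> from zero, hence at most of size \<open>N\<close> times a constant. Young's
  inequality with weight \<open>\<delta>\<close> combines the two, with the factor \<open>(1 + \<delta>) (1 - \<delta>) = 1 - \<delta>\<^sup>2\<close>.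
\<close>

lemma window_contraction:
  assumes z: "linear_arc A B \<nu> \<tau> j m z" and y: "linear_arc A B (\<lambda>_ _. 0) \<tau> j m y"
    and start: "y (\<tau> j) j = z (\<tau> j) j" and seg: "segment_in D s j \<tau> m"
    and proper: "\<And>k. k \<in> {j..<m} \<Longrightarrow> \<tau> (Suc k) \<notin> interior (flow_times D k)"
    and int: "hybrid_integrable \<tau> j m (\<lambda>t k. y t k \<bullet> (\<Phi> t k *v y t k))"
    and obs: "\<mu> * (norm (z (\<tau> j) j))\<^sup>2 \<le> hybrid_integral \<tau> j m (\<lambda>t k. y t k \<bullet> (\<Phi> t k *v y t k))"
    and len: "segment_length \<tau> j m \<le> h"
    and \<nu>: "\<And>t k. (t, k) \<in> segment \<tau> j m \<Longrightarrow> t < \<tau> (Suc m) \<or> k < m \<Longrightarrow> norm (\<nu> t k) \<le> N"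
    and \<delta>: "0 < \<delta>" "\<delta> * p2 \<le> \<mu>"
  shows "V (\<tau> (Suc m)) m (z (\<tau> (Suc m)) m)
    \<le> (1 - \<delta>\<^sup>2) * V (\<tau> j) j (z (\<tau> j) j) + (1 + 1 / \<delta>) * (p2 * exp (growth_rate * h)) * N\<^sup>2"
proof -
  define w where "w = (\<lambda>t k. z t k - y t k)"
  have "j \<le> m" using seg by (simp add: segment_in_def)
  have startD: "(\<tau> j, j) \<in> D"
    using segment_in_mem[OF seg, of j "\<tau> j"] segment_in_mono[OF seg, of j "Suc j"] \<open>j \<le> m\<close> by simp
  have endD: "(\<tau> (Suc m), m) \<in> D"
    using segment_in_mem[OF seg, of m "\<tau> (Suc m)"] segment_in_mono[OF seg, of m "Suc m"] \<open>j \<le> m\<close> by simp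
  have "linear_arc A B (\<lambda>t k. \<nu> t k - 0) \<tau> j m w"
    unfolding w_def by (rule linear_arc_diff[OF z y])
  then have "(norm (w (\<tau> (Suc m)) m))\<^sup>2 + N\<^sup>2
      \<le> exp (growth_rate * segment_length \<tau> j m) * ((norm (w (\<tau> j) j))\<^sup>2 + N\<^sup>2)"
    by (rule arc_growth_in_domain[OF _ seg]) (use \<nu> in simp)
  also have "\<dots> = exp (growth_rate * segment_length \<tau> j m) * N\<^sup>2"
    using start by (simp add: w_def)
  also have "\<dots> \<le> exp (growth_rate * h) * N\<^sup>2"
    using len growth_rate_pos by (intro mult_right_mono) auto
  finally have w_le: "(norm (w (\<tau> (Suc m)) m))\<^sup>2 \<le> exp (growth_rate * h) * N\<^sup>2"
    using zero_le_power2[of N] by linarith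
  have "V (\<tau> (Suc m)) m (w (\<tau> (Suc m)) m) \<le> p2 * (norm (w (\<tau> (Suc m)) m))\<^sup>2"
    by (rule V_bounds(2)[OF endD])
  also have "\<dots> \<le> p2 * (exp (growth_rate * h) * N\<^sup>2)"
    using w_le p2_pos by (intro mult_left_mono) auto
  finally have Vw: "V (\<tau> (Suc m)) m (w (\<tau> (Suc m)) m) \<le> p2 * exp (growth_rate * h) * N\<^sup>2"
    by (simp add: mult.assoc)
  have "\<delta> * V (\<tau> j) j (z (\<tau> j) j) \<le> \<delta> * (p2 * (norm (z (\<tau> j) j))\<^sup>2)"
    using \<delta>(1) V_bounds(2)[OF startD] by (intro mult_left_mono) auto
  also have "\<dots> \<le> \<mu> * (norm (z (\<tau> j) j))\<^sup>2"
    using mult_right_mono[OF \<delta>(2), of "(norm (z (\<tau> j) j))\<^sup>2"] by (simp add: mult.assoc)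
  finally have Vy: "V (\<tau> (Suc m)) m (y (\<tau> (Suc m)) m) \<le> (1 - \<delta>) * V (\<tau> j) j (z (\<tau> j) j)"
    using V_window_decrease[OF y seg proper int] obs start by (simp add: algebra_simps)
  have "V (\<tau> (Suc m)) m (y (\<tau> (Suc m)) m + w (\<tau> (Suc m)) m)
      \<le> (1 + \<delta>) * V (\<tau> (Suc m)) m (y (\<tau> (Suc m)) m) + (1 + 1 / \<delta>) * V (\<tau> (Suc m)) m (w (\<tau> (Suc m)) m)"
    using P_sym endD V_bounds(3)[OF endD] \<delta>(1) by (intro quadratic_form_young) auto
  also have "\<dots> \<le> (1 + \<delta>) * ((1 - \<delta>) * V (\<tau> j) j (z (\<tau> j) j))
      + (1 + 1 / \<delta>) * (p2 * exp (growth_rate * h) * N\<^sup>2)"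
    using \<delta>(1) by (intro add_mono mult_left_mono Vy Vw) auto
  also have "(1 + \<delta>) * ((1 - \<delta>) * V (\<tau> j) j (z (\<tau> j) j)) = (1 - \<delta>\<^sup>2) * V (\<tau> j) j (z (\<tau> j) j)"
    by (simp add: power2_eq_square algebra_simps)
  finally show ?thesis by (simp add: w_def mult.assoc)
qed

end

text \<open>
  Observability with its witnesses \<open>M\<close>, \<open>K\<close> and \<open>\<mu>\<close> fixed, so that the constants below depend on them only.
\<close>

locale observable_lyapunov_pair = hybrid_lyapunov_pair D A B P Qc Qd p1 p2 Abar Bbar
  for D :: "(real \<times> nat) set"
    and A B P Qc Qd :: "real \<Rightarrow> nat \<Rightarrow> real^'n^'n"
    and p1 p2 Abar Bbar :: real +
  fixes M :: "real \<times> nat \<Rightarrow> real \<times> nat \<Rightarrow> real^'n^'n" and K \<mu> :: real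
  assumes M: "transition_matrix D A B M" and K_pos: "K > 0" and \<mu>_pos: "\<mu> > 0"
    and observable: "\<forall>(t0, j0) \<in> D. \<exists>\<tau> m. shortest_segment D t0 j0 K \<tau> m \<and>
      (let g = (\<lambda>s i. transpose (M (s, i) (t0, j0)) ** Phi D Qc Qd s i ** M (s, i) (t0, j0))
       in hybrid_integrable \<tau> j0 m g \<and> mat \<mu> \<preceq> hybrid_integral \<tau> j0 m g)"
begin

lemma observability_window:
  fixes x :: "real^'n"
  assumes "(s, i) \<in> D"
  obtains \<tau> m where "segment_in D s i \<tau> m" "K \<le> segment_length \<tau> i m" "segment_length \<tau> i m \<le> K + 1"
    "hybrid_integrable \<tau> i m (\<lambda>t k. (M (t, k) (s, i) *v x) \<bullet> (\<Phi> t k *v (M (t, k) (s, i) *v x)))"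
    "\<mu> * (norm x)\<^sup>2 \<le> hybrid_integral \<tau> i m
        (\<lambda>t k. (M (t, k) (s, i) *v x) \<bullet> (\<Phi> t k *v (M (t, k) (s, i) *v x)))"
proof -
  define g where "g = (\<lambda>t k. transpose (M (t, k) (s, i)) ** \<Phi> t k ** M (t, k) (s, i))"
  obtain \<tau> m where short: "shortest_segment D s i K \<tau> m"
    and int: "hybrid_integrable \<tau> i m g" and pos: "mat \<mu> \<preceq> hybrid_integral \<tau> i m g"
    using bspec[OF observable assms] unfolding prod.case Let_def g_def by blast
  have gx: "x \<bullet> (g t k *v x) = (M (t, k) (s, i) *v x) \<bullet> (\<Phi> t k *v (M (t, k) (s, i) *v x))" for t k x
    unfolding g_def matrix_vector_mul_assoc[symmetric] by (rule inner_transpose)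
  show thesis
  proof (rule that)
    show "segment_in D s i \<tau> m" "K \<le> segment_length \<tau> i m"
      using short unfolding shortest_segment_def by blast+
    show "segment_length \<tau> i m \<le> K + 1"
      by (rule shortest_segment_length_le[OF short K_pos])
    show "hybrid_integrable \<tau> i m (\<lambda>t k. (M (t, k) (s, i) *v x) \<bullet> (\<Phi> t k *v (M (t, k) (s, i) *v x)))"
      using hybrid_integral_quadratic_form(1)[OF int, of x] by (simp only: gx)
    have "\<mu> * (norm x)\<^sup>2 = x \<bullet> (mat \<mu> *v x)"
      by (simp add: mat_vector_mult power2_norm_eq_inner)
    also have "\<dots> \<le> x \<bullet> (hybrid_integral \<tau> i m g *v x)" by (rule psd_leD[OF pos])
    also have "\<dots> = hybrid_integral \<tau> i m
        (\<lambda>t k. (M (t, k) (s, i) *v x) \<bullet> (\<Phi> t k *v (M (t, k) (s, i) *v x)))"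
      using hybrid_integral_quadratic_form(2)[OF int, of x] by (simp only: gx)
    finally show "\<mu> * (norm x)\<^sup>2 \<le> hybrid_integral \<tau> i m
        (\<lambda>t k. (M (t, k) (s, i) *v x) \<bullet> (\<Phi> t k *v (M (t, k) (s, i) *v x)))" .
  qed
qed

text \<open>
  The fraction of \<open>V\<close> lost over a window is at least \<open>\<mu> / p2\<close>; capping it at one half keeps the
  contraction factor \<open>\<rho>\<close> positive, so that it is the exponential of a rate.
\<close>

definition \<delta> :: real where "\<delta> = min (\<mu> / p2) (1 / 2)"
definition \<rho> :: real where "\<rho> = 1 - \<delta>\<^sup>2"
definition h :: real where "h = K + 1"
definition window_gain :: real where
  "window_gain = (1 + 1 / \<delta>) * (p2 * exp (growth_rate * h))"

lemma constants: "0 < \<delta>" "\<delta> * p2 \<le> \<mu>" "0 < \<rho>" "\<rho> < 1" "0 < h" "0 < window_gain"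
proof -
  show \<delta>: "0 < \<delta>" using \<mu>_pos p2_pos by (simp add: \<delta>_def)
  have "\<delta> \<le> \<mu> / p2" by (simp add: \<delta>_def)
  then show "\<delta> * p2 \<le> \<mu>" using p2_pos by (simp add: pos_le_divide_eq)
  have "\<delta> \<le> 1 / 2" unfolding \<delta>_def by (rule min.cobounded2)
  then have "\<delta>\<^sup>2 \<le> (1 / 2)\<^sup>2" using \<delta> by (intro power_mono) auto
  then show "0 < \<rho>" by (simp add: \<rho>_def power2_eq_square)
  show "\<rho> < 1" using \<delta> by (simp add: \<rho>_def)
  show "0 < h" using K_pos by (simp add: h_def)
  show "0 < window_gain" unfolding window_gain_def using \<delta> p2_pos by (intro mult_pos_pos add_pos_pos) auto
qed

definition input_bounded_before ::
  "(real \<Rightarrow> nat \<Rightarrow> real^'n) \<Rightarrow> (real \<times> nat) set \<Rightarrow> real \<Rightarrow> nat \<Rightarrow> real \<Rightarrow> bool" where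
  "input_bounded_before \<nu> E t j N \<longleftrightarrow> (\<forall>x k. (x, k) \<in> E \<longrightarrow> x < t \<or> k < j \<longrightarrow> norm (\<nu> x k) \<le> N)"

lemma input_bounded_before_mono:
  assumes "input_bounded_before \<nu> E t j N" and "s \<le> t" "i \<le> j"
  shows "input_bounded_before \<nu> E s i N"
  using assms unfolding input_bounded_before_def by fastforce

lemma solutionD:
  assumes "solution D A B \<nu> t0 j0 z0 E z"
  shows "hybrid_time_domain_from t0 j0 E" "E \<subseteq> D" "(t0, j0) \<in> E" "z t0 j0 = z0"
  using assms unfolding solution_def by blast+

lemma solution_growth:
  assumes sol: "solution D A B \<nu> t0 j0 z0 E z" and p: "(s, i) \<in> E" and e: "(T, J) \<in> E"
    and le: "s \<le> T" "i \<le> J" and \<nu>: "input_bounded_before \<nu> E T J N"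
  shows "(norm (z T J))\<^sup>2 + N\<^sup>2
    \<le> exp (growth_rate * ((T + real J) - (s + real i))) * ((norm (z s i))\<^sup>2 + N\<^sup>2)"
proof -
  obtain \<sigma> where seg: "segment_in E s i \<sigma> J" and final: "\<sigma> (Suc J) = T"
    using segment_between[OF solutionD(1)[OF sol] p e le] .
  have segE: "segment \<sigma> i J \<subseteq> E" and start: "\<sigma> i = s" using seg by (auto simp: segment_in_def)
  have segD: "segment_in D s i \<sigma> J"
    using seg solutionD(2)[OF sol] unfolding segment_in_def by blast
  have "(norm (z (\<sigma> (Suc J)) J))\<^sup>2 + N\<^sup>2
      \<le> exp (growth_rate * segment_length \<sigma> i J) * ((norm (z (\<sigma> i) i))\<^sup>2 + N\<^sup>2)"
  proof (rule arc_growth_in_domain[OF solution_linear_arc[OF sol seg] segD])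
    fix t k assume "(t, k) \<in> segment \<sigma> i J" "t < \<sigma> (Suc J) \<or> k < J"
    then show "norm (\<nu> t k) \<le> N"
      using \<nu> segE final unfolding input_bounded_before_def by blast
  qed
  moreover have "segment_length \<sigma> i J = (T + real J) - (s + real i)"
    using le by (simp add: segment_length_def start final of_nat_diff)
  ultimately show ?thesis by (simp add: start final)
qed

text \<open>
  A jump out of an interior flow time starts a second branch, and the flowing one would reach a point
  that is incomparable with \<open>(T, J)\<close>, or contradict the order of levels below \<open>(T, J)\<close>.
\<close>

lemma unbranched_no_interior_jump:
  assumes unb: "unbranched D s i T J" and e: "(T, J) \<in> D"
    and u: "(u, k) \<in> D" "(u, Suc k) \<in> D" and "s \<le> u" "i \<le> k" "u \<le> T" "Suc k \<le> J"
  shows "u \<notin> interior (flow_times D k)"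
proof
  assume "u \<in> interior (flow_times D k)"
  then obtain r where "r > 0" and r: "ball u r \<subseteq> flow_times D k"
    by (auto simp: mem_interior)
  define x where "x = u + r / 2"
  have "x \<in> ball u r" using \<open>r > 0\<close> by (simp add: x_def dist_real_def)
  then have x: "(x, k) \<in> D" "u < x" using r \<open>r > 0\<close> by (auto simp: flow_times_def x_def)
  have "x \<le> T"
  proof (rule ccontr)
    assume "\<not> x \<le> T"
    then show False using unb x \<open>s \<le> u\<close> \<open>i \<le> k\<close> \<open>Suc k \<le> J\<close> unfolding unbranched_def by fastforce
  qed
  then have "x \<le> u"
    using lower_level_earlier[OF D_from x(1) u(2) e] \<open>u \<le> T\<close> \<open>Suc k \<le> J\<close> by simp
  with x show False by simp
qed

text \<open>
  The end of the observability window from \<open>(s, i)\<close> is comparable with \<open>(T, J)\<close> and, by length, does not lie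
  beyond it. Hence the window is part of the domain of the solution, and \<open>window_contraction\<close> applies to
  the solution and the transition matrix.
\<close>

lemma solution_window:
  assumes sol: "solution D A B \<nu> t0 j0 z0 E z" and p: "(s, i) \<in> E" and e: "(T, J) \<in> E"
    and le: "s \<le> T" "i \<le> J" and \<nu>: "input_bounded_before \<nu> E T J N"
    and unb: "unbranched D s i T J" and long: "h \<le> (T + real J) - (s + real i)"
  obtains x k where "(x, k) \<in> E" "s \<le> x" "x \<le> T" "i \<le> k" "k \<le> J"
    "K \<le> (x + real k) - (s + real i)" "(x + real k) - (s + real i) \<le> h"
    "V x k (z x k) \<le> \<rho> * V s i (z s i) + window_gain * N\<^sup>2"
proof -
  note E = solutionD(1)[OF sol] and ED = solutionD(2)[OF sol]
  have pD: "(s, i) \<in> D" and eD: "(T, J) \<in> D" using p e ED by auto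
  obtain \<tau> m where seg: "segment_in D s i \<tau> m"
    and len: "K \<le> segment_length \<tau> i m" "segment_length \<tau> i m \<le> K + 1"
    and int: "hybrid_integrable \<tau> i m
        (\<lambda>t k. (M (t, k) (s, i) *v z s i) \<bullet> (\<Phi> t k *v (M (t, k) (s, i) *v z s i)))"
    and obs: "\<mu> * (norm (z s i))\<^sup>2 \<le> hybrid_integral \<tau> i m
        (\<lambda>t k. (M (t, k) (s, i) *v z s i) \<bullet> (\<Phi> t k *v (M (t, k) (s, i) *v z s i)))"
    using observability_window[OF pD] .
  have start: "\<tau> i = s" and "i \<le> m" using seg by (auto simp: segment_in_def)
  define x where "x = \<tau> (Suc m)"
  have lenx: "segment_length \<tau> i m = (x + real m) - (s + real i)"
    using \<open>i \<le> m\<close> by (simp add: segment_length_def start x_def of_nat_diff)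
  have "(x, m) \<in> segment \<tau> i m"
    using segment_in_mono[OF seg, of m "Suc m"] \<open>i \<le> m\<close> by (simp add: mem_segment x_def)
  then have xD: "(x, m) \<in> D" and sx: "s \<le> x"
    using seg segment_in_bounds(1)[OF seg] by (auto simp: segment_in_def)
  have "x \<le> T \<and> m \<le> J"
  proof -
    have "x + real m \<le> T + real J" using len(2) long unfolding lenx h_def by linarith
    moreover have "(x \<le> T \<and> m \<le> J) \<or> (T \<le> x \<and> J \<le> m)"
      using unb xD sx \<open>i \<le> m\<close> unfolding unbranched_def by blast
    ultimately show ?thesis by linarith
  qed
  then have xT: "x \<le> T" "m \<le> J" by auto
  have bounds: "s \<le> t" "t \<le> x" "i \<le> k" "k \<le> m" if "(t, k) \<in> segment \<tau> i m" for t k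
    using segment_in_bounds[OF seg that] by (auto simp: x_def)
  have segE: "segment \<tau> i m \<subseteq> E"
  proof clarify
    fix t k assume tk: "(t, k) \<in> segment \<tau> i m"
    then have "(t, k) \<in> D" using seg by (auto simp: segment_in_def)
    moreover have "t0 \<le> s" "j0 \<le> i" using hybrid_time_domain_from_lower_bound[OF E p] .
    ultimately show "(t, k) \<in> E"
      using subdomain_mem[OF D_from E ED e, of t k] bounds[OF tk] xT by linarith
  qed
  then have seg': "segment_in E s i \<tau> m" using seg by (simp add: segment_in_def)
  have "V (\<tau> (Suc m)) m (z (\<tau> (Suc m)) m)
      \<le> (1 - \<delta>\<^sup>2) * V (\<tau> i) i (z (\<tau> i) i) + (1 + 1 / \<delta>) * (p2 * exp (growth_rate * h)) * N\<^sup>2"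
  proof (rule window_contraction[OF solution_linear_arc[OF sol seg'] _ _ seg _ _ _ _ _ constants(1,2)])
    let ?y = "\<lambda>t k. M (t, k) (s, i) *v z s i"
    show "linear_arc A B (\<lambda>_ _. 0) \<tau> i m ?y"
      by (rule transition_matrix_linear_arc[OF M pD seg])
    have "M (s, i) (s, i) = mat 1"
      using bspec[OF M[unfolded transition_matrix_def] pD, unfolded prod.case] by blast
    then show "M (\<tau> i, i) (s, i) *v z s i = z (\<tau> i) i" by (simp add: start)
    show "hybrid_integrable \<tau> i m (\<lambda>t k. ?y t k \<bullet> (\<Phi> t k *v ?y t k))" by (rule int)
    show "\<mu> * (norm (z (\<tau> i) i))\<^sup>2 \<le> hybrid_integral \<tau> i m (\<lambda>t k. ?y t k \<bullet> (\<Phi> t k *v ?y t k))"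
      using obs by (simp add: start)
    show "segment_length \<tau> i m \<le> h" using len(2) by (simp add: h_def)
    show "norm (\<nu> t k) \<le> N" if tk: "(t, k) \<in> segment \<tau> i m" and lt: "t < \<tau> (Suc m) \<or> k < m" for t k
    proof -
      have "t < T \<or> k < J" using lt xT by (auto simp: x_def)
      then show ?thesis using \<nu> segE tk unfolding input_bounded_before_def by blast
    qed
    fix k assume k: "k \<in> {i..<m}"
    have "(\<tau> (Suc k), k) \<in> segment \<tau> i m" "(\<tau> (Suc k), Suc k) \<in> segment \<tau> i m"
      using k segment_in_mono[OF seg, of k "Suc k"] segment_in_mono[OF seg, of "Suc k" "Suc (Suc k)"]
      by (auto simp: mem_segment)
    then show "\<tau> (Suc k) \<notin> interior (flow_times D k)"
      using bounds[of "\<tau> (Suc k)" k] k xT seg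
      by (intro unbranched_no_interior_jump[OF unb eD]) (auto simp: segment_in_def)
  qed
  then have "V x m (z x m) \<le> \<rho> * V s i (z s i) + window_gain * N\<^sup>2"
    by (simp add: x_def start \<rho>_def window_gain_def)
  moreover have "(x, m) \<in> E" using \<open>(x, m) \<in> segment \<tau> i m\<close> segE by blast
  ultimately show thesis
    using that[of x m] sx xT \<open>i \<le> m\<close> len lenx h_def by simp
qed

end

section \<open>Decay, exponential stability and input-to-state stability\<close>

lemma class_KL_exponential:
  assumes "0 < c" "0 < \<gamma>"
  shows "class_KL (\<lambda>r s. c * r * exp (- \<gamma> * s))"
  unfolding class_KL_def
proof (intro conjI allI impI)
  show "continuous_on ({0..} \<times> {0..}) (\<lambda>(r, s). c * r * exp (- \<gamma> * s))"
    by (simp add: case_prod_unfold) (intro continuous_intros)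
  show "class_K (\<lambda>r. c * r * exp (- \<gamma> * s))" for s
    unfolding class_K_def using assms
    by (auto intro!: continuous_intros strict_mono_onI)
  fix r :: real assume "0 \<le> r"
  show "antimono_on {0..} (\<lambda>s. c * r * exp (- \<gamma> * s))"
    using assms \<open>0 \<le> r\<close> by (intro monotone_onI mult_left_mono) auto
  have "((\<lambda>s. exp (- \<gamma> * s)) \<longlongrightarrow> 0) at_top"
    by (rule filterlim_compose[OF exp_at_bot
          filterlim_tendsto_neg_mult_at_bot[OF tendsto_const _ filterlim_ident]]) (use assms(2) in simp)
  from tendsto_mult_right_zero[OF this, of "c * r"]
  show "((\<lambda>s. c * r * exp (- \<gamma> * s)) \<longlongrightarrow> 0) at_top" .
qed

lemma class_K_inf_linear:
  assumes "0 < c"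
  shows "class_K_inf (\<lambda>r. c * r)"
  unfolding class_K_inf_def class_K_def
proof (intro conjI)
  show "strict_mono_on {0..} (\<lambda>r. c * r)" using assms by (auto intro!: strict_mono_onI)
  show "filterlim (\<lambda>r. c * r) at_top at_top"
    by (rule filterlim_tendsto_pos_mult_at_top[OF tendsto_const assms filterlim_ident])
qed (auto intro!: continuous_intros)

context observable_lyapunov_pair
begin

text \<open>
  The rate turns the factor \<open>\<rho>\<close> per window of length at most \<open>h\<close> into an exponential. The map
  \<open>V \<mapsto> \<rho> V + window_gain N\<^sup>2\<close> has the fixed point \<open>offset N\<^sup>2\<close>, and the excess of \<open>V\<close> over it
  is what contracts.
\<close>

definition decay_rate :: real where "decay_rate = - ln \<rho> / h"
definition offset :: real where "offset = window_gain / (1 - \<rho>)"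
definition overshoot :: real where "overshoot = p2 * exp (growth_rate * h) * (1 / p1 + 1)"

lemma decay_constants: "0 < decay_rate" "exp (- decay_rate * h) = \<rho>" "0 < offset"
  "window_gain = (1 - \<rho>) * offset" "0 < overshoot"
proof -
  show "0 < decay_rate" using constants by (simp add: decay_rate_def divide_neg_pos)
  show "exp (- decay_rate * h) = \<rho>" using constants by (simp add: decay_rate_def)
  show "0 < offset" "window_gain = (1 - \<rho>) * offset" using constants by (simp_all add: offset_def)
  show "0 < overshoot" using p1_pos p2_pos by (simp add: overshoot_def add_pos_pos)
qed

lemma short_growth:
  assumes sol: "solution D A B \<nu> t0 j0 z0 E z" and p: "(s, i) \<in> E" and e: "(T, J) \<in> E"
    and le: "s \<le> T" "i \<le> J" and \<nu>: "input_bounded_before \<nu> E T J N"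
    and short: "(T + real J) - (s + real i) \<le> h"
  shows "V T J (z T J) \<le> overshoot * (V s i (z s i) + N\<^sup>2)"
proof -
  have pD: "(s, i) \<in> D" and eD: "(T, J) \<in> D" using p e solutionD(2)[OF sol] by auto
  have "(norm (z T J))\<^sup>2 \<le> exp (growth_rate * ((T + real J) - (s + real i))) * ((norm (z s i))\<^sup>2 + N\<^sup>2)"
    using solution_growth[OF sol p e le \<nu>] zero_le_power2[of N] by linarith
  also have "\<dots> \<le> exp (growth_rate * h) * ((norm (z s i))\<^sup>2 + N\<^sup>2)"
    using short growth_rate_pos by (intro mult_right_mono) auto
  also have "\<dots> \<le> exp (growth_rate * h) * ((1 / p1 + 1) * (V s i (z s i) + N\<^sup>2))"
  proof (rule mult_left_mono)
    have "(norm (z s i))\<^sup>2 \<le> 1 / p1 * V s i (z s i)"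
      using V_bounds(1)[OF pD, of "z s i"] p1_pos by (simp add: pos_le_divide_eq mult.commute)
    moreover have "0 \<le> 1 / p1 * N\<^sup>2" using p1_pos by simp
    ultimately show "(norm (z s i))\<^sup>2 + N\<^sup>2 \<le> (1 / p1 + 1) * (V s i (z s i) + N\<^sup>2)"
      using V_bounds(3)[OF pD, of "z s i"] by (simp add: distrib_right distrib_left)
  qed simp
  finally have "p2 * (norm (z T J))\<^sup>2 \<le> p2 * (exp (growth_rate * h) * ((1 / p1 + 1) * (V s i (z s i) + N\<^sup>2)))"
    using p2_pos by (intro mult_left_mono) auto
  then show ?thesis
    using V_bounds(2)[OF eD, of "z T J"] by (simp add: overshoot_def mult.assoc)
qed

lemma short_V_decay:
  assumes sol: "solution D A B \<nu> t0 j0 z0 E z" and e: "(T, J) \<in> E"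
    and \<nu>: "input_bounded_before \<nu> E T J N" and p: "(s, i) \<in> E" and le: "s \<le> T" "i \<le> J"
    and short: "(T + real J) - (s + real i) \<le> h"
  shows "V T J (z T J) \<le> overshoot * (exp (- decay_rate * ((T + real J) - (s + real i) - h))
        * max 0 (V s i (z s i) - offset * N\<^sup>2) + (offset + 1) * N\<^sup>2)"
proof -
  let ?Z = "max 0 (V s i (z s i) - offset * N\<^sup>2)"
  have "decay_rate * ((T + real J) - (s + real i) - h) \<le> 0"
    using short decay_constants(1) by (simp add: mult_le_0_iff)
  then have "1 \<le> exp (- decay_rate * ((T + real J) - (s + real i) - h))" by simp
  then have "?Z \<le> exp (- decay_rate * ((T + real J) - (s + real i) - h)) * ?Z"
    using mult_right_mono[of 1 "exp (- decay_rate * ((T + real J) - (s + real i) - h))" ?Z] by simp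
  then have "V s i (z s i) + N\<^sup>2 \<le> exp (- decay_rate * ((T + real J) - (s + real i) - h)) * ?Z + (offset + 1) * N\<^sup>2"
    by (simp add: algebra_simps)
  then have "overshoot * (V s i (z s i) + N\<^sup>2)
      \<le> overshoot * (exp (- decay_rate * ((T + real J) - (s + real i) - h)) * ?Z + (offset + 1) * N\<^sup>2)"
    using decay_constants(5) by (intro mult_left_mono) auto
  then show ?thesis using short_growth[OF sol p e le \<nu> short] by linarith
qed

text \<open>
  Induction on the number of windows of length at least \<open>K\<close>. Stating the bound for the excess of \<open>V\<close> over
  the fixed point keeps the contributions of the input from accumulating. The remainder, shorter than a window,
  is paid for once by the growth bound.
\<close>

lemma unbranched_V_decay:
  assumes sol: "solution D A B \<nu> t0 j0 z0 E z" and e: "(T, J) \<in> E"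
    and \<nu>: "input_bounded_before \<nu> E T J N"
  shows "\<lbrakk>(s, i) \<in> E; s \<le> T; i \<le> J; unbranched D s i T J; (T + real J) - (s + real i) \<le> real n * K\<rbrakk> \<Longrightarrow>
    V T J (z T J) \<le> overshoot * (exp (- decay_rate * ((T + real J) - (s + real i) - h))
        * max 0 (V s i (z s i) - offset * N\<^sup>2) + (offset + 1) * N\<^sup>2)"
proof (induction n arbitrary: s i)
  case (0 s i)
  then have "(T + real J) - (s + real i) \<le> h" using constants(5) by simp
  from short_V_decay[OF sol e \<nu> 0(1-3) this] show ?case .
next
  case (Suc n s i)
  let ?L = "(T + real J) - (s + real i)"
  show ?case
  proof (cases "?L \<le> h")
    case True
    from short_V_decay[OF sol e \<nu> Suc.prems(1-3) this] show ?thesis .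
  next
    case False
    then have "h \<le> ?L" by simp
    obtain x k where x: "(x, k) \<in> E" "s \<le> x" "x \<le> T" "i \<le> k" "k \<le> J"
      and adv: "K \<le> (x + real k) - (s + real i)" "(x + real k) - (s + real i) \<le> h"
      and contr: "V x k (z x k) \<le> \<rho> * V s i (z s i) + window_gain * N\<^sup>2"
      using solution_window[OF sol Suc.prems(1) e Suc.prems(2,3) \<nu> Suc.prems(4) \<open>h \<le> ?L\<close>] .
    have "unbranched D x k T J"
      using Suc.prems(4) x(2,4) unfolding unbranched_def by (meson order_trans)
    moreover have "(T + real J) - (x + real k) \<le> real n * K"
      using Suc.prems(5) adv(1) by (simp add: algebra_simps)
    ultimately have IH: "V T J (z T J) \<le> overshoot * (exp (- decay_rate * ((T + real J) - (x + real k) - h))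
        * max 0 (V x k (z x k) - offset * N\<^sup>2) + (offset + 1) * N\<^sup>2)"
      using Suc.IH[OF x(1,3,5)] by blast
    have "V x k (z x k) - offset * N\<^sup>2 \<le> \<rho> * (V s i (z s i) - offset * N\<^sup>2)"
      using contr unfolding decay_constants(4) by (simp add: algebra_simps)
    also have "\<dots> \<le> \<rho> * max 0 (V s i (z s i) - offset * N\<^sup>2)"
      using constants(3) by (intro mult_left_mono) auto
    finally have excess: "max 0 (V x k (z x k) - offset * N\<^sup>2) \<le> \<rho> * max 0 (V s i (z s i) - offset * N\<^sup>2)"
      using constants(3) by simp
    have "- decay_rate * ((T + real J) - (x + real k) - h) \<le> - decay_rate * (?L - h) + decay_rate * h"
    proof -
      have "decay_rate * (?L - h - h) \<le> decay_rate * ((T + real J) - (x + real k) - h)"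
        using adv(2) decay_constants(1) by (intro mult_left_mono) auto
      then show ?thesis by (simp add: algebra_simps)
    qed
    then have "exp (- decay_rate * ((T + real J) - (x + real k) - h))
        \<le> exp (- decay_rate * (?L - h)) * exp (decay_rate * h)"
      by (simp add: exp_add[symmetric])
    also have "exp (decay_rate * h) = 1 / \<rho>"
      using decay_constants(2) constants(3) by (simp add: exp_minus field_simps)
    finally have rate: "exp (- decay_rate * ((T + real J) - (x + real k) - h))
        \<le> exp (- decay_rate * (?L - h)) * (1 / \<rho>)" .
    have "exp (- decay_rate * ((T + real J) - (x + real k) - h)) * max 0 (V x k (z x k) - offset * N\<^sup>2)
        \<le> (exp (- decay_rate * (?L - h)) * (1 / \<rho>)) * (\<rho> * max 0 (V s i (z s i) - offset * N\<^sup>2))"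
      using constants(3) by (intro mult_mono rate excess) auto
    also have "\<dots> = exp (- decay_rate * (?L - h)) * max 0 (V s i (z s i) - offset * N\<^sup>2)"
      using constants(3) by simp
    finally have "overshoot * (exp (- decay_rate * ((T + real J) - (x + real k) - h))
        * max 0 (V x k (z x k) - offset * N\<^sup>2) + (offset + 1) * N\<^sup>2)
      \<le> overshoot * (exp (- decay_rate * (?L - h)) * max 0 (V s i (z s i) - offset * N\<^sup>2) + (offset + 1) * N\<^sup>2)"
      using decay_constants(5) by (intro mult_left_mono) auto
    with IH show ?thesis by linarith
  qed
qed

definition decay_gain :: real where "decay_gain = overshoot * exp (decay_rate * h) * p2 / p1"
definition input_gain :: real where "input_gain = overshoot * (offset + 1) / p1"

lemma gains_pos: "0 < decay_gain" "0 < input_gain"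
  using decay_constants p1_pos p2_pos by (simp_all add: decay_gain_def input_gain_def)

lemma unbranched_decay:
  assumes sol: "solution D A B \<nu> t0 j0 z0 E z" and p: "(s, i) \<in> E" and e: "(T, J) \<in> E"
    and le: "s \<le> T" "i \<le> J" and \<nu>: "input_bounded_before \<nu> E T J N" and unb: "unbranched D s i T J"
  shows "(norm (z T J))\<^sup>2 \<le> decay_gain * exp (- decay_rate * ((T + real J) - (s + real i))) * (norm (z s i))\<^sup>2
           + input_gain * N\<^sup>2"
proof -
  let ?L = "(T + real J) - (s + real i)"
  have pD: "(s, i) \<in> D" and eD: "(T, J) \<in> D" using p e solutionD(2)[OF sol] by auto
  obtain n where "?L / K \<le> real n" using real_arch_simple by blast
  then have "?L \<le> real n * K" using K_pos by (simp add: pos_divide_le_eq)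
  from unbranched_V_decay[OF sol e \<nu> p le unb this]
  have V_le: "V T J (z T J) \<le> overshoot * (exp (- decay_rate * (?L - h))
        * max 0 (V s i (z s i) - offset * N\<^sup>2) + (offset + 1) * N\<^sup>2)" .
  have "0 \<le> offset * N\<^sup>2" using decay_constants(3) by simp
  then have "max 0 (V s i (z s i) - offset * N\<^sup>2) \<le> p2 * (norm (z s i))\<^sup>2"
    using V_bounds(2,3)[OF pD, of "z s i"] by linarith
  then have "exp (- decay_rate * (?L - h)) * max 0 (V s i (z s i) - offset * N\<^sup>2)
      \<le> exp (- decay_rate * (?L - h)) * (p2 * (norm (z s i))\<^sup>2)"
    by (rule mult_left_mono) simp
  then have "overshoot * (exp (- decay_rate * (?L - h)) * max 0 (V s i (z s i) - offset * N\<^sup>2) + (offset + 1) * N\<^sup>2)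
      \<le> overshoot * (exp (- decay_rate * (?L - h)) * (p2 * (norm (z s i))\<^sup>2) + (offset + 1) * N\<^sup>2)"
    using decay_constants(5) by (intro mult_left_mono) auto
  with V_le V_bounds(1)[OF eD, of "z T J"]
  have "p1 * (norm (z T J))\<^sup>2
      \<le> overshoot * (exp (- decay_rate * (?L - h)) * (p2 * (norm (z s i))\<^sup>2) + (offset + 1) * N\<^sup>2)"
    by linarith
  then have "(norm (z T J))\<^sup>2
      \<le> overshoot * (exp (- decay_rate * (?L - h)) * (p2 * (norm (z s i))\<^sup>2) + (offset + 1) * N\<^sup>2) / p1"
    using p1_pos by (simp add: pos_le_divide_eq mult.commute)
  also have "- decay_rate * (?L - h) = decay_rate * h + (- decay_rate * ?L)"
    by (simp add: algebra_simps)
  also have "overshoot * (exp (decay_rate * h + (- decay_rate * ?L)) * (p2 * (norm (z s i))\<^sup>2) + (offset + 1) * N\<^sup>2) / p1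
      = decay_gain * exp (- decay_rate * ?L) * (norm (z s i))\<^sup>2 + input_gain * N\<^sup>2"
    unfolding exp_add decay_gain_def input_gain_def using p1_pos by (simp add: field_simps)
  finally show ?thesis .
qed

text \<open>
  Without a branch ahead this is \<open>unbranched_decay\<close>. Otherwise the decay estimates before and after
  the branch point are chained through a step of length at most one, whose cost
  \<open>exp growth_rate\<close> and whose lost decay \<open>exp decay_rate\<close> enter the constants.
\<close>

theorem solution_decay:
  shows "\<exists>a>0. \<exists>d>0. \<forall>\<nu> t0 j0 z0 E z T J N.
    solution D A B \<nu> t0 j0 z0 E z \<and> (T, J) \<in> E \<and> input_bounded_before \<nu> E T J N \<longrightarrow>
    (norm (z T J))\<^sup>2 \<le> a * exp (- decay_rate * (T + real J - t0 - real j0)) * (norm z0)\<^sup>2 + d * N\<^sup>2"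
proof -
  define b where "b = exp growth_rate"
  define a where "a = decay_gain + decay_gain * b * decay_gain * exp decay_rate"
  define d where "d = input_gain + decay_gain * b * (input_gain + 1)"
  have pos: "0 < decay_gain" "0 < input_gain" "0 < b" using gains_pos by (simp_all add: b_def)
  have "0 < a" "0 < d" using pos by (auto simp: a_def d_def intro!: add_pos_pos mult_pos_pos)
  have "(norm (z T J))\<^sup>2 \<le> a * exp (- decay_rate * ((T + real J) - (t0 + real j0))) * (norm z0)\<^sup>2 + d * N\<^sup>2"
    if sol: "solution D A B \<nu> t0 j0 z0 E z" and e: "(T, J) \<in> E" and \<nu>: "input_bounded_before \<nu> E T J N"
    for \<nu> t0 j0 z0 E z T J N
  proof -
    note E = solutionD(1)[OF sol] and ED = solutionD(2)[OF sol] and p = solutionD(3)[OF sol]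
    note lb = hybrid_time_domain_from_lower_bound[OF E]
    let ?x = "exp (- decay_rate * ((T + real J) - (t0 + real j0)))"
    have "a * ?x * (norm z0)\<^sup>2 + d * N\<^sup>2 = (decay_gain * ?x * (norm z0)\<^sup>2 + input_gain * N\<^sup>2)
        + (decay_gain * b * (decay_gain * exp decay_rate) * ?x * (norm z0)\<^sup>2 + decay_gain * b * (input_gain + 1) * N\<^sup>2)"
      by (simp add: a_def d_def algebra_simps)
    moreover have "0 \<le> decay_gain * b * (decay_gain * exp decay_rate) * ?x * (norm z0)\<^sup>2 + decay_gain * b * (input_gain + 1) * N\<^sup>2"
      using pos by simp
    ultimately have direct: "decay_gain * ?x * (norm z0)\<^sup>2 + input_gain * N\<^sup>2 \<le> a * ?x * (norm z0)\<^sup>2 + d * N\<^sup>2"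
      by linarith
    from split_at_branch[OF D_from subsetD[OF ED p] subsetD[OF ED e] lb[OF e]]
    show ?thesis
    proof (elim disjE exE conjE)
      assume "unbranched D t0 j0 T J"
      from unbranched_decay[OF sol p e lb[OF e] \<nu> this] direct show ?thesis
        by (simp add: solutionD(4)[OF sol])
    next
      fix t1 j1 t2 j2
      assume in_D: "(t1, j1) \<in> D" "(t2, j2) \<in> D"
        and t: "t0 \<le> t1" "t1 \<le> t2" "t2 \<le> T" and j: "j0 \<le> j1" "j1 \<le> j2" "j2 \<le> J"
        and gap: "(t2 + real j2) - (t1 + real j1) \<le> 1"
        and unb: "unbranched D t0 j0 t1 j1" "unbranched D t2 j2 T J"
      have e1: "(t1, j1) \<in> E" and e2: "(t2, j2) \<in> E"
        using t j in_D by (auto intro!: subdomain_mem[OF D_from E ED e])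
      have \<nu>1: "input_bounded_before \<nu> E t1 j1 N" and \<nu>2: "input_bounded_before \<nu> E t2 j2 N"
        using t j by (auto intro!: input_bounded_before_mono[OF \<nu>])
      let ?x1 = "exp (- decay_rate * ((t1 + real j1) - (t0 + real j0)))"
      let ?x3 = "exp (- decay_rate * ((T + real J) - (t2 + real j2)))"
      have s1: "(norm (z t1 j1))\<^sup>2 \<le> decay_gain * ?x1 * (norm z0)\<^sup>2 + input_gain * N\<^sup>2"
        using unbranched_decay[OF sol p e1 t(1) j(1) \<nu>1 unb(1)] by (simp add: solutionD(4)[OF sol])
      have "(norm (z t2 j2))\<^sup>2
          \<le> exp (growth_rate * ((t2 + real j2) - (t1 + real j1))) * ((norm (z t1 j1))\<^sup>2 + N\<^sup>2)"
        using solution_growth[OF sol e1 e2 t(2) j(2) \<nu>2] zero_le_power2[of N] by linarith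
      also have "\<dots> \<le> b * ((norm (z t1 j1))\<^sup>2 + N\<^sup>2)"
        unfolding b_def using gap growth_rate_pos mult_left_mono[OF gap, of growth_rate]
        by (intro mult_right_mono) auto
      also have "\<dots> \<le> b * (decay_gain * ?x1 * (norm z0)\<^sup>2 + (input_gain + 1) * N\<^sup>2)"
        using s1 pos by (intro mult_left_mono) (auto simp: algebra_simps)
      finally have s2: "(norm (z t2 j2))\<^sup>2 \<le> b * (decay_gain * ?x1 * (norm z0)\<^sup>2 + (input_gain + 1) * N\<^sup>2)" .
      have x3: "?x3 \<le> 1"
        using t j decay_constants(1) by (simp add: mult_nonneg_nonneg)
      have x13: "?x3 * ?x1 \<le> exp decay_rate * ?x"
      proof -
        have "decay_rate * ((t2 + real j2) - (t1 + real j1)) \<le> decay_rate"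
          using mult_left_mono[OF gap, of decay_rate] decay_constants(1) by simp
        then show ?thesis unfolding exp_add[symmetric] exp_le_cancel_iff by (simp add: algebra_simps)
      qed
      have "(norm (z T J))\<^sup>2 \<le> decay_gain * ?x3 * (norm (z t2 j2))\<^sup>2 + input_gain * N\<^sup>2"
        by (rule unbranched_decay[OF sol e2 e t(3) j(3) \<nu> unb(2)])
      also have "\<dots> \<le> decay_gain * ?x3 * (b * (decay_gain * ?x1 * (norm z0)\<^sup>2 + (input_gain + 1) * N\<^sup>2)) + input_gain * N\<^sup>2"
        using s2 pos by (intro add_mono mult_left_mono) auto
      also have "\<dots> = decay_gain * b * decay_gain * (norm z0)\<^sup>2 * (?x3 * ?x1)
          + decay_gain * b * (input_gain + 1) * N\<^sup>2 * ?x3 + input_gain * N\<^sup>2"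
        by (simp add: algebra_simps)
      also have "\<dots> \<le> decay_gain * b * decay_gain * (norm z0)\<^sup>2 * (exp decay_rate * ?x)
          + decay_gain * b * (input_gain + 1) * N\<^sup>2 * 1 + input_gain * N\<^sup>2"
        using pos by (intro add_mono mult_left_mono x13 x3 order_refl) auto
      also have "\<dots> \<le> a * ?x * (norm z0)\<^sup>2 + d * N\<^sup>2"
      proof -
        have "0 \<le> decay_gain * ?x * (norm z0)\<^sup>2" using pos by simp
        then show ?thesis by (simp add: a_def d_def algebra_simps)
      qed
      finally show ?thesis .
    qed
  qed
  then show ?thesis
    using \<open>0 < a\<close> \<open>0 < d\<close> by (intro exI[of _ a] exI[of _ d] conjI allI impI) (auto simp: diff_diff_add)
qed

theorem exponentially_stable: "UES D A B"
proof -
  obtain a d where "a > 0" and decay: "\<forall>\<nu> t0 j0 z0 E z T J N.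
    solution D A B \<nu> t0 j0 z0 E z \<and> (T, J) \<in> E \<and> input_bounded_before \<nu> E T J N \<longrightarrow>
    (norm (z T J))\<^sup>2 \<le> a * exp (- decay_rate * (T + real J - t0 - real j0)) * (norm z0)\<^sup>2 + d * N\<^sup>2"
    using solution_decay by blast
  have bound: "norm (z T J) \<le> sqrt a * norm z0 * exp (- (decay_rate / 2) * (T + real J - t0 - real j0))"
    if sol: "solution D A B (\<lambda>_ _. 0) t0 j0 z0 E z" and e: "(T, J) \<in> E" for t0 j0 z0 E z T J
  proof (rule power2_le_imp_le)
    let ?L = "T + real J - t0 - real j0"
    have "input_bounded_before (\<lambda>_ _. 0) E T J 0" by (simp add: input_bounded_before_def)
    with decay sol e have "(norm (z T J))\<^sup>2 \<le> a * exp (- decay_rate * ?L) * (norm z0)\<^sup>2 + d * 0\<^sup>2"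
      by blast
    also have "exp (- decay_rate * ?L) = (exp (- (decay_rate / 2) * ?L))\<^sup>2"
      by (simp add: exp_double[symmetric])
    finally show "(norm (z T J))\<^sup>2 \<le> (sqrt a * norm z0 * exp (- (decay_rate / 2) * ?L))\<^sup>2"
      using \<open>a > 0\<close> by (simp add: power_mult_distrib mult_ac)
  qed (use \<open>a > 0\<close> in simp)
  show ?thesis
    unfolding UES_def
  proof (intro exI conjI)
    show "0 < sqrt a" "0 < decay_rate / 2" using \<open>a > 0\<close> decay_constants(1) by simp_all
    show "\<forall>t0 j0 z0 E z. (t0, j0) \<in> D \<and> solution D A B (\<lambda>_ _. 0) t0 j0 z0 E z \<longrightarrow>
        (\<forall>(t, j) \<in> E. norm (z t j)
           \<le> sqrt a * norm z0 * exp (- (decay_rate / 2) * (t + real j - t0 - real j0)))"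
      using bound by blast
  qed
qed

theorem input_to_state_stable: "ISS D A B"
proof -
  obtain a d where "a > 0" "d > 0" and decay: "\<forall>\<nu> t0 j0 z0 E z T J N.
    solution D A B \<nu> t0 j0 z0 E z \<and> (T, J) \<in> E \<and> input_bounded_before \<nu> E T J N \<longrightarrow>
    (norm (z T J))\<^sup>2 \<le> a * exp (- decay_rate * (T + real J - t0 - real j0)) * (norm z0)\<^sup>2 + d * N\<^sup>2"
    using solution_decay by blast
  have bound: "norm (z T J) \<le> sqrt a * norm z0 * exp (- (decay_rate / 2) * (T + real J - t0 - real j0))
      + sqrt d * Sup (insert 0 N)"
    if sol: "solution D A B \<nu> t0 j0 z0 E z" and e: "(T, J) \<in> tail_from E t0 j0"
      and N: "N = (\<lambda>(s, i). norm (\<nu> s i)) ` (E - tail_from E T J)" and bdd: "bdd_above N"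
    for \<nu> t0 j0 z0 E z T J N
  proof (rule power2_le_imp_le)
    let ?L = "T + real J - t0 - real j0" and ?N = "Sup (insert 0 N)"
    have "(T, J) \<in> E" using e by (simp add: tail_from_def)
    have sup: "y \<le> ?N" if "y \<in> insert 0 N" for y
      using that bdd by (intro cSup_upper) auto
    have "input_bounded_before \<nu> E T J ?N"
      unfolding input_bounded_before_def
    proof (intro allI impI)
      fix x k assume "(x, k) \<in> E" "x < T \<or> k < J"
      then have "(x, k) \<in> E - tail_from E T J" by (auto simp: tail_from_def)
      then have "norm (\<nu> x k) \<in> N" unfolding N by (rule rev_image_eqI) simp
      then show "norm (\<nu> x k) \<le> ?N" by (intro sup) simp
    qed
    with decay sol \<open>(T, J) \<in> E\<close> have "(norm (z T J))\<^sup>2 \<le> a * exp (- decay_rate * ?L) * (norm z0)\<^sup>2 + d * ?N\<^sup>2"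
      by blast
    also have "exp (- decay_rate * ?L) = (exp (- (decay_rate / 2) * ?L))\<^sup>2"
      by (simp add: exp_double[symmetric])
    also have "a * (exp (- (decay_rate / 2) * ?L))\<^sup>2 * (norm z0)\<^sup>2 + d * ?N\<^sup>2
        = (sqrt a * norm z0 * exp (- (decay_rate / 2) * ?L))\<^sup>2 + (sqrt d * ?N)\<^sup>2"
      using \<open>a > 0\<close> \<open>d > 0\<close> by (simp add: power_mult_distrib mult_ac)
    also have "\<dots> \<le> (sqrt a * norm z0 * exp (- (decay_rate / 2) * ?L) + sqrt d * ?N)\<^sup>2"
    proof -
      have "0 \<le> (sqrt a * norm z0 * exp (- (decay_rate / 2) * ?L)) * (sqrt d * ?N)"
        using sup[of 0] \<open>a > 0\<close> \<open>d > 0\<close> by (intro mult_nonneg_nonneg) auto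
      then show ?thesis unfolding power2_sum by linarith
    qed
    finally show "(norm (z T J))\<^sup>2 \<le> (sqrt a * norm z0 * exp (- (decay_rate / 2) * ?L) + sqrt d * ?N)\<^sup>2" .
    show "0 \<le> sqrt a * norm z0 * exp (- (decay_rate / 2) * ?L) + sqrt d * ?N"
      using sup[of 0] \<open>a > 0\<close> \<open>d > 0\<close> by (intro add_nonneg_nonneg mult_nonneg_nonneg) auto
  qed
  show ?thesis
    unfolding ISS_def
  proof (intro exI conjI)
    show "class_K_inf (\<lambda>r. sqrt d * r)" using \<open>d > 0\<close> by (intro class_K_inf_linear) simp
    show "class_KL (\<lambda>r s. sqrt a * r * exp (- (decay_rate / 2) * s))"
      using \<open>a > 0\<close> decay_constants(1) by (intro class_KL_exponential) auto
    show "\<forall>\<nu> t0 j0 z0 E z. (t0, j0) \<in> D \<and> solution D A B \<nu> t0 j0 z0 E z \<longrightarrow>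
        (\<forall>(t, j) \<in> tail_from E t0 j0.
           let N = (\<lambda>(s, i). norm (\<nu> s i)) ` (E - tail_from E t j) in
           bdd_above N \<longrightarrow>
           norm (z t j) \<le> sqrt a * norm z0 * exp (- (decay_rate / 2) * (t + real j - t0 - real j0))
             + sqrt d * Sup (insert 0 N))"
      unfolding Let_def using bound by blast
  qed
qed

end

theorem theorem2:
  fixes D :: "(real \<times> nat) set"
    and A B P Qc Qd :: "real \<Rightarrow> nat \<Rightarrow> real^'n^'n"
    and p1 p2 Abar Bbar :: real
  assumes "hybrid_time_domain D"
    and "\<forall>(t, j) \<in> D. sym_matrix (P t j)"
    and "\<forall>j. continuous_on (flow_times D j) (\<lambda>t. P t j)"
    and "p1 > 0" and "p2 > 0"
    and "\<forall>(t, j) \<in> D. mat p1 \<preceq> P t j \<and> P t j \<preceq> mat p2"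
    and "\<forall>(t, j) \<in> D. psd (Qc t j) \<and> psd (Qd t j)"
    and "\<forall>j. \<forall>t \<in> interior (flow_times D j).
           \<exists>P'. ((\<lambda>s. P s j) has_vector_derivative P') (at t) \<and>
             P' - transpose (A t j) ** P t j - P t j ** A t j \<preceq> - Qc t j"
    and "\<forall>t j. (t, j) \<in> D \<and> (t, Suc j) \<in> D \<longrightarrow>
           transpose (mat 1 - B t j) ** P t (Suc j) ** (mat 1 - B t j) - P t j \<preceq> - Qd t j"
    and "Abar > 0" and "Bbar > 0"
    and "\<forall>(t, j) \<in> D. matrix_norm (A t j) \<le> Abar \<and> matrix_norm (B t j) \<le> Bbar"
    and "HUO D A B Qc Qd"
  shows "UES D A B \<and> ISS D A B"
proof -
  interpret hybrid_lyapunov_pair D A B P Qc Qd p1 p2 Abar Bbar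
    by unfold_locales (fact assms(1-12))+
  obtain M K \<mu> where "transition_matrix D A B M" "K > 0" "\<mu> > 0"
    "\<forall>(t0, j0) \<in> D. \<exists>\<tau> m. shortest_segment D t0 j0 K \<tau> m \<and>
      (let g = (\<lambda>s i. transpose (M (s, i) (t0, j0)) ** Phi D Qc Qd s i ** M (s, i) (t0, j0))
       in hybrid_integrable \<tau> j0 m g \<and> mat \<mu> \<preceq> hybrid_integral \<tau> j0 m g)"
    using assms(13) unfolding HUO_def by (elim exE conjE) 
  then interpret observable_lyapunov_pair D A B P Qc Qd p1 p2 Abar Bbar M K \<mu>
    by unfold_locales
  show ?thesis using exponentially_stable input_to_state_stable by (rule conjI)
qed

end
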